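(* For $n=1,2$ let $\Psi_n\subset\mathcal{H}_n$ be an $\mathcal{A}_n$-localised frame for the separable Hilbert space $\mathcal{H}_n$, and let $w_n$ be an $\mathcal{A}_n$-admissible weight. Then $$\mathcal{H}^{1,1}_{w_1\otimes w_2}(\Psi_1\otimes\Psi_2)=\mathcal{H}^1_{w_1}(\Psi_1)\,\widehat\otimes_\pi\,\mathcal{H}^1_{w_2}(\Psi_2)$$ with equivalent norms.
   Context: Conventions. Hilbert spaces are separable, with inner products linear in the first argument. Frames. A countable family $\Psi=\{\psi_i\}_{i\in I}\subset\mathcal{H}$ is a frame if $A\|f\|^2\le\sum_i|\langle f,\psi_i\rangle|^2\le B\|f\|^2$ for all $f\in\mathcal{H}$ and some $A,B>0$. $C_\Psi f=\{\langle f,\psi_i\rangle\}_{i}$, $D_\Psi c=\sum_i c_i\psi_i$, $S_\Psi=D_\Psi C_\Psi$; the canonical dual frame is $\widetilde\Psi=\{\widetilde\psi_i\}=\{S_\Psi^{-1}\psi_i\}$. The Gram matrix is $G_\Psi=(\langle\psi_{i'},\psi_i\rangle)_{(i,i')\in I^2}$. Localisation. A spectral matrix algebra $\mathcal{A}$ is an involutive Banach algebra of infinite matrices indexed by $I\times I$ (involution: conjugate transpose) such that (a) every $A\in\mathcal{A}$ defines a bounded operator on $\ell^2(I)$; (b) if $A\in\mathcal{A}$ is invertible in $B(\ell^2(I))$ then $A^{-1}\in\mathcal{A}$; (c) $\mathcal{A}$ is solid: $A\in\mathcal{A}$ and $|b_{i,j}|\le|a_{i,j}|$ for all $i,j$ imply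 $B\in\mathcal{A}$ and $\|B\|_{\mathcal{A}}\le\|A\|_{\mathcal{A}}$. A frame $\Psi$ is $\mathcal{A}$-localised if $G_\Psi\in\mathcal{A}$. For a weight $w=\{w_i\}$, $w_i>0$, put $\|c\|_{\ell^p_w(I)}=\|c\cdot w\|_{\ell^p(I)}$; $w$ is $\mathcal{A}$-admissible if every $A\in\mathcal{A}$ defines a bounded operator on $\ell^p_w(I)$ for every $1\le p\le\infty$. Here $\mathcal{A}_1,\mathcal{A}_2$ are spectral matrix algebras over the index sets $I$ and $J$ of $\Psi_1=\{\psi_{1,i}\}_{i\in I}$ and $\Psi_2=\{\psi_{2,j}\}_{j\in J}$. Co-orbit spaces. $\mathcal{H}^1_w(\Psi)$ is the completion of the space $\mathcal{H}_{00}(\Psi)$ of finite linear combinations of the $\psi_i$ in the norm $\|f\|_{\mathcal{H}^1_w(\Psi)}=\|C_{\widetilde\Psi}f\|_{\ell^1_w}$; $C_{\widetilde\Psi}$ is extended to it by continuity. Tensor products. $f_1\otimes f_2$ is the rank-one operator $f\mapsto\langle f,f_1\rangle f_2$, so that $\alpha(f_1\otimes f_2)=(\overline\alpha f_1)\otimes f_2=f_1\otimes(\alpha f_2)$; $\mathcal{H}_1\otimes\mathcal{H}_2$ is the Hilbert space completion of the span of simple tensors under $\langle f_1\otimes f_2,g_1\otimes g_2\rangle=\overline{\langle f_1,g_1\rangle}\langle f_2,g_2\rangle$. $\Psi_1\otimes\Psi_2=\{\psi_{1,i}\otimes\psi_{2,j}\}_{(i,j)\in I\times J}$ is a frame for it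 with canonical dual $\widetilde{\Psi_1\otimes\Psi_2}=\widetilde\Psi_1\otimes\widetilde\Psi_2$. With $(w_1\otimes w_2)_{i,j}=w_{1,i}w_{2,j}$, the space $\mathcal{H}^{1,1}_{w_1\otimes w_2}(\Psi_1\otimes\Psi_2)$ is the completion of the span of $\Psi_1\otimes\Psi_2$ in the norm $\|F\|=\sum_{j\in J}\sum_{i\in I}|(C_{\widetilde{\Psi_1\otimes\Psi_2}}F)_{i,j}|\,w_{1,i}w_{2,j}$. For $f_n\in\mathcal{H}^1_{w_n}(\Psi_n)$, $f_1\otimes f_2$ is regarded as the element of $\mathcal{H}^{1,1}_{w_1\otimes w_2}(\Psi_1\otimes\Psi_2)$ with coefficients $(C_{\widetilde{\Psi_1\otimes\Psi_2}}(f_1\otimes f_2))_{i,j}=\overline{(C_{\widetilde\Psi_1}f_1)_i}(C_{\widetilde\Psi_2}f_2)_j$. Projective tensor product. For Banach spaces $B_1,B_2$, $$B_1\widehat\otimes_\pi B_2=\Big\{F=\sum_{r\in R}f_r\otimes g_r:\ f_r\in B_1,\ g_r\in B_2,\ \sum_{r\in R}\|f_r\|_{B_1}\|g_r\|_{B_2}<\infty\Big\}$$ ($R$ countable), with norm $\|F\|_{B_1\widehat\otimes_\pi B_2}=\inf\sum_{r}\|f_r\|_{B_1}\|g_r\|_{B_2}$ over all representations $F=\sum_rf_r\otimes g_r$. In this definition $\otimes$ is conjugate-homogeneous in the first factor and homogeneous in the second, that is, $\alpha(f\otimes g)=(\overline\alpha f)\otimes g=f\otimes(\alpha g)$ for scalars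 $\alpha$, $f\in B_1$, $g\in B_2$, and the asserted equality is the identification through simple tensors.
   Formalization: The spectral matrix algebras are assumed to contain the identity matrix; without a unit, condition (b) can be vacuous and the norm of a frame vector in the co-orbit space can be infinite, so that the spaces in the claim are undefined. *)

theory Defs
  imports "HOL-Analysis.Analysis" "HOL-Library.Function_Algebras"
begin

section \<open>Complex normed, Banach and Hilbert spaces\<close>

class complex_vector = ab_group_add +
  fixes scaleC :: "complex \<Rightarrow> 'a \<Rightarrow> 'a"  (infixr "*\<^sub>C" 75)
  assumes scaleC_add_right: "a *\<^sub>C (x + y) = a *\<^sub>C x + a *\<^sub>C y"
    and scaleC_add_left: "(a + b) *\<^sub>C x = a *\<^sub>C x + b *\<^sub>C x"
    and scaleC_scaleC: "a *\<^sub>C (b *\<^sub>C x) = (a * b) *\<^sub>C x"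
    and scaleC_one: "1 *\<^sub>C x = x"

class complex_normed_vector = complex_vector + real_normed_vector +
  assumes scaleC_of_real: "complex_of_real r *\<^sub>C x = r *\<^sub>R x"
    and norm_scaleC: "norm (a *\<^sub>C x) = cmod a * norm x"

class complex_banach = complex_normed_vector + complete_space

class complex_hilbert = complex_banach +
  fixes cinner :: "'a \<Rightarrow> 'a \<Rightarrow> complex"
  assumes cinner_add_left: "cinner (x + y) z = cinner x z + cinner y z"
    and cinner_scaleC_left: "cinner (a *\<^sub>C x) y = a * cinner x y"
    and cinner_commute: "cinner x y = cnj (cinner y x)"
    and cinner_self: "cinner x x = complex_of_real ((norm x)\<^sup>2)"

instantiation complex :: complex_vector
begin
definition scaleC_complex :: "complex \<Rightarrow> complex \<Rightarrow> complex"
  where "scaleC_complex a x = a * x"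
instance by standard (auto simp: scaleC_complex_def algebra_simps)
end

instantiation "fun" :: (type, complex_vector) complex_vector
begin
definition scaleC_fun :: "complex \<Rightarrow> ('a \<Rightarrow> 'b) \<Rightarrow> 'a \<Rightarrow> 'b"
  where "scaleC_fun a f = (\<lambda>x. a *\<^sub>C f x)"
instance
  by standard
    (auto simp: scaleC_fun_def plus_fun_def scaleC_add_right scaleC_add_left scaleC_scaleC scaleC_one)
end

definition cspan :: "'v::complex_vector set \<Rightarrow> 'v set"
  where "cspan = module.span scaleC"

definition clinear_on :: "'v::complex_vector set \<Rightarrow> ('v \<Rightarrow> 'u::complex_vector) \<Rightarrow> bool"
  where "clinear_on V T \<longleftrightarrow>
    (\<forall>x\<in>V. \<forall>y\<in>V. T (x + y) = T x + T y) \<and> (\<forall>a. \<forall>x\<in>V. T (a *\<^sub>C x) = a *\<^sub>C T x)"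

text \<open>A Banach space together with the embedding \<open>\<iota>\<close> is a completion of the space \<open>V\<close> with
  norm \<open>N\<close>. A completion is determined by this up to a unique isometric isomorphism.\<close>

definition is_completion ::
    "'v::complex_vector set \<Rightarrow> ('v \<Rightarrow> real) \<Rightarrow> ('v \<Rightarrow> 'b::complex_banach) \<Rightarrow> bool"
  where "is_completion V N \<iota> \<longleftrightarrow>
    clinear_on V \<iota> \<and> (\<forall>x\<in>V. norm (\<iota> x) = N x) \<and> closure (\<iota> ` V) = UNIV"

text \<open>Extension by continuity, to a completion \<open>\<iota>\<close> of \<open>V\<close>, of a map \<open>C\<close> from \<open>V\<close> into the
  sequence space \<open>L\<close> with norm \<open>N\<close>.\<close>

definition extend_by_continuity ::
    "'v set \<Rightarrow> ('v \<Rightarrow> 'b::topological_space) \<Rightarrow> ('k \<Rightarrow> complex) set \<Rightarrow> (('k \<Rightarrow> complex) \<Rightarrow> real)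
      \<Rightarrow> ('v \<Rightarrow> 'k \<Rightarrow> complex) \<Rightarrow> 'b \<Rightarrow> 'k \<Rightarrow> complex"
  where "extend_by_continuity V \<iota> L N C f =
    (THE c. c \<in> L \<and> (\<forall>x :: nat \<Rightarrow> 'v. range x \<subseteq> V \<longrightarrow> (\<lambda>n. \<iota> (x n)) \<longlonglongrightarrow> f
       \<longrightarrow> (\<lambda>n. N (C (x n) - c)) \<longlonglongrightarrow> 0))"


section \<open>Frames\<close>

definition is_frame :: "('i \<Rightarrow> 'h::complex_hilbert) \<Rightarrow> bool"
  where "is_frame \<Psi> \<longleftrightarrow> (\<exists>A>0. \<exists>B>0. \<forall>f.
    (\<lambda>i. (cmod (cinner f (\<Psi> i)))\<^sup>2) summable_on UNIV \<and>
    A * (norm f)\<^sup>2 \<le> (\<Sum>\<^sub>\<infinity>i. (cmod (cinner f (\<Psi> i)))\<^sup>2) \<and>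
    (\<Sum>\<^sub>\<infinity>i. (cmod (cinner f (\<Psi> i)))\<^sup>2) \<le> B * (norm f)\<^sup>2)"

definition analysis_op :: "('i \<Rightarrow> 'h::complex_hilbert) \<Rightarrow> 'h \<Rightarrow> 'i \<Rightarrow> complex"
  where "analysis_op \<Psi> f = (\<lambda>i. cinner f (\<Psi> i))"

definition synthesis_op :: "('i \<Rightarrow> 'h::complex_hilbert) \<Rightarrow> ('i \<Rightarrow> complex) \<Rightarrow> 'h"
  where "synthesis_op \<Psi> c = (\<Sum>\<^sub>\<infinity>i. c i *\<^sub>C \<Psi> i)"

definition frame_op :: "('i \<Rightarrow> 'h::complex_hilbert) \<Rightarrow> 'h \<Rightarrow> 'h"
  where "frame_op \<Psi> f = synthesis_op \<Psi> (analysis_op \<Psi> f)"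

definition canonical_dual :: "('i \<Rightarrow> 'h::complex_hilbert) \<Rightarrow> 'i \<Rightarrow> 'h"
  where "canonical_dual \<Psi> i = inv (frame_op \<Psi>) (\<Psi> i)"

definition gram :: "('i \<Rightarrow> 'h::complex_hilbert) \<Rightarrow> 'i \<Rightarrow> 'i \<Rightarrow> complex"
  where "gram \<Psi> i i' = cinner (\<Psi> i') (\<Psi> i)"


section \<open>Weighted sequence spaces\<close>

definition lp_space :: "ereal \<Rightarrow> ('i \<Rightarrow> complex) set"
  where "lp_space p = {c. if p = \<infinity> then bounded (range c)
    else (\<lambda>i. cmod (c i) powr real_of_ereal p) summable_on UNIV}"

definition lp_norm :: "ereal \<Rightarrow> ('i \<Rightarrow> complex) \<Rightarrow> real"
  where "lp_norm p c = (if p = \<infinity> then (SUP i. cmod (c i))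
    else (\<Sum>\<^sub>\<infinity>i. cmod (c i) powr real_of_ereal p) powr (1 / real_of_ereal p))"

definition lpw_space :: "ereal \<Rightarrow> ('i \<Rightarrow> real) \<Rightarrow> ('i \<Rightarrow> complex) set"
  where "lpw_space p w = {c. (\<lambda>i. c i * complex_of_real (w i)) \<in> lp_space p}"

definition lpw_norm :: "ereal \<Rightarrow> ('i \<Rightarrow> real) \<Rightarrow> ('i \<Rightarrow> complex) \<Rightarrow> real"
  where "lpw_norm p w c = lp_norm p (\<lambda>i. c i * complex_of_real (w i))"

definition l11w_space :: "('i \<Rightarrow> real) \<Rightarrow> ('j \<Rightarrow> real) \<Rightarrow> ('i \<times> 'j \<Rightarrow> complex) set"
  where "l11w_space w1 w2 = {c.
    (\<forall>j. (\<lambda>i. cmod (c (i, j)) * (w1 i * w2 j)) summable_on UNIV) \<and>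
    (\<lambda>j. \<Sum>\<^sub>\<infinity>i. cmod (c (i, j)) * (w1 i * w2 j)) summable_on UNIV}"

definition l11w_norm :: "('i \<Rightarrow> real) \<Rightarrow> ('j \<Rightarrow> real) \<Rightarrow> ('i \<times> 'j \<Rightarrow> complex) \<Rightarrow> real"
  where "l11w_norm w1 w2 c = (\<Sum>\<^sub>\<infinity>j. \<Sum>\<^sub>\<infinity>i. cmod (c (i, j)) * (w1 i * w2 j))"


section \<open>Spectral matrix algebras\<close>

definition mat_vec :: "('i \<Rightarrow> 'i \<Rightarrow> complex) \<Rightarrow> ('i \<Rightarrow> complex) \<Rightarrow> 'i \<Rightarrow> complex"
  where "mat_vec A c = (\<lambda>i. \<Sum>\<^sub>\<infinity>k. A i k * c k)"

definition mat_mul ::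
    "('i \<Rightarrow> 'i \<Rightarrow> complex) \<Rightarrow> ('i \<Rightarrow> 'i \<Rightarrow> complex) \<Rightarrow> 'i \<Rightarrow> 'i \<Rightarrow> complex"
  where "mat_mul A B = (\<lambda>i j. \<Sum>\<^sub>\<infinity>k. A i k * B k j)"

definition mat_one :: "'i \<Rightarrow> 'i \<Rightarrow> complex"
  where "mat_one = (\<lambda>i j. if i = j then 1 else 0)"

definition mat_adj :: "('i \<Rightarrow> 'i \<Rightarrow> complex) \<Rightarrow> 'i \<Rightarrow> 'i \<Rightarrow> complex"
  where "mat_adj A = (\<lambda>i j. cnj (A j i))"

definition bounded_on_lpw :: "ereal \<Rightarrow> ('i \<Rightarrow> real) \<Rightarrow> ('i \<Rightarrow> 'i \<Rightarrow> complex) \<Rightarrow> bool"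
  where "bounded_on_lpw p w A \<longleftrightarrow> (\<exists>K. \<forall>c\<in>lpw_space p w.
    (\<forall>i. (\<lambda>k. A i k * c k) summable_on UNIV) \<and>
    mat_vec A c \<in> lpw_space p w \<and> lpw_norm p w (mat_vec A c) \<le> K * lpw_norm p w c)"

abbreviation bounded_on_l2 :: "('i \<Rightarrow> 'i \<Rightarrow> complex) \<Rightarrow> bool"
  where "bounded_on_l2 \<equiv> bounded_on_lpw 2 (\<lambda>_. 1)"

text \<open>Every bounded operator on \<open>\<ell>\<^sup>2\<close> is given by a matrix, so a matrix is invertible in the
  algebra of bounded operators iff it has an inverse in the following sense.\<close>

definition is_l2_inverse :: "('i \<Rightarrow> 'i \<Rightarrow> complex) \<Rightarrow> ('i \<Rightarrow> 'i \<Rightarrow> complex) \<Rightarrow> bool"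
  where "is_l2_inverse A B \<longleftrightarrow> bounded_on_l2 A \<and> bounded_on_l2 B \<and>
    (\<forall>c\<in>lp_space 2. mat_vec A (mat_vec B c) = c \<and> mat_vec B (mat_vec A c) = c)"

text \<open>Sums, differences, scalar multiples and the zero of matrices are the pointwise ones. The
  algebra is unital: inverse-closedness presupposes a unit, and it would be vacuous for an algebra
  without one, since a matrix and its inverse in the algebra multiply to the identity matrix.\<close>

locale spectral_matrix_algebra =
  fixes \<A> :: "('i::countable \<Rightarrow> 'i \<Rightarrow> complex) set"
    and N :: "('i \<Rightarrow> 'i \<Rightarrow> complex) \<Rightarrow> real"
  assumes zero_mem: "0 \<in> \<A>"
    and add_mem: "A \<in> \<A> \<Longrightarrow> B \<in> \<A> \<Longrightarrow> A + B \<in> \<A>"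
    and scale_mem: "A \<in> \<A> \<Longrightarrow> a *\<^sub>C A \<in> \<A>"
    and mul_mem: "A \<in> \<A> \<Longrightarrow> B \<in> \<A> \<Longrightarrow> mat_mul A B \<in> \<A>"
    and one_mem: "mat_one \<in> \<A>"
    and adj_mem: "A \<in> \<A> \<Longrightarrow> mat_adj A \<in> \<A>"
    and norm_nonneg: "A \<in> \<A> \<Longrightarrow> 0 \<le> N A"
    and norm_eq_zero: "A \<in> \<A> \<Longrightarrow> N A = 0 \<longleftrightarrow> A = 0"
    and norm_triangle: "A \<in> \<A> \<Longrightarrow> B \<in> \<A> \<Longrightarrow> N (A + B) \<le> N A + N B"
    and norm_scale: "A \<in> \<A> \<Longrightarrow> N (a *\<^sub>C A) = cmod a * N A"
    and norm_mul: "A \<in> \<A> \<Longrightarrow> B \<in> \<A> \<Longrightarrow> N (mat_mul A B) \<le> N A * N B"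
    and norm_adj: "A \<in> \<A> \<Longrightarrow> N (mat_adj A) = N A"
    and complete: "(\<And>n. X n \<in> \<A>) \<Longrightarrow>
        (\<And>e. e > 0 \<Longrightarrow> \<exists>M::nat. \<forall>m\<ge>M. \<forall>n\<ge>M. N (X m - X n) < e) \<Longrightarrow>
        \<exists>A\<in>\<A>. (\<lambda>n. N (X n - A)) \<longlonglongrightarrow> 0"
    and bounded_l2: "A \<in> \<A> \<Longrightarrow> bounded_on_l2 A"
    and inverse_closed: "A \<in> \<A> \<Longrightarrow> is_l2_inverse A B \<Longrightarrow> B \<in> \<A>"
    and solid: "A \<in> \<A> \<Longrightarrow> (\<And>i j. cmod (B i j) \<le> cmod (A i j)) \<Longrightarrow> B \<in> \<A> \<and> N B \<le> N A"

definition localised_frame :: "('i \<Rightarrow> 'i \<Rightarrow> complex) set \<Rightarrow> ('i \<Rightarrow> 'h::complex_hilbert) \<Rightarrow> bool"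
  where "localised_frame \<A> \<Psi> \<longleftrightarrow> is_frame \<Psi> \<and> gram \<Psi> \<in> \<A>"

definition admissible_weight :: "('i \<Rightarrow> 'i \<Rightarrow> complex) set \<Rightarrow> ('i \<Rightarrow> real) \<Rightarrow> bool"
  where "admissible_weight \<A> w \<longleftrightarrow>
    (\<forall>i. 0 < w i) \<and> (\<forall>A\<in>\<A>. \<forall>p. 1 \<le> p \<longrightarrow> bounded_on_lpw p w A)"


section \<open>Co-orbit spaces\<close>

definition is_coorbit1 ::
    "('i \<Rightarrow> 'h::complex_hilbert) \<Rightarrow> ('i \<Rightarrow> real) \<Rightarrow> ('h \<Rightarrow> 'b::complex_banach) \<Rightarrow> bool"
  where "is_coorbit1 \<Psi> w \<iota> \<longleftrightarrow> is_completion (cspan (range \<Psi>))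
    (\<lambda>f. lpw_norm 1 w (analysis_op (canonical_dual \<Psi>) f)) \<iota>"

definition coorbit1_coeffs ::
    "('i \<Rightarrow> 'h::complex_hilbert) \<Rightarrow> ('i \<Rightarrow> real) \<Rightarrow> ('h \<Rightarrow> 'b::complex_banach) \<Rightarrow> 'b \<Rightarrow> 'i \<Rightarrow> complex"
  where "coorbit1_coeffs \<Psi> w \<iota> = extend_by_continuity (cspan (range \<Psi>)) \<iota>
    (lpw_space 1 w) (lpw_norm 1 w) (analysis_op (canonical_dual \<Psi>))"

definition is_coorbit11 ::
    "('i \<times> 'j \<Rightarrow> 'h::complex_hilbert) \<Rightarrow> ('i \<Rightarrow> real) \<Rightarrow> ('j \<Rightarrow> real)
      \<Rightarrow> ('h \<Rightarrow> 'b::complex_banach) \<Rightarrow> bool"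
  where "is_coorbit11 \<Psi> w1 w2 \<iota> \<longleftrightarrow> is_completion (cspan (range \<Psi>))
    (\<lambda>F. l11w_norm w1 w2 (analysis_op (canonical_dual \<Psi>) F)) \<iota>"

definition coorbit11_coeffs ::
    "('i \<times> 'j \<Rightarrow> 'h::complex_hilbert) \<Rightarrow> ('i \<Rightarrow> real) \<Rightarrow> ('j \<Rightarrow> real)
      \<Rightarrow> ('h \<Rightarrow> 'b::complex_banach) \<Rightarrow> 'b \<Rightarrow> 'i \<times> 'j \<Rightarrow> complex"
  where "coorbit11_coeffs \<Psi> w1 w2 \<iota> = extend_by_continuity (cspan (range \<Psi>)) \<iota>
    (l11w_space w1 w2) (l11w_norm w1 w2) (analysis_op (canonical_dual \<Psi>))"


section \<open>Tensor products of Hilbert spaces and of frames\<close>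

definition rank_one :: "'h1::complex_hilbert \<Rightarrow> 'h2::complex_hilbert \<Rightarrow> 'h1 \<Rightarrow> 'h2"
  where "rank_one f1 f2 = (\<lambda>f. cinner f f1 *\<^sub>C f2)"

definition is_hilbert_tensor_product ::
    "(('h1::complex_hilbert \<Rightarrow> 'h2::complex_hilbert) \<Rightarrow> 'h::complex_hilbert) \<Rightarrow> bool"
  where "is_hilbert_tensor_product \<tau> \<longleftrightarrow>
    (let V = cspan {rank_one f1 f2 | f1 f2. True} in
      clinear_on V \<tau> \<and>
      (\<forall>f1 f2 g1 g2. cinner (\<tau> (rank_one f1 f2)) (\<tau> (rank_one g1 g2)) =
         cnj (cinner f1 g1) * cinner f2 g2) \<and>
      closure (\<tau> ` V) = UNIV)"

definition tensor_family ::
    "(('h1::complex_hilbert \<Rightarrow> 'h2::complex_hilbert) \<Rightarrow> 'h::complex_hilbert)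
      \<Rightarrow> ('i \<Rightarrow> 'h1) \<Rightarrow> ('j \<Rightarrow> 'h2) \<Rightarrow> 'i \<times> 'j \<Rightarrow> 'h"
  where "tensor_family \<tau> \<Psi>1 \<Psi>2 = (\<lambda>(i, j). \<tau> (rank_one (\<Psi>1 i) (\<Psi>2 j)))"


section \<open>The projective tensor product of Banach spaces\<close>

definition bounded_sesquilinear_form ::
    "('b1::complex_normed_vector \<Rightarrow> 'b2::complex_normed_vector \<Rightarrow> complex) \<Rightarrow> bool"
  where "bounded_sesquilinear_form \<beta> \<longleftrightarrow>
    (\<forall>x x' y. \<beta> (x + x') y = \<beta> x y + \<beta> x' y) \<and> (\<forall>a x y. \<beta> (a *\<^sub>C x) y = cnj a * \<beta> x y) \<and>
    (\<forall>x y y'. \<beta> x (y + y') = \<beta> x y + \<beta> x y') \<and> (\<forall>a x y. \<beta> x (a *\<^sub>C y) = a * \<beta> x y) \<and>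
    (\<exists>K. \<forall>x y. cmod (\<beta> x y) \<le> K * norm x * norm y)"

text \<open>As in Ryan's book on tensor products of Banach spaces, the simple tensor \<open>f \<otimes> g\<close> is
  evaluation at \<open>(f, g)\<close>, a functional on the bounded forms that are conjugate-linear in the first
  and linear in the second argument. Functionals are set to zero off the space of these forms. Since
  the bounded forms constitute the dual of the completed algebraic tensor product under the
  projective norm, two absolutely convergent series of simple tensors define the same functional iff
  they have the same sum in that completion.\<close>

definition simple_tensor ::
    "'b1::complex_banach \<Rightarrow> 'b2::complex_banach \<Rightarrow> ('b1 \<Rightarrow> 'b2 \<Rightarrow> complex) \<Rightarrow> complex"
  where "simple_tensor f g = (\<lambda>\<beta>. if bounded_sesquilinear_form \<beta> then \<beta> f g else 0)"

definition tensor_representation ::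
    "(('b1::complex_banach \<Rightarrow> 'b2::complex_banach \<Rightarrow> complex) \<Rightarrow> complex)
      \<Rightarrow> nat set \<Rightarrow> (nat \<Rightarrow> 'b1) \<Rightarrow> (nat \<Rightarrow> 'b2) \<Rightarrow> bool"
  where "tensor_representation F R f g \<longleftrightarrow>
    (\<lambda>r. norm (f r) * norm (g r)) summable_on R \<and>
    F = (\<lambda>\<beta>. \<Sum>\<^sub>\<infinity>r\<in>R. simple_tensor (f r) (g r) \<beta>)"

definition proj_tensor ::
    "(('b1::complex_banach \<Rightarrow> 'b2::complex_banach \<Rightarrow> complex) \<Rightarrow> complex) set"
  where "proj_tensor = {F. \<exists>R f g. tensor_representation F R f g}"

definition proj_norm ::
    "(('b1::complex_banach \<Rightarrow> 'b2::complex_banach \<Rightarrow> complex) \<Rightarrow> complex) \<Rightarrow> real"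
  where "proj_norm F =
    Inf {\<Sum>\<^sub>\<infinity>r\<in>R. norm (f r) * norm (g r) | R f g. tensor_representation F R f g}"

end

theory Submission
  imports Defs "HOL-Complex_Analysis.Complex_Analysis"
begin

text \<open>The analysis operator of the canonical dual embeds a co-orbit space isometrically into weighted \<open>\<ell>\<^sup>1\<close>,
  and \<open>\<ell>\<^sup>1(I) \<otimes>\<^sub>\<pi> \<ell>\<^sup>1(J) = \<ell>\<^sup>1(I \<times> J)\<close> for the projective tensor product. The latter does not respect
  subspaces in general, but it respects complemented ones. So the theorem comes down to a bounded projection of
  weighted \<open>\<ell>\<^sup>1\<close> onto the range of the analysis operator, and a candidate is the cross Gram matrix
  \<open>P\<^sub>i\<^sub>j = \<langle>\<psi>\<^sub>j, \<psi>\<^sub>i\<^sup>~\<rangle>\<close>, which on \<open>\<ell>\<^sup>2\<close> is the orthogonal projection onto that range.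

  \<^item> \<open>P\<close> is bounded on weighted \<open>\<ell>\<^sup>1\<close> (\<open>cross_gram_column_bound\<close>). It is the Riesz projection of the
    Gram matrix \<open>G\<close> that belongs to the part of the spectrum away from zero. On a circle separating this part from
    zero, inverse-closedness puts the resolvents of \<open>G\<close> into the algebra, hence they are bounded on
    weighted \<open>\<ell>\<^sup>1\<close> by admissibility, and uniformly so by the resolvent identity and compactness. The
    maximum modulus principle, applied to weighted sums of matrix entries, carries the bound over to \<open>P\<close>.

  \<^item> Consequently every element of a co-orbit space is the sum of its frame expansion, with a cost comparable
    to its norm (\<open>J_E\<close>), and a sequence of coefficients belongs to an element iff \<open>P\<close> fixes it (\<open>E_J\<close>).

  \<^item> The canonical dual of a tensor product of frames consists of the tensors of the dual vectors
    (\<open>canonical_dual_tensor\<close>). So the cross Gram matrix of the product is, up to a conjugation, the Kronecker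
    product of the two cross Gram matrices, and the co-orbit space of the product is of the same kind.

  \<^item> A bounded sesquilinear form is determined by its values at pairs of frame vectors, and an element \<open>F\<close> of the
    projective tensor product by its coefficients, the values at the coordinate forms
    \<open>(f, g) \<mapsto> cnj (C f)\<^sub>i (C g)\<^sub>j\<close> (\<open>evaluation\<close>). The isomorphism sends \<open>F\<close> to the element of the co-orbit
    space with these coefficients. It does not increase norms because the coefficients of \<open>f \<otimes> g\<close> have norm \<open>\<parallel>f\<parallel> \<parallel>g\<parallel>\<close>;
    it is onto, with a bound for the inverse, because the frame expansion of an element is a series of
    simple tensors (\<open>T_surj\<close>).\<close>


section \<open>Complex Hilbert spaces\<close>

interpretation complex_vector: vector_space "scaleC :: complex \<Rightarrow> 'a \<Rightarrow> 'a::complex_vector"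
  by standard (simp_all add: scaleC_add_right scaleC_add_left scaleC_scaleC scaleC_one)

instance complex_banach \<subseteq> banach ..

lemma cinner_add_right: "cinner x (y + z) = cinner x y + cinner x z"
  by (metis cinner_add_left cinner_commute complex_cnj_add)

lemma cinner_scaleC_right: "cinner x (a *\<^sub>C y) = cnj a * cinner x y"
  by (metis cinner_commute cinner_scaleC_left complex_cnj_mult)

lemma cinner_scaleR_left: "cinner (r *\<^sub>R x) y = r *\<^sub>R cinner x y"
  by (metis cinner_scaleC_left scaleC_of_real scaleR_conv_of_real)

lemma cinner_scaleR_right: "cinner x (r *\<^sub>R y) = r *\<^sub>R cinner x y"
  by (metis cinner_scaleC_right complex_cnj_complex_of_real scaleC_of_real scaleR_conv_of_real)

lemma cinner_zero_left [simp]: "cinner 0 y = 0"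
  using cinner_scaleR_left[of 0 0 y] by simp

lemma cinner_zero_right [simp]: "cinner x 0 = 0"
  using cinner_scaleR_right[of x 0 0] by simp

lemma cinner_minus_left: "cinner (- x) y = - cinner x y"
  using cinner_scaleR_left[of "-1" x y] by simp

lemma cinner_diff_left: "cinner (x - y) z = cinner x z - cinner y z"
  using cinner_add_left[of x "- y" z] by (simp add: cinner_minus_left)

lemma cinner_diff_right: "cinner x (y - z) = cinner x y - cinner x z"
  by (metis cinner_commute cinner_diff_left complex_cnj_diff)

lemma cinner_sum_left: "cinner (sum f A) y = (\<Sum>i\<in>A. cinner (f i) y)"
  by (induction A rule: infinite_finite_induct) (auto simp: cinner_add_left)

lemma cinner_sum_right: "cinner x (sum f A) = (\<Sum>i\<in>A. cinner x (f i))"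
  by (induction A rule: infinite_finite_induct) (auto simp: cinner_add_right)

lemma norm_sq_eq_Re_cinner: "(norm x)\<^sup>2 = Re (cinner x x)"
  by (simp add: cinner_self)

lemma cinner_self_eq_zero: "cinner x x = 0 \<longleftrightarrow> x = 0"
  by (simp add: cinner_self)

lemma norm_add_sq: "(norm (x + y))\<^sup>2 = (norm x)\<^sup>2 + 2 * Re (cinner x y) + (norm y)\<^sup>2"
proof -
  have "Re (cinner y x) = Re (cinner x y)"
    by (subst cinner_commute) simp
  then show ?thesis
    by (simp add: norm_sq_eq_Re_cinner cinner_add_left cinner_add_right)
qed

lemma cinner_Cauchy_Schwarz: "cmod (cinner x y) \<le> norm x * norm y"
proof (cases "y = 0")
  case False
  define a where "a = cinner x y / of_real ((norm y)\<^sup>2)"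
  have "Re (cinner x (- (a *\<^sub>C y))) = - (cmod (cinner x y))\<^sup>2 / (norm y)\<^sup>2"
    using False
    by (simp add: a_def cinner_scaleC_right cinner_diff_right[of x 0, simplified]
        cmod_power2[of "cinner x y"]) (simp add: power2_eq_square field_simps)
  moreover have "(norm (a *\<^sub>C y))\<^sup>2 = (cmod (cinner x y))\<^sup>2 / (norm y)\<^sup>2"
    using False by (simp add: a_def norm_scaleC norm_divide power_divide norm_power power2_eq_square)
      (simp add: norm_mult field_simps)
  ultimately have "0 \<le> (norm x)\<^sup>2 - (cmod (cinner x y))\<^sup>2 / (norm y)\<^sup>2"
    using norm_add_sq[of x "- (a *\<^sub>C y)"] zero_le_power2[of "norm (x + - (a *\<^sub>C y))"]
    by simp
  then have "(cmod (cinner x y))\<^sup>2 \<le> (norm x * norm y)\<^sup>2"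
    using False by (simp add: field_simps power_mult_distrib)
  then show ?thesis
    by (rule power2_le_imp_le) simp
qed simp

lemma bounded_linear_cinner_left: "bounded_linear (\<lambda>x. cinner x y)"
  by (rule bounded_linear_intro[of _ "norm y"])
    (simp_all add: cinner_add_left cinner_scaleR_left cinner_Cauchy_Schwarz)

lemma bounded_linear_cinner_right: "bounded_linear (\<lambda>y. cinner x y)"
  using cinner_Cauchy_Schwarz[of x]
  by (intro bounded_linear_intro[of _ "norm x"])
    (simp_all add: cinner_add_right cinner_scaleR_right mult.commute)

lemma cinner_eq_zero_of_dense:
  assumes "closure V = UNIV" and "\<And>v. v \<in> V \<Longrightarrow> cinner x v = 0"
  shows "x = 0"
proof -
  have "cinner x v = 0" if "v \<in> closure V" for v
    by (rule continuous_constant_on_closure[OF _ assms(2) that])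
      (auto intro: linear_continuous_on bounded_linear_cinner_right)
  then show ?thesis
    using assms(1) cinner_self_eq_zero by blast
qed

definition bounded_clinear :: "('a::complex_normed_vector \<Rightarrow> 'b::complex_normed_vector) \<Rightarrow> bool"
  where "bounded_clinear T \<longleftrightarrow> clinear_on UNIV T \<and> (\<exists>K. \<forall>x. norm (T x) \<le> K * norm x)"

lemma bounded_clinearI:
  assumes "\<And>x y. T (x + y) = T x + T y" and "\<And>a x. T (a *\<^sub>C x) = a *\<^sub>C T x"
    and "\<And>x. norm (T x) \<le> K * norm x"
  shows "bounded_clinear T"
  unfolding bounded_clinear_def clinear_on_def using assms by blast

lemma bounded_clinear_scaleC: "bounded_clinear T \<Longrightarrow> T (a *\<^sub>C x) = a *\<^sub>C T x"
  by (simp add: bounded_clinear_def clinear_on_def)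

lemma bounded_clinear_bounded_linear:
  assumes "bounded_clinear T"
  shows "bounded_linear T"
proof -
  from assms obtain K where "\<And>x. norm (T x) \<le> K * norm x"
    by (auto simp: bounded_clinear_def)
  with assms show ?thesis
    by (intro bounded_linear_intro[of T K])
      (simp_all add: bounded_clinear_def clinear_on_def mult.commute flip: scaleC_of_real)
qed

lemma bounded_clinear_nonneg_bound:
  assumes "bounded_clinear T"
  obtains K where "K \<ge> 0" and "\<And>x. norm (T x) \<le> K * norm x"
  using bounded_linear.nonneg_bounded[OF bounded_clinear_bounded_linear[OF assms]]
  by (metis mult.commute)

lemma bounded_linear_scaleC: "bounded_linear (\<lambda>x::'a::complex_normed_vector. a *\<^sub>C x)"
  by (rule bounded_linear_intro[of _ "cmod a"])
    (simp_all add: scaleC_add_right norm_scaleC mult.commute scaleC_scaleC flip: scaleC_of_real)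

lemma bounded_clinear_id: "bounded_clinear (\<lambda>x. x)"
  by (rule bounded_clinearI[where K = 1]) auto


section \<open>Bessel families and the frame operator\<close>

text \<open>\<open>square_summable\<close> is membership in \<open>lp_space 2\<close> and \<open>square_sum\<close> the square of \<open>lp_norm 2\<close>, with
  integer instead of real exponents.\<close>

definition square_summable :: "('i \<Rightarrow> complex) \<Rightarrow> bool"
  where "square_summable c \<longleftrightarrow> (\<lambda>i. (cmod (c i))\<^sup>2) summable_on UNIV"

definition square_sum :: "('i \<Rightarrow> complex) \<Rightarrow> real"
  where "square_sum c = (\<Sum>\<^sub>\<infinity>i. (cmod (c i))\<^sup>2)"

text \<open>The estimate is stated for finite sums of vectors, where no convergence is at stake; it is
  equivalent to the usual bound on \<open>\<Sum>|\<langle>f, \<psi>\<^sub>i\<rangle>|\<^sup>2\<close>.\<close>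

definition bessel :: "real \<Rightarrow> ('i \<Rightarrow> 'h::complex_hilbert) \<Rightarrow> bool"
  where "bessel B \<Psi> \<longleftrightarrow> 0 \<le> B \<and>
    (\<forall>F c. finite F \<longrightarrow> (norm (\<Sum>i\<in>F. c i *\<^sub>C \<Psi> i))\<^sup>2 \<le> B * (\<Sum>i\<in>F. (cmod (c i))\<^sup>2))"

lemma bessel_nonneg: "bessel B \<Psi> \<Longrightarrow> 0 \<le> B"
  by (simp add: bessel_def)

text \<open>The synthesis bound, applied to the coefficients \<open>c\<^sub>i = \<langle>f, \<psi>\<^sub>i\<rangle>\<close>, gives the analysis bound by duality,
  because \<open>\<Sum>|c\<^sub>i|\<^sup>2 = \<langle>f, \<Sum>c\<^sub>i \<psi>\<^sub>i\<rangle>\<close>. The converse below is the same argument read backwards.\<close>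

lemma bessel_analysis_finite:
  assumes "bessel B \<Psi>" and "finite F"
  shows "(\<Sum>i\<in>F. (cmod (cinner f (\<Psi> i)))\<^sup>2) \<le> B * (norm f)\<^sup>2"
proof -
  define s where "s = (\<Sum>i\<in>F. (cmod (cinner f (\<Psi> i)))\<^sup>2)"
  define v where "v = (\<Sum>i\<in>F. cinner f (\<Psi> i) *\<^sub>C \<Psi> i)"
  have s: "0 \<le> s"
    by (simp add: s_def sum_nonneg)
  have "complex_of_real s = cinner f v"
    by (simp add: s_def v_def cinner_sum_right cinner_scaleC_right complex_norm_square mult.commute del: of_real_power)
  then have "s \<le> norm f * norm v"
    by (metis cinner_Cauchy_Schwarz abs_of_nonneg norm_of_real s)
  then have "s\<^sup>2 \<le> (norm f)\<^sup>2 * (norm v)\<^sup>2"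
    using s by (metis power_mono power_mult_distrib)
  also have "\<dots> \<le> (norm f)\<^sup>2 * (B * s)"
    using assms unfolding bessel_def s_def v_def by (intro mult_left_mono) auto
  finally have "s * s \<le> (B * (norm f)\<^sup>2) * s"
    by (simp add: power2_eq_square mult_ac)
  moreover have "0 \<le> B * (norm f)\<^sup>2"
    using assms by (simp add: bessel_def)
  ultimately show ?thesis
    using s unfolding s_def[symmetric] by (cases "s = 0") auto
qed

lemma bessel_analysis:
  assumes "bessel B \<Psi>"
  shows "square_summable (analysis_op \<Psi> f)" and "square_sum (analysis_op \<Psi> f) \<le> B * (norm f)\<^sup>2"
proof -
  show s: "square_summable (analysis_op \<Psi> f)"
    unfolding square_summable_def analysis_op_def
    by (rule nonneg_bdd_above_summable_on)
      (auto intro!: bdd_aboveI2[where M = "B * (norm f)\<^sup>2"] bessel_analysis_finite[OF assms])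
  show "square_sum (analysis_op \<Psi> f) \<le> B * (norm f)\<^sup>2"
    unfolding square_sum_def analysis_op_def
    by (rule infsum_le_finite_sums)
      (use s in \<open>auto simp: square_summable_def analysis_op_def intro!: bessel_analysis_finite[OF assms]\<close>)
qed

lemma sum_mult_le_sqrt:
  "(\<Sum>i\<in>F. cmod (c i) * cmod (d i)) \<le> sqrt (\<Sum>i\<in>F. (cmod (c i))\<^sup>2) * sqrt (\<Sum>i\<in>F. (cmod (d i))\<^sup>2)"
  using L2_set_mult_ineq[of "\<lambda>i. cmod (c i)" "\<lambda>i. cmod (d i)" F] by (simp add: L2_set_def)

lemma bessel_of_analysis_bound:
  fixes \<Psi> :: "'i \<Rightarrow> 'h::complex_hilbert"
  assumes "0 \<le> B"
    and "\<And>f F. finite F \<Longrightarrow> (\<Sum>i\<in>F. (cmod (cinner f (\<Psi> i)))\<^sup>2) \<le> B * (norm f)\<^sup>2"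
  shows "bessel B \<Psi>"
  unfolding bessel_def
proof (intro conjI allI impI)
  fix F :: "'i set" and c assume F: "finite F"
  define v where "v = (\<Sum>i\<in>F. c i *\<^sub>C \<Psi> i)"
  define s where "s = (\<Sum>i\<in>F. (cmod (c i))\<^sup>2)"
  have "cinner v v = (\<Sum>i\<in>F. c i * cinner (\<Psi> i) v)"
    by (subst (1) v_def) (simp add: cinner_sum_left cinner_scaleC_left)
  then have "(norm v)\<^sup>2 = cmod (\<Sum>i\<in>F. c i * cinner (\<Psi> i) v)"
    by (metis cinner_self norm_of_real abs_power2)
  also have "\<dots> \<le> (\<Sum>i\<in>F. cmod (c i) * cmod (cinner (\<Psi> i) v))"
    by (rule sum_norm_le) (simp add: norm_mult)
  also have "\<dots> = (\<Sum>i\<in>F. cmod (c i) * cmod (cinner v (\<Psi> i)))"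
    by (metis cinner_commute complex_mod_cnj)
  also have "\<dots> \<le> sqrt s * sqrt (\<Sum>i\<in>F. (cmod (cinner v (\<Psi> i)))\<^sup>2)"
    unfolding s_def by (rule sum_mult_le_sqrt)
  also have "\<dots> \<le> sqrt s * sqrt (B * (norm v)\<^sup>2)"
    using assms(2)[OF F, of v] by (intro mult_left_mono real_sqrt_le_mono) (auto simp: s_def sum_nonneg)
  finally have "norm v * norm v \<le> sqrt (B * s) * norm v"
    by (simp add: power2_eq_square real_sqrt_mult mult_ac)
  then have "norm v \<le> sqrt (B * s)"
    using assms(1) by (cases "norm v = 0") (auto simp: s_def sum_nonneg)
  then show "(norm (\<Sum>i\<in>F. c i *\<^sub>C \<Psi> i))\<^sup>2 \<le> B * (\<Sum>i\<in>F. (cmod (c i))\<^sup>2)"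
    using sqrt_le_D real_le_rsqrt sqrt_ge_absD[of "norm v" "B * s"] by (simp add: v_def s_def)
qed (fact assms(1))

text \<open>The Cauchy criterion for unordered sums, wanted because synthesis series converge unconditionally
  but in general not absolutely.\<close>

lemma summable_on_of_small_tails:
  fixes f :: "'a \<Rightarrow> 'b::banach"
  assumes "\<And>e. e > 0 \<Longrightarrow> \<exists>F0. finite F0 \<and> (\<forall>F. finite F \<longrightarrow> F \<inter> F0 = {} \<longrightarrow> norm (sum f F) < e)"
  shows "f summable_on UNIV"
proof -
  have "\<exists>P. eventually P (finite_subsets_at_top UNIV) \<and>
      (\<forall>F F'. P F \<and> P F' \<longrightarrow> dist (sum f F) (sum f F') < e)" if "e > 0" for e
  proof -
    obtain F0 where F0: "finite F0" "\<And>F. finite F \<Longrightarrow> F \<inter> F0 = {} \<Longrightarrow> norm (sum f F) < e / 2"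
      using assms[of "e / 2"] \<open>e > 0\<close> by auto
    have *: "dist (sum f F) (sum f F0) < e / 2" if "finite F" "F0 \<subseteq> F" for F
      using F0(2)[of "F - F0"] that by (simp add: dist_norm sum_diff Int_commute)
    have "dist (sum f F) (sum f F') < e"
      if "finite F \<and> F0 \<subseteq> F" "finite F' \<and> F0 \<subseteq> F'" for F F'
      using *[of F] *[of F'] that dist_triangle_half_l by blast
    moreover have "eventually (\<lambda>F. finite F \<and> F0 \<subseteq> F) (finite_subsets_at_top UNIV)"
      using F0(1) by (auto simp: eventually_finite_subsets_at_top)
    ultimately show ?thesis
      by blast
  qed
  then have "cauchy_filter (filtermap (sum f) (finite_subsets_at_top UNIV))"
    by (simp add: cauchy_filter_metric_filtermap)
  moreover have "complete (UNIV::'b set)"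
    by (meson Cauchy_convergent UNIV_I complete_def convergent_def)
  ultimately obtain L where "(sum f \<longlongrightarrow> L) (finite_subsets_at_top UNIV)"
    using complete_uniform[where S = UNIV] by (force simp: filterlim_def)
  then show ?thesis
    using summable_on_def has_sum_def by blast
qed

lemma bessel_synthesis_summable:
  assumes B: "bessel B \<Psi>" and c: "square_summable c"
  shows "(\<lambda>i. c i *\<^sub>C \<Psi> i) summable_on UNIV"
proof (rule summable_on_of_small_tails)
  fix e :: real assume e: "e > 0"
  let ?g = "\<lambda>i. (cmod (c i))\<^sup>2"
  \<comment> \<open>The denominator is \<open>B + 1\<close> because \<open>B\<close> may vanish.\<close>
  define d where "d = e\<^sup>2 / (B + 1)"
  have B0: "0 \<le> B" using B by (rule bessel_nonneg)
  have d: "d > 0" using e B0 by (simp add: d_def)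
  obtain F0 where F0: "finite F0" and close: "dist (sum ?g F0) (infsum ?g UNIV) \<le> d / 2"
    using infsum_finite_approximation[of ?g UNIV "d / 2"] c d unfolding square_summable_def by auto
  have "norm (\<Sum>i\<in>F. c i *\<^sub>C \<Psi> i) < e" if F: "finite F" "F \<inter> F0 = {}" for F
  proof -
    have "sum ?g F + sum ?g F0 = sum ?g (F \<union> F0)"
      using F F0 by (simp add: sum.union_disjoint)
    also have "\<dots> \<le> infsum ?g UNIV"
      using F F0 c by (intro finite_sum_le_infsum) (auto simp: square_summable_def)
    finally have "sum ?g F \<le> d / 2"
      using close unfolding dist_real_def by arith
    then have "sum ?g F < d" using d by simp
    have "(norm (\<Sum>i\<in>F. c i *\<^sub>C \<Psi> i))\<^sup>2 \<le> B * sum ?g F"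
      using B F by (simp add: bessel_def)
    also have "\<dots> \<le> (B + 1) * sum ?g F"
      by (intro mult_right_mono) (auto simp: sum_nonneg)
    also have "\<dots> < (B + 1) * d"
      using \<open>sum ?g F < d\<close> B0 by (intro mult_strict_left_mono) auto
    also have "\<dots> = e\<^sup>2"
      using B0 by (simp add: d_def)
    finally show ?thesis
      using e by (simp add: power2_less_imp_less)
  qed
  with F0 show "\<exists>F0. finite F0 \<and> (\<forall>F. finite F \<longrightarrow> F \<inter> F0 = {} \<longrightarrow> norm (\<Sum>i\<in>F. c i *\<^sub>C \<Psi> i) < e)"
    by blast
qed

lemma bessel_synthesis_has_sum:
  assumes "bessel B \<Psi>" and "square_summable c"
  shows "((\<lambda>i. c i *\<^sub>C \<Psi> i) has_sum synthesis_op \<Psi> c) UNIV"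
  unfolding synthesis_op_def using bessel_synthesis_summable[OF assms] by simp

lemma bessel_synthesis_norm:
  fixes \<Psi> :: "'i \<Rightarrow> 'h::complex_hilbert"
  assumes B: "bessel B \<Psi>" and c: "square_summable c"
  shows "(norm (synthesis_op \<Psi> c))\<^sup>2 \<le> B * square_sum c"
proof -
  have "((\<lambda>F. (norm (\<Sum>i\<in>F. c i *\<^sub>C \<Psi> i))\<^sup>2) \<longlongrightarrow> (norm (synthesis_op \<Psi> c))\<^sup>2) (finite_subsets_at_top UNIV)"
    using bessel_synthesis_has_sum[OF assms] unfolding has_sum_def by (intro tendsto_intros)
  then show ?thesis
  proof (rule tendsto_upperbound)
    show "\<forall>\<^sub>F F in finite_subsets_at_top UNIV. (norm (\<Sum>i\<in>F. c i *\<^sub>C \<Psi> i))\<^sup>2 \<le> B * square_sum c"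
    proof (rule eventually_finite_subsets_at_top_weakI)
      fix F :: "'i set" assume F: "finite F"
      have "(norm (\<Sum>i\<in>F. c i *\<^sub>C \<Psi> i))\<^sup>2 \<le> B * (\<Sum>i\<in>F. (cmod (c i))\<^sup>2)"
        using B F by (simp add: bessel_def)
      also have "\<dots> \<le> B * square_sum c"
        unfolding square_sum_def using c F bessel_nonneg[OF B]
        by (intro mult_left_mono finite_sum_le_infsum) (auto simp: square_summable_def)
      finally show "(norm (\<Sum>i\<in>F. c i *\<^sub>C \<Psi> i))\<^sup>2 \<le> B * square_sum c" .
    qed
  qed simp
qed

lemma cinner_synthesis:
  assumes "bessel B \<Psi>" and "square_summable c"
  shows "((\<lambda>i. c i * cinner (\<Psi> i) g) has_sum cinner (synthesis_op \<Psi> c) g) UNIV"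
  using has_sum_bounded_linear[OF bounded_linear_cinner_left bessel_synthesis_has_sum[OF assms]]
  by (simp add: cinner_scaleC_left)

lemma cmod_add_sq_le: "(cmod (x + y))\<^sup>2 \<le> 2 * (cmod x)\<^sup>2 + 2 * (cmod y)\<^sup>2"
proof -
  have "(cmod (x + y))\<^sup>2 \<le> (cmod x + cmod y)\<^sup>2"
    by (intro power_mono norm_triangle_ineq) simp
  also have "\<dots> \<le> 2 * (cmod x)\<^sup>2 + 2 * (cmod y)\<^sup>2"
    using zero_le_power2[of "cmod x - cmod y"] by (simp add: power2_eq_square algebra_simps)
  finally show ?thesis .
qed

lemma square_summable_add:
  assumes "square_summable c" and "square_summable d"
  shows "square_summable (\<lambda>i. c i + d i)"
proof -
  note cmod_add_sq_le[of "c _" "d _"]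
  moreover have "(\<lambda>i. 2 * (cmod (c i))\<^sup>2 + 2 * (cmod (d i))\<^sup>2) summable_on UNIV"
    using assms unfolding square_summable_def by (intro summable_on_add summable_on_cmult_right)
  ultimately show ?thesis
    unfolding square_summable_def by (auto intro: summable_on_comparison_test)
qed

lemma square_summable_scale:
  assumes "square_summable c"
  shows "square_summable (\<lambda>i. a * c i)"
  using assms unfolding square_summable_def
  by (auto simp: norm_mult power_mult_distrib intro: summable_on_cmult_right)

lemma synthesis_add:
  assumes "bessel B \<Psi>" and "square_summable c" and "square_summable d"
  shows "synthesis_op \<Psi> (\<lambda>i. c i + d i) = synthesis_op \<Psi> c + synthesis_op \<Psi> d"
  unfolding synthesis_op_def scaleC_add_left
  by (intro infsum_add bessel_synthesis_summable[OF assms(1)] assms(2,3))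

lemma synthesis_scale:
  assumes "bessel B \<Psi>" and "square_summable c"
  shows "synthesis_op \<Psi> (\<lambda>i. a * c i) = a *\<^sub>C synthesis_op \<Psi> c"
  using has_sum_bounded_linear[OF bounded_linear_scaleC bessel_synthesis_has_sum[OF assms], of a]
  by (simp add: synthesis_op_def scaleC_scaleC infsumI)

lemma analysis_add: "analysis_op \<Psi> (f + g) = (\<lambda>i. analysis_op \<Psi> f i + analysis_op \<Psi> g i)"
  by (simp add: analysis_op_def cinner_add_left)

lemma analysis_scale: "analysis_op \<Psi> (a *\<^sub>C f) = (\<lambda>i. a * analysis_op \<Psi> f i)"
  by (simp add: analysis_op_def cinner_scaleC_left)

lemma frame_op_norm:
  assumes "bessel B \<Psi>"
  shows "norm (frame_op \<Psi> f) \<le> B * norm f"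
proof -
  have "(norm (frame_op \<Psi> f))\<^sup>2 \<le> B * square_sum (analysis_op \<Psi> f)"
    unfolding frame_op_def by (rule bessel_synthesis_norm[OF assms bessel_analysis(1)[OF assms]])
  also have "\<dots> \<le> B * (B * (norm f)\<^sup>2)"
    by (intro mult_left_mono bessel_analysis(2) assms bessel_nonneg[OF assms])
  also have "\<dots> = (B * norm f)\<^sup>2"
    by (simp add: power2_eq_square)
  finally show ?thesis
    by (rule power2_le_imp_le) (simp add: bessel_nonneg[OF assms])
qed

lemma frame_op_bounded_clinear:
  assumes "bessel B \<Psi>"
  shows "bounded_clinear (frame_op \<Psi>)"
proof (rule bounded_clinearI)
  show "frame_op \<Psi> (x + y) = frame_op \<Psi> x + frame_op \<Psi> y" for x y
    unfolding frame_op_def analysis_add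
    by (rule synthesis_add[OF assms bessel_analysis(1)[OF assms] bessel_analysis(1)[OF assms]])
  show "frame_op \<Psi> (a *\<^sub>C x) = a *\<^sub>C frame_op \<Psi> x" for a x
    unfolding frame_op_def analysis_scale
    by (rule synthesis_scale[OF assms bessel_analysis(1)[OF assms]])
  show "norm (frame_op \<Psi> x) \<le> B * norm x" for x
    by (rule frame_op_norm[OF assms])
qed

lemma frame_op_cinner:
  assumes "bessel B \<Psi>"
  shows "((\<lambda>i. cinner f (\<Psi> i) * cinner (\<Psi> i) g) has_sum cinner (frame_op \<Psi> f) g) UNIV"
  using cinner_synthesis[OF assms bessel_analysis(1)[OF assms], of f g]
  by (simp add: frame_op_def analysis_op_def)

lemma frame_op_self_adjoint:
  assumes "bessel B \<Psi>"
  shows "cinner (frame_op \<Psi> f) g = cinner f (frame_op \<Psi> g)"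
proof -
  have "((\<lambda>i. cnj (cinner g (\<Psi> i) * cinner (\<Psi> i) f)) has_sum cnj (cinner (frame_op \<Psi> g) f)) UNIV"
    by (simp only: has_sum_cnj_iff frame_op_cinner[OF assms])
  moreover have "cnj (cinner g (\<Psi> i) * cinner (\<Psi> i) f) = cinner f (\<Psi> i) * cinner (\<Psi> i) g" for i
    by (metis cinner_commute complex_cnj_mult mult.commute)
  ultimately have "((\<lambda>i. cinner f (\<Psi> i) * cinner (\<Psi> i) g) has_sum cinner f (frame_op \<Psi> g)) UNIV"
    by (simp add: mult.commute flip: cinner_commute)
  then show ?thesis
    using frame_op_cinner[OF assms] has_sum_unique by blast
qed

lemma frame_op_quadratic_form:
  assumes "bessel B \<Psi>"
  shows "cinner (frame_op \<Psi> f) f = of_real (square_sum (analysis_op \<Psi> f))"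
proof -
  have "((\<lambda>i. of_real ((cmod (analysis_op \<Psi> f i))\<^sup>2) :: complex) has_sum of_real (square_sum (analysis_op \<Psi> f))) UNIV"
    unfolding square_sum_def
    by (rule has_sum_of_real) (use bessel_analysis(1)[OF assms] in \<open>simp add: square_summable_def\<close>)
  moreover have "complex_of_real ((cmod (analysis_op \<Psi> f i))\<^sup>2) = cinner f (\<Psi> i) * cinner (\<Psi> i) f" for i
    unfolding complex_norm_square analysis_op_def by (metis cinner_commute)
  ultimately show ?thesis
    using frame_op_cinner[OF assms, of f f] has_sum_unique by (metis (no_types, lifting) has_sum_cong)
qed


section \<open>The resolvent of the frame operator\<close>

locale frame =
  fixes \<Psi> :: "'i \<Rightarrow> 'h::complex_hilbert" and A B :: real
  assumes lower_pos: "0 < A"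
    and bessel: "bessel B \<Psi>"
    and lower_bound: "A * (norm f)\<^sup>2 \<le> square_sum (analysis_op \<Psi> f)"

lemma is_frame_imp_frame:
  assumes "is_frame \<Psi>"
  shows "\<exists>A B. frame \<Psi> A B"
proof -
  from assms obtain A B where AB: "0 < A" "0 < B"
    and *: "\<And>f. (\<lambda>i. (cmod (cinner f (\<Psi> i)))\<^sup>2) summable_on UNIV"
      "\<And>f. A * (norm f)\<^sup>2 \<le> (\<Sum>\<^sub>\<infinity>i. (cmod (cinner f (\<Psi> i)))\<^sup>2)"
      "\<And>f. (\<Sum>\<^sub>\<infinity>i. (cmod (cinner f (\<Psi> i)))\<^sup>2) \<le> B * (norm f)\<^sup>2"
    unfolding is_frame_def by blast
  have "bessel B \<Psi>"
  proof (rule bessel_of_analysis_bound)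
    show "(\<Sum>i\<in>F. (cmod (cinner f (\<Psi> i)))\<^sup>2) \<le> B * (norm f)\<^sup>2" if "finite F" for f F
      using finite_sum_le_infsum[OF *(1) that, of f] *(3)[of f] by simp
  qed (use AB in simp)
  with AB *(2) have "frame \<Psi> A B"
    by unfold_locales (auto simp: square_sum_def analysis_op_def)
  then show ?thesis by blast
qed

context frame
begin

text \<open>The squared norm of \<open>1 - s S\<close>, for \<open>S\<close> the frame operator, is at most
  \<open>1 - 2 s A + s\<^sup>2 B\<^sup>2\<close>. Enlarging \<open>B\<^sup>2\<close> to \<open>A\<^sup>2 + B\<^sup>2\<close> keeps the bound nonnegative even on the
  zero space, where \<open>A\<close> may exceed \<open>B\<close>; the chosen \<open>s\<close> minimises it, and its minimum is
  \<open>1 - s A < 1\<close>.\<close>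

definition step :: real where "step = A / (A\<^sup>2 + B\<^sup>2)"

definition rate :: real where "rate = sqrt (1 - step * A)"

definition Q :: "'h \<Rightarrow> 'h" where "Q f = f - step *\<^sub>R frame_op \<Psi> f"

lemma step_pos: "0 < step"
  using lower_pos by (simp add: step_def add_pos_nonneg)

lemma step_mult_le_1: "step * A \<le> 1"
  using lower_pos by (simp add: step_def field_simps power2_eq_square add_pos_nonneg)

lemma rate: "0 \<le> rate" "rate < 1"
  using step_pos lower_pos step_mult_le_1 by (auto simp: rate_def)

lemma norm_Q: "norm (Q f) \<le> rate * norm f"
proof -
  let ?S = "frame_op \<Psi> f"
  have S: "A * (norm f)\<^sup>2 \<le> Re (cinner f ?S)"
    using lower_bound[of f] frame_op_quadratic_form[OF bessel, of f]
      frame_op_self_adjoint[OF bessel, of f f] by simp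
  have nS: "(norm ?S)\<^sup>2 \<le> B\<^sup>2 * (norm f)\<^sup>2"
    using frame_op_norm[OF bessel, of f] by (metis norm_ge_zero power_mono power_mult_distrib)
  have "Re (cinner f (- (step *\<^sub>R ?S))) = - step * Re (cinner f ?S)"
    using cinner_scaleR_right[of f "- step" ?S] by simp
  then have "(norm (Q f))\<^sup>2 = (norm f)\<^sup>2 - 2 * step * Re (cinner f ?S) + step\<^sup>2 * (norm ?S)\<^sup>2"
    using norm_add_sq[of f "- (step *\<^sub>R ?S)"] by (simp add: Q_def power_mult_distrib)
  also have "\<dots> \<le> (norm f)\<^sup>2 - 2 * step * (A * (norm f)\<^sup>2) + step\<^sup>2 * (B\<^sup>2 * (norm f)\<^sup>2)"
    using S nS step_pos
    by (intro add_mono diff_mono mult_left_mono) auto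
  also have "\<dots> \<le> (1 - 2 * step * A + step\<^sup>2 * (A\<^sup>2 + B\<^sup>2)) * (norm f)\<^sup>2"
    by (simp add: algebra_simps)
  also have "step\<^sup>2 * (A\<^sup>2 + B\<^sup>2) = step * A"
    using lower_pos by (simp add: step_def power2_eq_square add_pos_nonneg)
  also have "1 - 2 * step * A + step * A = rate\<^sup>2"
    using step_mult_le_1 by (simp add: rate_def)
  finally have "(norm (Q f))\<^sup>2 \<le> (rate * norm f)\<^sup>2"
    by (simp add: power_mult_distrib)
  then show ?thesis
    by (rule power2_le_imp_le) (simp add: rate)
qed

lemma Q_bounded_clinear: "bounded_clinear Q"
proof -
  have S: "bounded_clinear (frame_op \<Psi>)"
    by (rule frame_op_bounded_clinear[OF bessel])
  show ?thesis
    by (rule bounded_clinearI[OF _ _ norm_Q])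
      (use S in \<open>simp_all add: Q_def bounded_clinear_def clinear_on_def scaleC_of_real[symmetric]
        scaleC_add_right scaleC_scaleC mult.commute complex_vector.scale_right_diff_distrib\<close>)
qed

lemma Q_linear:
  "Q (x + y) = Q x + Q y" "Q (a *\<^sub>C x) = a *\<^sub>C Q x"
  using Q_bounded_clinear by (simp_all add: bounded_clinear_def clinear_on_def)

lemma Q_power_linear:
  "(Q ^^ m) (x + y) = (Q ^^ m) x + (Q ^^ m) y" "(Q ^^ m) (a *\<^sub>C x) = a *\<^sub>C (Q ^^ m) x"
  by (induction m) (simp_all add: Q_linear)

lemma norm_Q_power: "norm ((Q ^^ m) f) \<le> rate ^ m * norm f"
proof (induction m)
  case (Suc m)
  have "norm ((Q ^^ Suc m) f) \<le> rate * norm ((Q ^^ m) f)"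
    by (simp add: norm_Q)
  also have "\<dots> \<le> rate * (rate ^ m * norm f)"
    by (intro mult_left_mono Suc rate)
  finally show ?case by (simp add: mult.assoc)
qed simp

text \<open>The Neumann series of \<open>(1 - z Q)\<^sup>-\<^sup>1\<close>. At \<open>z = 1\<close> it inverts \<open>s S\<close>; it is also wanted on a circle
  around the unit disc, where \<open>1 - z\<close> does not vanish.\<close>

definition neumann :: "complex \<Rightarrow> 'h \<Rightarrow> 'h"
  where "neumann z f = (\<Sum>m. z ^ m *\<^sub>C (Q ^^ m) f)"

lemma norm_neumann_term: "norm (z ^ m *\<^sub>C (Q ^^ m) f) \<le> (cmod z * rate) ^ m * norm f"
proof -
  have "norm (z ^ m *\<^sub>C (Q ^^ m) f) \<le> cmod z ^ m * (rate ^ m * norm f)"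
    unfolding norm_scaleC norm_power by (intro mult_left_mono norm_Q_power) simp
  then show ?thesis
    by (simp add: power_mult_distrib mult_ac)
qed

lemma neumann_summable_norm:
  assumes "cmod z * rate < 1"
  shows "summable (\<lambda>m. norm (z ^ m *\<^sub>C (Q ^^ m) f))"
proof (rule summable_comparison_test'[where N = 0])
  show "summable (\<lambda>m. (cmod z * rate) ^ m * norm f)"
    using assms rate by (intro summable_mult2 summable_geometric) simp
qed (use norm_neumann_term in simp)

lemma neumann_sums:
  assumes "cmod z * rate < 1"
  shows "(\<lambda>m. z ^ m *\<^sub>C (Q ^^ m) f) sums neumann z f"
  unfolding neumann_def
  by (rule summable_sums[OF summable_norm_cancel[OF neumann_summable_norm[OF assms]]])

lemma neumann_bounded_clinear:
  assumes "cmod z * rate < 1"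
  shows "bounded_clinear (neumann z)"
proof (rule bounded_clinearI)
  note sums = neumann_sums[OF assms]
  show "neumann z (x + y) = neumann z x + neumann z y" for x y
    using sums_add[OF sums[of x] sums[of y]] sums[of "x + y"]
    by (simp add: Q_power_linear scaleC_add_right sums_unique2)
  show "neumann z (a *\<^sub>C x) = a *\<^sub>C neumann z x" for a x
    using bounded_linear.sums[OF bounded_linear_scaleC sums[of x], of a] sums[of "a *\<^sub>C x"]
    by (simp add: Q_power_linear scaleC_scaleC mult.commute sums_unique2)
  show "norm (neumann z x) \<le> (1 / (1 - cmod z * rate)) * norm x" for x
  proof -
    have geo: "(\<lambda>m. (cmod z * rate) ^ m * norm x) sums (1 / (1 - cmod z * rate) * norm x)"
      using assms rate by (intro sums_mult2 geometric_sums) simp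
    have "norm (neumann z x) \<le> (\<Sum>m. norm (z ^ m *\<^sub>C (Q ^^ m) x))"
      unfolding neumann_def by (rule summable_norm[OF neumann_summable_norm[OF assms]])
    also have "\<dots> \<le> 1 / (1 - cmod z * rate) * norm x"
      by (rule sums_le[OF norm_neumann_term summable_sums[OF neumann_summable_norm[OF assms]] geo])
    finally show ?thesis .
  qed
qed

lemma neumann_Q_commute:
  assumes "cmod z * rate < 1"
  shows "neumann z (Q f) = Q (neumann z f)"
  using bounded_linear.sums[OF bounded_clinear_bounded_linear[OF Q_bounded_clinear] neumann_sums[OF assms], of f]
    neumann_sums[OF assms, of "Q f"]
  by (simp add: Q_linear sums_unique2 flip: funpow_swap1)

lemma neumann_right_inverse:
  assumes "cmod z * rate < 1"
  shows "neumann z f - z *\<^sub>C Q (neumann z f) = f"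
proof -
  have "(\<lambda>m. z *\<^sub>C (z ^ m *\<^sub>C (Q ^^ m) (Q f))) sums (z *\<^sub>C neumann z (Q f))"
    by (rule bounded_linear.sums[OF bounded_linear_scaleC neumann_sums[OF assms]])
  then have "(\<lambda>m. z ^ Suc m *\<^sub>C (Q ^^ Suc m) f) sums (z *\<^sub>C Q (neumann z f))"
    by (simp only: scaleC_scaleC neumann_Q_commute[OF assms] funpow_Suc_right o_def power_Suc)
  then have "(\<lambda>m. z ^ m *\<^sub>C (Q ^^ m) f) sums (z *\<^sub>C Q (neumann z f) + f)"
    by (subst (asm) sums_Suc_iff) (simp add: scaleC_one)
  then have "neumann z f = z *\<^sub>C Q (neumann z f) + f"
    by (rule sums_unique2[OF neumann_sums[OF assms]])
  then show ?thesis
    by (simp add: diff_eq_eq add.commute)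
qed

lemma neumann_left_inverse:
  assumes "cmod z * rate < 1"
  shows "neumann z (f - z *\<^sub>C Q f) = f"
  using neumann_right_inverse[OF assms, of f] neumann_bounded_clinear[OF assms]
    bounded_linear.linear[OF bounded_clinear_bounded_linear[OF neumann_bounded_clinear[OF assms]]]
  by (simp add: linear_diff bounded_clinear_scaleC neumann_Q_commute[OF assms])

lemma neumann_holomorphic:
  assumes "0 < R" and "R * rate < 1"
  shows "(\<lambda>z. cinner (neumann z f) g) holomorphic_on ball 0 R"
proof (rule power_series_holomorphic)
  fix z :: complex assume "z \<in> ball 0 R"
  then have "cmod z * rate \<le> R * rate"
    using rate by (intro mult_right_mono) auto
  then have z: "cmod z * rate < 1"
    using assms by simp
  show "(\<lambda>m. cinner ((Q ^^ m) f) g * (z - 0) ^ m) sums cinner (neumann z f) g"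
    using bounded_linear.sums[OF bounded_linear_cinner_left neumann_sums[OF z], of f g]
    by (simp add: cinner_scaleC_left mult.commute)
qed

lemma frame_op_inj: "inj (frame_op \<Psi>)"
proof (rule injI)
  fix x y assume "frame_op \<Psi> x = frame_op \<Psi> y"
  then have "frame_op \<Psi> (x - y) = 0"
    using bounded_linear.linear[OF bounded_clinear_bounded_linear[OF frame_op_bounded_clinear[OF bessel]]]
    by (simp add: linear_diff)
  then have "square_sum (analysis_op \<Psi> (x - y)) = 0"
    using frame_op_quadratic_form[OF bessel, of "x - y"] by simp
  then have "A * (norm (x - y))\<^sup>2 \<le> 0"
    using lower_bound[of "x - y"] by simp
  then show "x = y"
    using lower_pos by (simp add: mult_le_0_iff)
qed

lemma frame_op_neumann: "step *\<^sub>R frame_op \<Psi> (neumann 1 f) = f"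
  using neumann_right_inverse[of 1 f] rate by (simp add: scaleC_one Q_def)

lemma frame_op_surj: "surj (frame_op \<Psi>)"
proof (rule surjI)
  show "frame_op \<Psi> (step *\<^sub>R neumann 1 f) = f" for f
    using frame_op_neumann[of f]
      bounded_linear.linear[OF bounded_clinear_bounded_linear[OF frame_op_bounded_clinear[OF bessel]]]
    by (simp add: linear_scale)
qed

lemma frame_op_inv: "frame_op \<Psi> (inv (frame_op \<Psi>) f) = f"
  using frame_op_surj by (rule surj_f_inv_f)

lemma inv_frame_op_eq: "inv (frame_op \<Psi>) f = step *\<^sub>R neumann 1 f"
proof (rule inv_f_eq[OF frame_op_inj])
  show "frame_op \<Psi> (step *\<^sub>R neumann 1 f) = f"
    using frame_op_neumann[of f]
      bounded_linear.linear[OF bounded_clinear_bounded_linear[OF frame_op_bounded_clinear[OF bessel]]]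
    by (simp add: linear_scale)
qed

lemma cinner_canonical_dual: "cinner f (canonical_dual \<Psi> i) = cinner (inv (frame_op \<Psi>) f) (\<Psi> i)"
  unfolding canonical_dual_def
  using frame_op_self_adjoint[OF bessel, of "inv (frame_op \<Psi>) f" "inv (frame_op \<Psi>) (\<Psi> i)"]
  by (simp add: frame_op_inv)

lemma reconstruction: "((\<lambda>i. cinner f (canonical_dual \<Psi> i) *\<^sub>C \<Psi> i) has_sum f) UNIV"
  using bessel_synthesis_has_sum[OF bessel bessel_analysis(1)[OF bessel], of "inv (frame_op \<Psi>) f"]
  by (simp add: cinner_canonical_dual frame_op_inv flip: frame_op_def) (simp add: analysis_op_def)

end


section \<open>Matrices of operators relative to a frame\<close>

lemma lp_space_2: "lp_space 2 = Collect square_summable"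
  by (auto simp: lp_space_def square_summable_def)

lemma lp_norm_2: "lp_norm 2 c = sqrt (square_sum c)"
  by (simp add: lp_norm_def square_sum_def powr_half_sqrt infsum_nonneg)

lemma lpw_space_one: "lpw_space p (\<lambda>_. 1) = lp_space p" "lpw_norm p (\<lambda>_. 1) = lp_norm p"
  by (simp_all add: lpw_space_def lpw_norm_def fun_eq_iff)

definition op_matrix :: "('i \<Rightarrow> 'h::complex_hilbert) \<Rightarrow> ('h \<Rightarrow> 'h) \<Rightarrow> 'i \<Rightarrow> 'i \<Rightarrow> complex"
  where "op_matrix \<Psi> T i j = cinner (T (\<Psi> j)) (\<Psi> i)"

lemma gram_eq_op_matrix: "gram \<Psi> = op_matrix \<Psi> (\<lambda>x. x)"
  by (simp add: fun_eq_iff gram_def op_matrix_def)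

lemma op_matrix_has_sum:
  assumes "bessel B \<Psi>" and "bounded_clinear T" and "square_summable c"
  shows "((\<lambda>k. op_matrix \<Psi> T i k * c k) has_sum analysis_op \<Psi> (T (synthesis_op \<Psi> c)) i) UNIV"
  using has_sum_bounded_linear[OF bounded_linear_cinner_left
      has_sum_bounded_linear[OF bounded_clinear_bounded_linear[OF assms(2)]
        bessel_synthesis_has_sum[OF assms(1,3)]], of "\<Psi> i"]
  by (simp add: bounded_clinear_scaleC[OF assms(2)] cinner_scaleC_left op_matrix_def analysis_op_def
      mult.commute)

text \<open>Matrices \<open>\<alpha> + \<beta> C T D\<close> contain the Gram matrix \<open>C D\<close> and its resolvents, and they are
  composed by computing with operators on the Hilbert space.\<close>

definition shifted_matrix ::
    "('i \<Rightarrow> 'h::complex_hilbert) \<Rightarrow> complex \<Rightarrow> complex \<Rightarrow> ('h \<Rightarrow> 'h) \<Rightarrow> 'i \<Rightarrow> 'i \<Rightarrow> complex"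
  where "shifted_matrix \<Psi> \<alpha> \<beta> T i j = \<alpha> * mat_one i j + \<beta> * op_matrix \<Psi> T i j"

lemma has_sum_mat_one: "((\<lambda>k. mat_one i k * c k) has_sum c i) UNIV"
  by (rule has_sum_finite_neutralI[where B = "{i}"]) (auto simp: mat_one_def)

lemma shifted_matrix_has_sum:
  assumes "bessel B \<Psi>" and "bounded_clinear T" and "square_summable c"
  shows "((\<lambda>k. shifted_matrix \<Psi> \<alpha> \<beta> T i k * c k) has_sum
    (\<alpha> * c i + \<beta> * analysis_op \<Psi> (T (synthesis_op \<Psi> c)) i)) UNIV"
proof -
  have "((\<lambda>k. \<alpha> * (mat_one i k * c k) + \<beta> * (op_matrix \<Psi> T i k * c k)) has_sum
    (\<alpha> * c i + \<beta> * analysis_op \<Psi> (T (synthesis_op \<Psi> c)) i)) UNIV"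
    by (intro has_sum_add has_sum_cmult_right has_sum_mat_one op_matrix_has_sum[OF assms])
  then show ?thesis
    by (simp add: shifted_matrix_def algebra_simps)
qed

lemma mat_vec_shifted:
  assumes "bessel B \<Psi>" and "bounded_clinear T" and "square_summable c"
  shows "mat_vec (shifted_matrix \<Psi> \<alpha> \<beta> T) c =
    (\<lambda>i. \<alpha> * c i + \<beta> * analysis_op \<Psi> (T (synthesis_op \<Psi> c)) i)"
  unfolding mat_vec_def by (rule ext) (rule infsumI[OF shifted_matrix_has_sum[OF assms]])

lemma square_summable_mat_vec_shifted:
  assumes "bessel B \<Psi>" and "bounded_clinear T" and "square_summable c"
  shows "square_summable (mat_vec (shifted_matrix \<Psi> \<alpha> \<beta> T) c)"
  unfolding mat_vec_shifted[OF assms]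
  by (intro square_summable_add square_summable_scale assms(3) bessel_analysis(1)[OF assms(1)])

lemma square_sum_add_le:
  assumes "square_summable c" and "square_summable d"
  shows "square_sum (\<lambda>i. c i + d i) \<le> 2 * square_sum c + 2 * square_sum d"
proof -
  note cmod_add_sq_le[of "c _" "d _"]
  moreover have "(\<lambda>i. (cmod (c i + d i))\<^sup>2) summable_on UNIV"
    using square_summable_add[OF assms] by (simp add: square_summable_def)
  ultimately have "square_sum (\<lambda>i. c i + d i) \<le> (\<Sum>\<^sub>\<infinity>i. 2 * (cmod (c i))\<^sup>2 + 2 * (cmod (d i))\<^sup>2)"
    using assms unfolding square_summable_def square_sum_def
    by (intro infsum_mono summable_on_add summable_on_cmult_right) auto
  also have "\<dots> = 2 * square_sum c + 2 * square_sum d"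
    using assms unfolding square_summable_def square_sum_def
    by (subst infsum_add) (auto intro: summable_on_cmult_right simp: infsum_cmult_right)
  finally show ?thesis .
qed

lemma square_sum_scale:
  assumes "square_summable c"
  shows "square_sum (\<lambda>i. a * c i) = (cmod a)\<^sup>2 * square_sum c"
  using assms unfolding square_sum_def square_summable_def
  by (simp add: norm_mult power_mult_distrib infsum_cmult_right)

lemma bounded_on_l2_shifted:
  assumes B: "bessel B \<Psi>" and T: "bounded_clinear T"
  shows "bounded_on_l2 (shifted_matrix \<Psi> \<alpha> \<beta> T)"
proof -
  obtain K where K: "K \<ge> 0" "\<And>x. norm (T x) \<le> K * norm x"
    using T by (rule bounded_clinear_nonneg_bound) blast
  define L where "L = 2 * (cmod \<alpha>)\<^sup>2 + 2 * ((cmod \<beta>)\<^sup>2 * (B * (K\<^sup>2 * B)))"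
  have "square_sum (mat_vec (shifted_matrix \<Psi> \<alpha> \<beta> T) c) \<le> L * square_sum c"
    if c: "square_summable c" for c
  proof -
    let ?x = "synthesis_op \<Psi> c"
    note an = bessel_analysis[OF B, of "T ?x"]
    have "(norm (T ?x))\<^sup>2 \<le> (K * norm ?x)\<^sup>2"
      by (intro power_mono K) simp
    also have "\<dots> \<le> K\<^sup>2 * (B * square_sum c)"
      unfolding power_mult_distrib by (intro mult_left_mono bessel_synthesis_norm[OF B c]) simp
    finally have "B * (norm (T ?x))\<^sup>2 \<le> B * (K\<^sup>2 * (B * square_sum c))"
      by (rule mult_left_mono) (rule bessel_nonneg[OF B])
    with an(2) have "square_sum (analysis_op \<Psi> (T ?x)) \<le> B * (K\<^sup>2 * (B * square_sum c))"
      by (rule order.trans)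
    then have "(cmod \<beta>)\<^sup>2 * square_sum (analysis_op \<Psi> (T ?x)) \<le> (cmod \<beta>)\<^sup>2 * (B * (K\<^sup>2 * (B * square_sum c)))"
      by (intro mult_left_mono) auto
    then show ?thesis
      unfolding mat_vec_shifted[OF B T c]
      using square_sum_add_le[OF square_summable_scale[OF c] square_summable_scale[OF an(1)], of \<alpha> \<beta>]
      by (simp add: square_sum_scale c an(1) L_def algebra_simps)
  qed
  moreover have "0 \<le> L"
    using bessel_nonneg[OF B] by (simp add: L_def)
  moreover have "0 \<le> square_sum c" for c :: "'a \<Rightarrow> complex"
    by (simp add: square_sum_def infsum_nonneg)
  ultimately show ?thesis
    unfolding bounded_on_lpw_def lpw_space_one lp_space_2 lp_norm_2
    by (intro exI[where x = "sqrt L"])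
      (auto simp: real_sqrt_mult[symmetric] square_summable_mat_vec_shifted[OF B T]
        intro: has_sum_imp_summable[OF shifted_matrix_has_sum[OF B T]])
qed

lemma mat_vec_shifted_shifted:
  assumes B: "bessel B \<Psi>" and T: "bounded_clinear T" and U: "bounded_clinear U"
    and c: "square_summable c"
  defines "x \<equiv> synthesis_op \<Psi> c"
  shows "mat_vec (shifted_matrix \<Psi> \<alpha> \<beta> T) (mat_vec (shifted_matrix \<Psi> \<alpha>' \<beta>' U) c) =
    (\<lambda>i. \<alpha> * \<alpha>' * c i + analysis_op \<Psi> ((\<alpha> * \<beta>') *\<^sub>C U x
      + \<beta> *\<^sub>C T (\<alpha>' *\<^sub>C x + \<beta>' *\<^sub>C frame_op \<Psi> (U x))) i)"
proof -
  note s = bessel_analysis(1)[OF B]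
  have "synthesis_op \<Psi> (mat_vec (shifted_matrix \<Psi> \<alpha>' \<beta>' U) c) = \<alpha>' *\<^sub>C x + \<beta>' *\<^sub>C frame_op \<Psi> (U x)"
    unfolding mat_vec_shifted[OF B U c]
    by (simp add: synthesis_add[OF B] synthesis_scale[OF B] square_summable_scale c s x_def
        flip: frame_op_def)
  then show ?thesis
    unfolding mat_vec_shifted[OF B T square_summable_mat_vec_shifted[OF B U c]]
    by (simp add: mat_vec_shifted[OF B U c] analysis_add analysis_scale x_def algebra_simps)
qed

context frame
begin

text \<open>With \<open>C\<close> and \<open>D\<close> the analysis and synthesis operators and \<open>s\<close> the step, \<open>1 - z (1 - s C D)\<close> is
  inverted by means of the inverse \<open>neumann z\<close> of \<open>1 - z (1 - s D C)\<close>. On the kernel of \<open>D\<close> the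
  former operator is multiplication by \<open>1 - z\<close>, whence the exclusion of \<open>z = 1\<close>.\<close>

definition pencil :: "complex \<Rightarrow> 'i \<Rightarrow> 'i \<Rightarrow> complex"
  where "pencil z = shifted_matrix \<Psi> (1 - z) (z * step) (\<lambda>x. x)"

definition pencil_inverse :: "complex \<Rightarrow> 'i \<Rightarrow> 'i \<Rightarrow> complex"
  where "pencil_inverse z = shifted_matrix \<Psi> (1 / (1 - z)) (- (z * step) / (1 - z)) (neumann z)"

lemma pencil_frame_op: "f - z *\<^sub>C Q f = (1 - z) *\<^sub>C f + (z * step) *\<^sub>C frame_op \<Psi> f"
  by (simp add: Q_def scaleC_of_real[symmetric] scaleC_scaleC scaleC_one
      complex_vector.scale_right_diff_distrib complex_vector.scale_left_diff_distrib)

lemma pencil_mult_inverse: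
  assumes z: "cmod z * rate < 1" "z \<noteq> 1" and c: "square_summable c"
  shows "mat_vec (pencil z) (mat_vec (pencil_inverse z) c) = c"
proof -
  define x where "x = synthesis_op \<Psi> c"
  define y where "y = neumann z x"
  have "x = (1 - z) *\<^sub>C y + (z * step) *\<^sub>C frame_op \<Psi> y"
    using neumann_right_inverse[OF z(1), of x] pencil_frame_op[of y z] by (simp add: y_def)
  then have "x - (z * step) *\<^sub>C frame_op \<Psi> y = (1 - z) *\<^sub>C y"
    by (metis add_diff_cancel_right')
  then have "(1 / (1 - z)) *\<^sub>C (x - (z * step) *\<^sub>C frame_op \<Psi> y) = y"
    using z(2) by (simp add: scaleC_scaleC scaleC_one)
  then have "(1 / (1 - z)) *\<^sub>C x + (- (z * step) / (1 - z)) *\<^sub>C frame_op \<Psi> y = y"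
    by (simp add: complex_vector.scale_right_diff_distrib scaleC_scaleC)
  then have zero: "((1 - z) * (- (z * step) / (1 - z))) *\<^sub>C y + (z * step) *\<^sub>C ((1 / (1 - z)) *\<^sub>C x
      + (- (z * step) / (1 - z)) *\<^sub>C frame_op \<Psi> y) = 0"
    using z(2) by (simp add: scaleC_add_left[symmetric])
  have "mat_vec (pencil z) (mat_vec (pencil_inverse z) c) =
      (\<lambda>i. (1 - z) * (1 / (1 - z)) * c i + analysis_op \<Psi> 0 i)"
    unfolding pencil_def pencil_inverse_def
    by (subst mat_vec_shifted_shifted[OF bessel bounded_clinear_id neumann_bounded_clinear[OF z(1)] c])
      (simp only: x_def[symmetric] y_def[symmetric] zero)
  then show ?thesis
    using z(2) by (simp add: analysis_op_def)
qed

lemma pencil_inverse_mult: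
  assumes z: "cmod z * rate < 1" "z \<noteq> 1" and c: "square_summable c"
  shows "mat_vec (pencil_inverse z) (mat_vec (pencil z) c) = c"
proof -
  define x where "x = synthesis_op \<Psi> c"
  have "neumann z ((1 - z) *\<^sub>C x + (z * step) *\<^sub>C frame_op \<Psi> x) = x"
    using neumann_left_inverse[OF z(1), of x] by (simp add: pencil_frame_op)
  then show ?thesis
    unfolding pencil_def pencil_inverse_def
    by (subst mat_vec_shifted_shifted[OF bessel neumann_bounded_clinear[OF z(1)] bounded_clinear_id c])
      (use z(2) in \<open>simp add: x_def[symmetric] analysis_op_def flip: scaleC_add_left\<close>)
qed

lemma is_l2_inverse_pencil:
  assumes "cmod z * rate < 1" and "z \<noteq> 1"
  shows "is_l2_inverse (pencil z) (pencil_inverse z)"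
  unfolding is_l2_inverse_def lp_space_2
  using assms pencil_mult_inverse pencil_inverse_mult
    bounded_on_l2_shifted[OF bessel bounded_clinear_id]
    bounded_on_l2_shifted[OF bessel neumann_bounded_clinear[OF assms(1)]]
  by (auto simp: pencil_def pencil_inverse_def)

end


section \<open>Weighted \<open>\<ell>\<^sup>1\<close> spaces\<close>

definition weighted_l1 :: "('i \<Rightarrow> real) \<Rightarrow> ('i \<Rightarrow> complex) \<Rightarrow> bool"
  where "weighted_l1 w c \<longleftrightarrow> (\<lambda>i. cmod (c i) * w i) summable_on UNIV"

definition l1_norm :: "('i \<Rightarrow> real) \<Rightarrow> ('i \<Rightarrow> complex) \<Rightarrow> real"
  where "l1_norm w c = (\<Sum>\<^sub>\<infinity>i. cmod (c i) * w i)"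

lemma lpw_1:
  assumes "\<forall>i. 0 < w i"
  shows "lpw_space 1 w = Collect (weighted_l1 w)" and "lpw_norm 1 w = l1_norm w"
proof -
  have [simp]: "cmod (c i * complex_of_real (w i)) = cmod (c i) * w i" for c i
    using assms[rule_format, of i] by (simp add: norm_mult)
  have [simp]: "(cmod (c i) * w i) powr 1 = cmod (c i) * w i" for c i
    using assms[rule_format, of i] by simp
  have [simp]: "\<bar>cmod (c i) * w i\<bar> = cmod (c i) * w i" for c i
    using assms[rule_format, of i] by simp
  have [simp]: "0 \<le> (\<Sum>\<^sub>\<infinity>i. cmod (c i) * w i)" for c
    using assms by (intro infsum_nonneg) (simp add: less_imp_le)
  show "lpw_space 1 w = Collect (weighted_l1 w)"
    by (auto simp: lpw_space_def lp_space_def weighted_l1_def)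
  show "lpw_norm 1 w = l1_norm w"
    by (simp add: fun_eq_iff lpw_norm_def lp_norm_def l1_norm_def)
qed

lemma weighted_l1_add:
  assumes w: "\<forall>i. 0 < w i" and c: "weighted_l1 w c" and d: "weighted_l1 w d"
  shows "weighted_l1 w (\<lambda>i. c i + d i)" and "l1_norm w (\<lambda>i. c i + d i) \<le> l1_norm w c + l1_norm w d"
proof -
  have le: "cmod (c i + d i) * w i \<le> cmod (c i) * w i + cmod (d i) * w i" for i
    unfolding distrib_right[symmetric] using w[rule_format, of i] by (intro mult_right_mono norm_triangle_ineq) simp
  have s: "(\<lambda>i. cmod (c i) * w i + cmod (d i) * w i) summable_on UNIV"
    using c d unfolding weighted_l1_def by (rule summable_on_add)
  show *: "weighted_l1 w (\<lambda>i. c i + d i)"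
    unfolding weighted_l1_def
    by (rule summable_on_comparison_test[OF s le]) (use w in \<open>simp add: less_imp_le\<close>)
  have "l1_norm w (\<lambda>i. c i + d i) \<le> (\<Sum>\<^sub>\<infinity>i. cmod (c i) * w i + cmod (d i) * w i)"
    unfolding l1_norm_def by (rule infsum_mono[OF *[unfolded weighted_l1_def] s le])
  also have "\<dots> = l1_norm w c + l1_norm w d"
    using c d unfolding weighted_l1_def l1_norm_def by (rule infsum_add)
  finally show "l1_norm w (\<lambda>i. c i + d i) \<le> l1_norm w c + l1_norm w d" .
qed

lemma weighted_l1_scale:
  assumes "weighted_l1 w c"
  shows "weighted_l1 w (\<lambda>i. a * c i)" and "l1_norm w (\<lambda>i. a * c i) = cmod a * l1_norm w c"
  using assms unfolding weighted_l1_def l1_norm_def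
  by (auto simp: norm_mult mult.assoc infsum_cmult_right intro: summable_on_cmult_right)

lemma weighted_l1_diff:
  assumes "\<forall>i. 0 < w i" and "weighted_l1 w c" and "weighted_l1 w d"
  shows "weighted_l1 w (c - d)" and "l1_norm w (c - d) \<le> l1_norm w c + l1_norm w d"
  using weighted_l1_add[OF assms(1,2) weighted_l1_scale(1)[OF assms(3), of "-1"]]
    weighted_l1_scale(2)[OF assms(3), of "-1"]
  by (simp_all add: fun_diff_def)

lemma l1_norm_minus_commute: "l1_norm w (c - d) = l1_norm w (d - c)"
  by (simp add: l1_norm_def norm_minus_commute)

lemma coordinate_le_l1_norm:
  assumes "\<forall>i. 0 < w i" and "weighted_l1 w c"
  shows "cmod (c i) * w i \<le> l1_norm w c"
  using finite_sum_le_infsum[of "\<lambda>i. cmod (c i) * w i" UNIV "{i}"] assms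
  by (simp add: weighted_l1_def l1_norm_def less_imp_le)

lemma l1_norm_nonneg:
  assumes "\<forall>i. 0 < w i"
  shows "0 \<le> l1_norm w c"
  using assms unfolding l1_norm_def by (intro infsum_nonneg) (simp add: less_imp_le)

lemma l1_norm_eq_0:
  assumes "\<forall>i. 0 < w i" and "weighted_l1 w c" and "l1_norm w c \<le> 0"
  shows "c i = 0"
proof -
  have "cmod (c i) * w i \<le> 0"
    using coordinate_le_l1_norm[OF assms(1,2), of i] assms(3) by simp
  then show ?thesis
    using assms(1)[rule_format, of i] by (simp add: mult_le_0_iff)
qed

lemma weighted_l1I:
  assumes "\<forall>i. 0 < w i" and "\<And>F. finite F \<Longrightarrow> (\<Sum>i\<in>F. cmod (c i) * w i) \<le> K"
  shows "weighted_l1 w c" and "l1_norm w c \<le> K"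
proof -
  show *: "weighted_l1 w c"
    unfolding weighted_l1_def
    by (rule nonneg_bdd_above_summable_on)
      (use assms in \<open>auto intro!: bdd_aboveI2[where M = K] simp: less_imp_le\<close>)
  show "l1_norm w c \<le> K"
    unfolding l1_norm_def
    by (rule infsum_le_finite_sums[OF *[unfolded weighted_l1_def]]) (use assms(2) in simp)
qed

text \<open>Coordinatewise limits of Cauchy sequences are limits in norm by Fatou's lemma, applied to
  finite sums.\<close>

lemma weighted_l1_complete:
  assumes w: "\<forall>i. 0 < w i" and X: "\<And>n. weighted_l1 w (X n)"
    and cauchy: "\<And>e. e > 0 \<Longrightarrow> \<exists>k::nat. \<forall>m\<ge>k. \<forall>n\<ge>k. l1_norm w (X m - X n) < e"
  shows "\<exists>c. weighted_l1 w c \<and> (\<lambda>n. l1_norm w (X n - c)) \<longlonglongrightarrow> 0"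
proof -
  have d: "weighted_l1 w (X m - X n)" for m n
    by (rule weighted_l1_diff[OF w X X])
  have "Cauchy (\<lambda>n. X n i)" for i
  proof (rule CauchyI)
    fix e :: real assume "0 < e"
    then have "0 < e * w i" using w by simp
    with cauchy obtain k where k: "\<forall>m\<ge>k. \<forall>n\<ge>k. l1_norm w (X m - X n) < e * w i"
      by blast
    have "cmod (X m i - X n i) < e" if "m \<ge> k" "n \<ge> k" for m n
    proof -
      have "cmod (X m i - X n i) * w i < e * w i"
        using coordinate_le_l1_norm[OF w d, of m n i] k that
        by (simp add: order_le_less_trans)
      then show ?thesis using w[rule_format, of i] by simp
    qed
    then show "\<exists>k. \<forall>m\<ge>k. \<forall>n\<ge>k. cmod (X m i - X n i) < e" by blast
  qed
  then have "\<exists>l. (\<lambda>n. X n i) \<longlonglongrightarrow> l" for i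
    using Cauchy_convergent convergent_def by blast
  then obtain c where c: "\<And>i. (\<lambda>n. X n i) \<longlonglongrightarrow> c i"
    by metis
  have tail: "\<exists>k. \<forall>n\<ge>k. weighted_l1 w (X n - c) \<and> l1_norm w (X n - c) \<le> e" if "e > 0" for e
  proof -
    from cauchy[OF that] obtain k where k: "\<forall>m\<ge>k. \<forall>n\<ge>k. l1_norm w (X m - X n) < e"
      by blast
    have "(\<Sum>i\<in>F. cmod ((X n - c) i) * w i) \<le> e" if "n \<ge> k" "finite F" for n F
    proof (rule tendsto_upperbound)
      show "(\<lambda>m. \<Sum>i\<in>F. cmod ((X n - X m) i) * w i) \<longlonglongrightarrow> (\<Sum>i\<in>F. cmod ((X n - c) i) * w i)"
        unfolding minus_apply by (intro tendsto_intros c)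
      have "(\<Sum>i\<in>F. cmod ((X n - X m) i) * w i) \<le> l1_norm w (X n - X m)" for m
        unfolding l1_norm_def using d[of n m] \<open>finite F\<close> w
        by (intro finite_sum_le_infsum) (auto simp: weighted_l1_def less_imp_le)
      moreover have "l1_norm w (X n - X m) \<le> e" if "m \<ge> k" for m
        using k \<open>n \<ge> k\<close> that by (simp add: less_imp_le)
      ultimately show "\<forall>\<^sub>F m in sequentially. (\<Sum>i\<in>F. cmod ((X n - X m) i) * w i) \<le> e"
        by (intro eventually_sequentiallyI[of k]) (metis order.trans)
    qed simp
    then show ?thesis
      by (intro exI[of _ k] allI impI conjI weighted_l1I[OF w])
  qed
  obtain k where "weighted_l1 w (X k - c)"
    using tail[of 1] by auto
  then have "weighted_l1 w (X k - (X k - c))"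
    by (rule weighted_l1_diff(1)[OF w X])
  moreover have "X k - (X k - c) = c" by simp
  moreover have "(\<lambda>n. l1_norm w (X n - c)) \<longlonglongrightarrow> 0"
  proof (rule LIMSEQ_I)
    fix e :: real assume "0 < e"
    then obtain k where "\<forall>n\<ge>k. l1_norm w (X n - c) \<le> e / 2"
      using tail[of "e / 2"] by auto
    moreover have "0 \<le> l1_norm w (X n - c)" for n
      by (rule l1_norm_nonneg[OF w])
    ultimately have "norm (l1_norm w (X n - c) - 0) < e" if "n \<ge> k" for n
      using that \<open>0 < e\<close> by force
    then show "\<exists>k. \<forall>n\<ge>k. norm (l1_norm w (X n - c) - 0) < e"
      by blast
  qed
  ultimately show ?thesis by auto
qed


section \<open>The cross Gram matrix is bounded on weighted \<open>\<ell>\<^sup>1\<close>\<close>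

definition cross_gram :: "('i \<Rightarrow> 'h::complex_hilbert) \<Rightarrow> 'i \<Rightarrow> 'i \<Rightarrow> complex"
  where "cross_gram \<Psi> i j = cinner (\<Psi> j) (canonical_dual \<Psi> i)"

lemma analysis_dual_column: "analysis_op (canonical_dual \<Psi>) (\<Psi> j) = (\<lambda>i. cross_gram \<Psi> i j)"
  by (simp add: analysis_op_def cross_gram_def)

text \<open>Idempotence is the reconstruction formula for \<open>\<psi>\<^sub>j\<close>, paired with a dual vector.\<close>

lemma (in frame) cross_gram_idempotent:
  "((\<lambda>k. cross_gram \<Psi> i k * cross_gram \<Psi> k j) has_sum cross_gram \<Psi> i j) UNIV"
  using has_sum_bounded_linear[OF bounded_linear_cinner_left reconstruction[of "\<Psi> j"], of "canonical_dual \<Psi> i"]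
  by (simp add: cross_gram_def cinner_scaleC_left mult.commute)

lemma mat_vec_unit: "mat_vec A (\<lambda>k. mat_one k j) = (\<lambda>i. A i j)"
  unfolding mat_vec_def
proof (rule ext, rule infsumI)
  show "((\<lambda>k. A i k * mat_one k j) has_sum A i j) UNIV" for i
    by (rule has_sum_finite_neutralI[where B = "{j}"]) (auto simp: mat_one_def)
qed

lemma unit_square_summable: "square_summable (\<lambda>k. mat_one k j)"
  unfolding square_summable_def
  by (rule finite_nonzero_values_imp_summable_on) (auto simp: mat_one_def)

lemma unit_weighted_l1: "weighted_l1 w (\<lambda>k. mat_one k j)" "l1_norm w (\<lambda>k. mat_one k j) = w j"
proof -
  have "((\<lambda>k. cmod (mat_one k j) * w k) has_sum w j) UNIV"
    by (rule has_sum_finite_neutralI[where B = "{j}"]) (auto simp: mat_one_def)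
  then show "weighted_l1 w (\<lambda>k. mat_one k j)" "l1_norm w (\<lambda>k. mat_one k j) = w j"
    by (auto simp: weighted_l1_def l1_norm_def has_sum_iff)
qed

lemma admissible_weight_bound:
  assumes w: "admissible_weight \<A> w" and "A \<in> \<A>"
  obtains K where "K \<ge> 0"
    and "\<And>c. weighted_l1 w c \<Longrightarrow> weighted_l1 w (mat_vec A c) \<and> l1_norm w (mat_vec A c) \<le> K * l1_norm w c"
proof -
  have pos: "\<forall>i. 0 < w i"
    using w by (simp add: admissible_weight_def)
  have "bounded_on_lpw 1 w A"
    using assms by (simp add: admissible_weight_def)
  then obtain K where K: "\<And>c. weighted_l1 w c \<Longrightarrow> weighted_l1 w (mat_vec A c)"
    "\<And>c. weighted_l1 w c \<Longrightarrow> l1_norm w (mat_vec A c) \<le> K * l1_norm w c"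
    unfolding bounded_on_lpw_def lpw_1[OF pos] by auto
  have "K * l1_norm w c \<le> max K 0 * l1_norm w c" for c
    by (intro mult_right_mono l1_norm_nonneg[OF pos]) simp
  with K that[of "max K 0"] show ?thesis
    by (meson max.cobounded2 order.trans)
qed

text \<open>A bound that holds near every point of a compact set holds uniformly on it.\<close>

lemma compact_uniform_bound:
  fixes P :: "'a::metric_space \<Rightarrow> real \<Rightarrow> bool"
  assumes S: "compact S"
    and loc: "\<And>x. x \<in> S \<Longrightarrow> \<exists>e>0. \<exists>K. \<forall>y\<in>S \<inter> ball x e. P y K"
    and mono: "\<And>y K K'. P y K \<Longrightarrow> K \<le> K' \<Longrightarrow> P y K'"
  shows "\<exists>K. \<forall>y\<in>S. P y K"
proof -
  obtain e K where e: "\<And>x. x \<in> S \<Longrightarrow> e x > 0"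
    and K: "\<And>x y. x \<in> S \<Longrightarrow> y \<in> S \<inter> ball x (e x) \<Longrightarrow> P y (K x)"
    using loc by metis
  have "S \<subseteq> (\<Union>x\<in>S. ball x (e x))"
    using e by force
  with S obtain T where T: "T \<subseteq> S" "finite T" "S \<subseteq> (\<Union>x\<in>T. ball x (e x))"
    by (meson compactE_image open_ball)
  have "P y (\<Sum>x\<in>T. \<bar>K x\<bar>)" if "y \<in> S" for y
  proof -
    obtain x where x: "x \<in> T" "y \<in> ball x (e x)" using T(3) \<open>y \<in> S\<close> by blast
    have "K x \<le> \<bar>K x\<bar>" by simp
    also have "\<dots> \<le> (\<Sum>x\<in>T. \<bar>K x\<bar>)"
      using T x by (intro member_le_sum) auto
    finally show ?thesis
      using mono K[of x y] x T that by blast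
  qed
  then show ?thesis by blast
qed

lemma shifted_gram_mem:
  assumes "spectral_matrix_algebra \<A> N" and "gram \<Psi> \<in> \<A>"
  shows "shifted_matrix \<Psi> \<alpha> \<beta> (\<lambda>x. x) \<in> \<A>"
proof -
  interpret spectral_matrix_algebra \<A> N by fact
  have "shifted_matrix \<Psi> \<alpha> \<beta> (\<lambda>x. x) = \<alpha> *\<^sub>C mat_one + \<beta> *\<^sub>C gram \<Psi>"
    by (simp add: fun_eq_iff shifted_matrix_def gram_eq_op_matrix scaleC_fun_def scaleC_complex_def)
  then show ?thesis
    using assms(2) by (simp add: add_mem scale_mem one_mem)
qed

text \<open>Inverse-closedness puts every resolvent matrix on the circle into the algebra, and so makes it
  bounded on weighted \<open>\<ell>\<^sup>1\<close>, though with a bound depending on \<open>z\<close>. Near \<open>z\<^sub>0\<close> the column \<open>v\<close> of the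
  matrix at \<open>z\<close> satisfies \<open>v = R (\<delta>\<^sub>j + (z - z\<^sub>0) K v)\<close> where \<open>R\<close> is the matrix at \<open>z\<^sub>0\<close> and \<open>K = 1 - s G\<close>; since \<open>\<parallel>v\<parallel>\<close> is
  known to be finite, the last term can be absorbed, which makes the bound locally uniform.\<close>

lemma pencil_inverse_columns_bounded:
  fixes \<Psi> :: "'i::countable \<Rightarrow> 'h::complex_hilbert"
  assumes fr: "frame \<Psi> A B" and alg: "spectral_matrix_algebra \<A> N" and G: "gram \<Psi> \<in> \<A>"
    and w: "admissible_weight \<A> w" and \<rho>: "1 < \<rho>" "\<rho> * frame.rate A B < 1"
  shows "\<exists>M. \<forall>z. cmod z = \<rho> \<longrightarrow> (\<forall>j. l1_norm w (\<lambda>i. frame.pencil_inverse \<Psi> A B z i j) \<le> M * w j)"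
    and "cmod z = \<rho> \<Longrightarrow> weighted_l1 w (\<lambda>i. frame.pencil_inverse \<Psi> A B z i j)"
proof -
  interpret frame \<Psi> A B by fact
  interpret spectral_matrix_algebra \<A> N by fact
  have pos: "\<forall>i. 0 < w i"
    using w by (simp add: admissible_weight_def)
  define K where "K = shifted_matrix \<Psi> 1 (- complex_of_real step) (\<lambda>x. x)"
  have "K \<in> \<A>"
    unfolding K_def by (rule shifted_gram_mem[OF alg G])
  then obtain k where k: "k \<ge> 0"
    and Kk: "\<And>c. weighted_l1 w c \<Longrightarrow> weighted_l1 w (mat_vec K c) \<and> l1_norm w (mat_vec K c) \<le> k * l1_norm w c"
    using admissible_weight_bound[OF w] by blast
  have circle: "cmod z * rate < 1" "z \<noteq> 1" if "cmod z = \<rho>" for z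
    using that \<rho> by auto
  have mem: "pencil_inverse z \<in> \<A>" if "cmod z = \<rho>" for z
    by (rule inverse_closed[OF _ is_l2_inverse_pencil[OF circle[OF that]]])
      (simp add: pencil_def shifted_gram_mem[OF alg G])
  have col: "weighted_l1 w (\<lambda>i. pencil_inverse z i j)" if "cmod z = \<rho>" for z j
  proof -
    have "weighted_l1 w (mat_vec (pencil_inverse z) c)" if "weighted_l1 w c" for c
      using admissible_weight_bound[OF w mem[OF \<open>cmod z = \<rho>\<close>]] that by blast
    from this[OF unit_weighted_l1(1)[of w j]] show ?thesis
      by (simp add: mat_vec_unit)
  qed
  then show "cmod z = \<rho> \<Longrightarrow> weighted_l1 w (\<lambda>i. frame.pencil_inverse \<Psi> A B z i j)" .
  have "\<exists>M. \<forall>z\<in>sphere 0 \<rho>. \<forall>j. l1_norm w (\<lambda>i. pencil_inverse z i j) \<le> M * w j"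
  proof (rule compact_uniform_bound)
    show "compact (sphere (0::complex) \<rho>)" by simp
    show "\<forall>j. l1_norm w (\<lambda>i. pencil_inverse z i j) \<le> M' * w j"
      if "\<forall>j. l1_norm w (\<lambda>i. pencil_inverse z i j) \<le> M * w j" "M \<le> M'" for z M M'
      using that mult_right_mono[of M M' "w _"] pos by (meson less_imp_le order.trans)
    fix z0 :: complex assume "z0 \<in> sphere 0 \<rho>"
    then have z0: "cmod z0 = \<rho>" by simp
    obtain r where r: "r \<ge> 0" and R: "\<And>c. weighted_l1 w c \<Longrightarrow>
        weighted_l1 w (mat_vec (pencil_inverse z0) c) \<and>
        l1_norm w (mat_vec (pencil_inverse z0) c) \<le> r * l1_norm w c"
      using admissible_weight_bound[OF w mem[OF z0]] by blast
    \<comment> \<open>Chosen for \<open>e (r k) \<le> 1/2\<close>, so that half of the norm of \<open>v\<close> remains after absorption.\<close>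
    define e where "e = 1 / (2 * (r * k + 1))"
    have rk: "0 \<le> r * k" using r k by simp
    have e: "e > 0" using rk by (simp add: e_def)
    have "l1_norm w (\<lambda>i. pencil_inverse z i j) \<le> 2 * r * w j"
      if z: "z \<in> sphere 0 \<rho> \<inter> ball z0 e" for z j
    proof -
      have nz: "cmod z = \<rho>" using z by simp
      define v where "v = mat_vec (pencil_inverse z) (\<lambda>k. mat_one k j)"
      have v_col: "v = (\<lambda>i. pencil_inverse z i j)"
        by (simp add: v_def mat_vec_unit)
      have v2: "square_summable v"
        unfolding v_def pencil_inverse_def
        by (rule square_summable_mat_vec_shifted[OF bessel neumann_bounded_clinear[OF circle(1)[OF nz]]
              unit_square_summable])
      have v1: "weighted_l1 w v"
        unfolding v_col by (rule col[OF nz])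
      define u where "u = (\<lambda>i. mat_one i j + (z - z0) * mat_vec K v i)"
      have "mat_vec (pencil z) v = (\<lambda>i. mat_one i j)"
        unfolding v_def by (rule pencil_mult_inverse[OF circle[OF nz] unit_square_summable])
      moreover have "mat_vec (pencil z0) v i = mat_vec (pencil z) v i + (z - z0) * mat_vec K v i" for i
        unfolding pencil_def K_def mat_vec_shifted[OF bessel bounded_clinear_id v2]
        by (simp add: algebra_simps)
      ultimately have "mat_vec (pencil z0) v = u"
        by (simp add: u_def fun_eq_iff)
      then have v_eq: "v = mat_vec (pencil_inverse z0) u"
        using pencil_inverse_mult[OF circle[OF z0] v2] by simp
      note zK = weighted_l1_scale[OF conjunct1[OF Kk[OF v1]], of "z - z0"]
      note u = weighted_l1_add[OF pos unit_weighted_l1(1)[of w j] zK(1), folded u_def]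
      have "l1_norm w v \<le> r * l1_norm w u"
        unfolding v_eq using R[OF u(1)] by simp
      also have "\<dots> \<le> r * (w j + cmod (z - z0) * (k * l1_norm w v))"
        using u(2) Kk[OF v1] unfolding zK(2) unit_weighted_l1(2)
        by (intro mult_left_mono r) (meson add_left_mono mult_left_mono norm_ge_zero order.trans)
      also have "\<dots> = r * w j + cmod (z - z0) * (r * k) * l1_norm w v"
        by (simp add: algebra_simps)
      also have "\<dots> \<le> r * w j + 1 / 2 * l1_norm w v"
      proof -
        have "cmod (z - z0) * (r * k) \<le> e * (r * k)"
          using z rk by (intro mult_right_mono) (auto simp: dist_norm norm_minus_commute)
        also have "\<dots> \<le> 1 / 2"
          using rk by (simp add: e_def field_simps)
        finally show ?thesis
          by (intro add_left_mono mult_right_mono l1_norm_nonneg[OF pos])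
      qed
      finally show ?thesis
        by (simp add: v_col)
    qed
    with e show "\<exists>e>0. \<exists>M. \<forall>z\<in>sphere 0 \<rho> \<inter> ball z0 e. \<forall>j.
        l1_norm w (\<lambda>i. pencil_inverse z i j) \<le> M * w j"
      by blast
  qed
  then show "\<exists>M. \<forall>z. cmod z = \<rho> \<longrightarrow> (\<forall>j. l1_norm w (\<lambda>i. frame.pencil_inverse \<Psi> A B z i j) \<le> M * w j)"
    by (simp add: Ball_def)
qed

text \<open>The matrix \<open>P\<close> of the \<open>\<langle>\<psi>\<^sub>j, \<psi>\<^sub>i\<^sup>~\<rangle>\<close> is the orthogonal projection onto the range of the
  analysis operator, that is, the Riesz projection of the Gram matrix for the part \<open>[A, B]\<close> of its
  spectrum, which explains its boundedness on every space on which the resolvents are bounded. Instead of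
  integrating the resolvents one may observe that \<open>(1 - z)\<close> times the inverse pencil extends
  holomorphically over the disc of radius \<open>\<rho>\<close> and takes the value \<open>1 - P\<close> at \<open>z = 1\<close>, and then
  apply the maximum modulus principle to weighted sums over finite parts of a column.\<close>

theorem cross_gram_column_bound:
  fixes \<Psi> :: "'i::countable \<Rightarrow> 'h::complex_hilbert"
  assumes fr: "frame \<Psi> A B" and alg: "spectral_matrix_algebra \<A> N" and G: "gram \<Psi> \<in> \<A>"
    and w: "admissible_weight \<A> w"
  shows "\<exists>M>0. \<forall>j. weighted_l1 w (\<lambda>i. cross_gram \<Psi> i j) \<and> l1_norm w (\<lambda>i. cross_gram \<Psi> i j) \<le> M * w j"
proof -
  interpret frame \<Psi> A B by fact
  have pos: "\<forall>i. 0 < w i"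
    using w by (simp add: admissible_weight_def)
  \<comment> \<open>The Neumann series converges for \<open>|z| rate < 1\<close>, hence on the disc of radius \<open>R > 1\<close>; the circle of
    radius \<open>\<rho>\<close> lies inside it and has \<open>1\<close> in its interior.\<close>
  define R where "R = 2 / (1 + rate)"
  define \<rho> where "\<rho> = (1 + R) / 2"
  have R: "1 < R" "R * rate < 1"
    using rate by (auto simp: R_def field_simps)
  have \<rho>: "1 < \<rho>" "\<rho> < R" "\<rho> * rate < 1"
    using R rate by (auto simp: \<rho>_def field_simps)
  obtain M where M: "\<And>z j. cmod z = \<rho> \<Longrightarrow> l1_norm w (\<lambda>i. pencil_inverse z i j) \<le> M * w j"
    using pencil_inverse_columns_bounded(1)[OF fr alg G w \<rho>(1,3)] by blast
  note col = pencil_inverse_columns_bounded(2)[OF fr alg G w \<rho>(1,3)]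
  define f where "f i j z = mat_one i j - z * step * cinner (neumann z (\<Psi> j)) (\<Psi> i)"
    for i j and z :: complex
  have f_1: "f i j 1 = mat_one i j - cross_gram \<Psi> i j" for i j
    by (simp add: f_def cross_gram_def cinner_canonical_dual inv_frame_op_eq cinner_scaleR_left
        scaleR_conv_of_real)
  have f_pencil: "f i j z = (1 - z) * pencil_inverse z i j" if "z \<noteq> 1" for i j z
    using that by (simp add: f_def pencil_inverse_def shifted_matrix_def op_matrix_def distrib_left
        right_diff_distrib)
  have f_hol: "f i j holomorphic_on ball 0 R" for i j
    unfolding f_def using R by (intro holomorphic_intros neumann_holomorphic) auto
  have f_bound: "(\<Sum>i\<in>F. cmod (f i j 1) * w i) \<le> (1 + \<rho>) * (M * w j)" if F: "finite F" for F j
  proof -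
    \<comment> \<open>The phases turn \<open>\<phi> 1\<close> into the sum of absolute values that is to be bounded.\<close>
    define \<phi> where "\<phi> z = (\<Sum>i\<in>F. cnj (sgn (f i j 1)) * w i * f i j z)" for z
    have hol: "\<phi> holomorphic_on ball 0 R"
      unfolding \<phi>_def by (intro holomorphic_intros f_hol)
    have "cmod (\<phi> 1) \<le> (1 + \<rho>) * (M * w j)"
    proof (rule maximum_modulus_frontier[where f = \<phi> and \<xi> = 1 and S = "cball 0 \<rho>"])
      show "\<phi> holomorphic_on interior (cball 0 \<rho>)"
        using hol \<rho> by (auto elim!: holomorphic_on_subset)
      show "continuous_on (closure (cball 0 \<rho>)) \<phi>"
        using holomorphic_on_imp_continuous_on[OF hol] \<rho> by (auto elim!: continuous_on_subset)
      fix z :: complex assume "z \<in> frontier (cball 0 \<rho>)"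
      then have z: "cmod z = \<rho>" using \<rho> by simp
      then have "z \<noteq> 1" using \<rho> by auto
      have "cmod (\<phi> z) \<le> (\<Sum>i\<in>F. cmod (f i j z) * w i)"
        unfolding \<phi>_def using pos
        by (intro sum_norm_le) (auto simp: norm_mult norm_sgn less_imp_le)
      also have "\<dots> = cmod (1 - z) * (\<Sum>i\<in>F. cmod (pencil_inverse z i j) * w i)"
        using \<open>z \<noteq> 1\<close> by (simp add: f_pencil norm_mult sum_distrib_left mult.assoc)
      also have "\<dots> \<le> (1 + \<rho>) * (M * w j)"
      proof (rule mult_mono)
        show "cmod (1 - z) \<le> 1 + \<rho>"
          using norm_triangle_ineq4[of 1 z] z by simp
        have "(\<Sum>i\<in>F. cmod (pencil_inverse z i j) * w i) \<le> l1_norm w (\<lambda>i. pencil_inverse z i j)"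
          unfolding l1_norm_def using col[OF z] F pos
          by (intro finite_sum_le_infsum) (auto simp: weighted_l1_def less_imp_le)
        then show "(\<Sum>i\<in>F. cmod (pencil_inverse z i j) * w i) \<le> M * w j"
          using M[OF z, of j] by simp
      qed (use \<rho> pos in \<open>auto intro!: sum_nonneg simp: less_imp_le\<close>)
      finally show "cmod (\<phi> z) \<le> (1 + \<rho>) * (M * w j)" .
    qed (use \<rho> in auto)
    moreover have "\<phi> 1 = of_real (\<Sum>i\<in>F. cmod (f i j 1) * w i)"
    proof -
      have "cnj (sgn x) * x = cmod x" for x :: complex
      proof (cases "x = 0")
        case False
        have "cnj (sgn x) * x = (x * cnj x) / cmod x"
          by (simp add: sgn_div_norm scaleR_conv_of_real divide_inverse mult_ac)
        also have "x * cnj x = of_real (cmod x) * of_real (cmod x)"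
          by (metis complex_norm_square of_real_mult power2_eq_square)
        finally show ?thesis
          using False by simp
      qed simp
      then show ?thesis
        by (simp add: \<phi>_def mult_ac)
    qed
    ultimately have "\<bar>\<Sum>i\<in>F. cmod (f i j 1) * w i\<bar> \<le> (1 + \<rho>) * (M * w j)"
      by (metis norm_of_real)
    then show ?thesis
      by simp
  qed
  have "(\<Sum>i\<in>F. cmod (cross_gram \<Psi> i j) * w i) \<le> (1 + (1 + \<rho>) * M) * w j" if F: "finite F" for F j
  proof -
    have "cross_gram \<Psi> i j = mat_one i j - f i j 1" for i
      by (simp add: f_1)
    then have "cmod (cross_gram \<Psi> i j) \<le> cmod (mat_one i j) + cmod (f i j 1)" for i
      by (simp add: norm_triangle_ineq4)
    then have "(\<Sum>i\<in>F. cmod (cross_gram \<Psi> i j) * w i) \<le>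
        (\<Sum>i\<in>F. (cmod (mat_one i j) + cmod (f i j 1)) * w i)"
      using pos by (intro sum_mono mult_right_mono) (auto simp: less_imp_le)
    also have "\<dots> = (\<Sum>i\<in>F. cmod (mat_one i j) * w i) + (\<Sum>i\<in>F. cmod (f i j 1) * w i)"
      by (simp add: algebra_simps sum.distrib)
    also have "\<dots> \<le> l1_norm w (\<lambda>i. mat_one i j) + (1 + \<rho>) * (M * w j)"
      unfolding l1_norm_def using unit_weighted_l1(1)[of w j] F pos
      by (intro add_mono finite_sum_le_infsum f_bound) (auto simp: weighted_l1_def less_imp_le)
    finally show ?thesis
      by (simp add: unit_weighted_l1(2) algebra_simps)
  qed
  then have bound: "weighted_l1 w (\<lambda>i. cross_gram \<Psi> i j)"
    "l1_norm w (\<lambda>i. cross_gram \<Psi> i j) \<le> (1 + (1 + \<rho>) * M) * w j" for j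
    using weighted_l1I[OF pos, where c = "\<lambda>i. cross_gram \<Psi> i j" and K = "(1 + (1 + \<rho>) * M) * w j"]
    by blast+
  have "(1 + (1 + \<rho>) * M) * w j \<le> max (1 + (1 + \<rho>) * M) 1 * w j" for j
    using pos[rule_format, of j] by (intro mult_right_mono) auto
  then have "l1_norm w (\<lambda>i. cross_gram \<Psi> i j) \<le> max (1 + (1 + \<rho>) * M) 1 * w j" for j
    using bound(2)[of j] order.trans by blast
  with bound(1) show ?thesis
    by (intro exI[of _ "max (1 + (1 + \<rho>) * M) 1"]) simp
qed


section \<open>Co-orbit spaces\<close>

text \<open>Of the frame only two properties of the matrix \<open>\<langle>\<psi>\<^sub>j, \<psi>\<^sub>i\<^sup>~\<rangle>\<close> enter: it is idempotent and its columns
  are bounded in weighted \<open>\<ell>\<^sup>1\<close>. Both pass to tensor products at once, so that the spaces of all three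
  frames of the theorem are instances.\<close>

locale bounded_cross_gram =
  fixes \<Psi> :: "'i \<Rightarrow> 'h::complex_hilbert" and w :: "'i \<Rightarrow> real" and M :: real
  assumes w_all: "\<forall>i. 0 < w i"
    and M_pos: "0 < M"
    and column_l1: "weighted_l1 w (\<lambda>i. cross_gram \<Psi> i j)"
    and column_bound: "l1_norm w (\<lambda>i. cross_gram \<Psi> i j) \<le> M * w j"
    and idempotent: "((\<lambda>k. cross_gram \<Psi> i k * cross_gram \<Psi> k j) has_sum cross_gram \<Psi> i j) UNIV"
begin

lemma w_pos: "0 < w i"
  using w_all by simp

abbreviation V :: "'h set" where "V \<equiv> cspan (range \<Psi>)"

abbreviation C :: "'h \<Rightarrow> 'i \<Rightarrow> complex" where "C \<equiv> analysis_op (canonical_dual \<Psi>)"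

lemma V_subspace: "complex_vector.subspace V"
  unfolding cspan_def by (rule complex_vector.subspace_span)

lemma V_add: "x \<in> V \<Longrightarrow> y \<in> V \<Longrightarrow> x + y \<in> V"
  using V_subspace by (simp add: complex_vector.subspace_def)

lemma V_scale: "x \<in> V \<Longrightarrow> a *\<^sub>C x \<in> V"
  using V_subspace by (simp add: complex_vector.subspace_def)

lemma V_diff: "x \<in> V \<Longrightarrow> y \<in> V \<Longrightarrow> x - y \<in> V"
  by (rule complex_vector.subspace_diff[OF V_subspace])

lemma V_base: "\<Psi> i \<in> V"
  unfolding cspan_def by (rule complex_vector.span_base) simp

lemma V_induct [consumes 1, case_names zero add]:
  assumes "x \<in> V" and "P 0" and "\<And>a i y. y \<in> V \<Longrightarrow> P y \<Longrightarrow> P (a *\<^sub>C \<Psi> i + y)"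
  shows "P x"
proof -
  have "x \<in> V \<and> P x"
    using assms(1)[unfolded cspan_def]
  proof (induction rule: complex_vector.span_induct_alt)
    case base
    then show ?case using assms(2) V_subspace by (simp add: complex_vector.subspace_def)
  next
    case (step c v y)
    then show ?case using assms(3) V_add V_scale V_base by blast
  qed
  then show ?thesis ..
qed

lemma C_diff: "C (x - y) = C x - C y"
  by (simp add: fun_eq_iff analysis_op_def cinner_diff_left)

lemma C_l1: "x \<in> V \<Longrightarrow> weighted_l1 w (C x)"
proof (induction rule: V_induct)
  case zero
  then show ?case by (simp add: analysis_op_def weighted_l1_def)
next
  case (add a i y)
  show ?case
    unfolding analysis_add analysis_scale analysis_dual_column
    by (intro weighted_l1_add(1) w_all weighted_l1_scale(1) column_l1 add)
qed

lemma cross_gram_fixes_C: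
  assumes "x \<in> V"
  shows "((\<lambda>k. cross_gram \<Psi> i k * C x k) has_sum C x i) UNIV"
  using assms
proof (induction rule: V_induct)
  case zero
  then show ?case by (simp add: analysis_op_def)
next
  case (add a j y)
  have "((\<lambda>k. a * (cross_gram \<Psi> i k * cross_gram \<Psi> k j) + cross_gram \<Psi> i k * C y k) has_sum
      (a * cross_gram \<Psi> i j + C y i)) UNIV"
    by (intro has_sum_add has_sum_cmult_right idempotent add)
  then show ?case
    unfolding analysis_add analysis_scale analysis_dual_column by (simp add: algebra_simps)
qed

end

locale coorbit = bounded_cross_gram \<Psi> w M
  for \<Psi> :: "'i \<Rightarrow> 'h::complex_hilbert" and w :: "'i \<Rightarrow> real" and M :: real +
  fixes \<iota> :: "'h \<Rightarrow> 'b::complex_banach"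
  assumes completion: "is_completion (cspan (range \<Psi>)) (\<lambda>f. l1_norm w (analysis_op (canonical_dual \<Psi>) f)) \<iota>"
begin

lemma \<iota>_add: "x \<in> V \<Longrightarrow> y \<in> V \<Longrightarrow> \<iota> (x + y) = \<iota> x + \<iota> y"
  using completion by (simp add: is_completion_def clinear_on_def)

lemma \<iota>_scale: "x \<in> V \<Longrightarrow> \<iota> (a *\<^sub>C x) = a *\<^sub>C \<iota> x"
  using completion by (simp add: is_completion_def clinear_on_def)

lemma \<iota>_diff: "x \<in> V \<Longrightarrow> y \<in> V \<Longrightarrow> \<iota> (x - y) = \<iota> x - \<iota> y"
  using \<iota>_add[of "x - y" y] V_diff by simp

lemma norm_\<iota>: "x \<in> V \<Longrightarrow> norm (\<iota> x) = l1_norm w (C x)"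
  using completion by (simp add: is_completion_def)

lemma norm_\<iota>_base: "norm (\<iota> (\<Psi> i)) \<le> M * w i"
  using norm_\<iota>[OF V_base, of i] column_bound[of i] by (simp add: analysis_dual_column)

lemma approximating_sequence:
  obtains x where "range x \<subseteq> V" and "(\<lambda>n. \<iota> (x n)) \<longlonglongrightarrow> f"
proof -
  have "f \<in> closure (\<iota> ` V)"
    using completion by (simp add: is_completion_def)
  then obtain y where y: "\<And>n. y n \<in> \<iota> ` V" "y \<longlonglongrightarrow> f"
    unfolding closure_sequential by blast
  then have "\<forall>n. \<exists>x. x \<in> V \<and> y n = \<iota> x"
    by blast
  then obtain x where x: "\<And>n. x n \<in> V" "\<And>n. y n = \<iota> (x n)"
    by metis
  have "y = (\<lambda>n. \<iota> (x n))" using x(2) by auto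
  then show ?thesis
    using that[of x] x(1) y(2) by auto
qed

text \<open>The analysis operator \<open>E\<close> and, further below, the synthesis operator \<open>J\<close> of the co-orbit space:
  \<open>J E\<close> is the identity and \<open>E J\<close> is multiplication by the cross Gram matrix, so that \<open>E\<close> identifies the
  co-orbit space with a complemented subspace of weighted \<open>\<ell>\<^sup>1\<close>.\<close>

definition E :: "'b \<Rightarrow> 'i \<Rightarrow> complex"
  where "E = extend_by_continuity V \<iota> (Collect (weighted_l1 w)) (l1_norm w) C"

lemma extension_unique:
  assumes "range x \<subseteq> V" and "weighted_l1 w c" and "weighted_l1 w c'"
    and "(\<lambda>n. l1_norm w (C (x n) - c)) \<longlonglongrightarrow> 0" and "(\<lambda>n. l1_norm w (C (x n) - c')) \<longlonglongrightarrow> 0"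
  shows "c = c'"
proof -
  have "l1_norm w (c - c') \<le> l1_norm w (C (x n) - c') + l1_norm w (C (x n) - c)" for n
  proof -
    have Cx: "weighted_l1 w (C (x n))" using assms(1) C_l1 by blast
    have "c - c' = (C (x n) - c') - (C (x n) - c)" by simp
    then show ?thesis
      using weighted_l1_diff(2)[OF w_all weighted_l1_diff(1)[OF w_all Cx assms(3)]
          weighted_l1_diff(1)[OF w_all Cx assms(2)]] by simp
  qed
  moreover have "(\<lambda>n. l1_norm w (C (x n) - c') + l1_norm w (C (x n) - c)) \<longlonglongrightarrow> 0"
    using tendsto_add[OF assms(5,4)] by simp
  ultimately have "l1_norm w (c - c') \<le> 0"
    by (intro tendsto_lowerbound[where F = sequentially]) auto
  then have "(c - c') i = 0" for i
    by (rule l1_norm_eq_0[OF w_all weighted_l1_diff(1)[OF w_all assms(2,3)]])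
  then show ?thesis by (simp add: fun_eq_iff)
qed

text \<open>The norm on \<open>V\<close> makes \<open>C\<close> isometric, so that it maps sequences converging in the completion to
  Cauchy sequences. An estimate between two sequences with the same limit makes the limit of the
  coefficients independent of the sequence.\<close>

lemma extension_exists:
  "\<exists>c. weighted_l1 w c \<and>
    (\<forall>x. range x \<subseteq> V \<longrightarrow> (\<lambda>n. \<iota> (x n)) \<longlonglongrightarrow> f \<longrightarrow> (\<lambda>n. l1_norm w (C (x n) - c)) \<longlonglongrightarrow> 0)"
proof -
  obtain x where x: "range x \<subseteq> V" "(\<lambda>n. \<iota> (x n)) \<longlonglongrightarrow> f"
    by (rule approximating_sequence)
  have norm_diff: "l1_norm w (C u - C v) = norm (\<iota> u - \<iota> v)" if "u \<in> V" "v \<in> V" for u v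
    using that norm_\<iota>[OF V_diff] by (simp add: C_diff \<iota>_diff)
  have xV: "x n \<in> V" for n using x(1) by auto
  have "\<exists>c. weighted_l1 w c \<and> (\<lambda>n. l1_norm w (C (x n) - c)) \<longlonglongrightarrow> 0"
  proof (rule weighted_l1_complete[OF w_all])
    show "weighted_l1 w (C (x n))" for n
      by (rule C_l1[OF xV])
    fix e :: real assume "e > 0"
    then show "\<exists>k. \<forall>m\<ge>k. \<forall>n\<ge>k. l1_norm w (C (x m) - C (x n)) < e"
      using CauchyD[OF LIMSEQ_imp_Cauchy[OF x(2)]] by (simp add: norm_diff xV)
  qed
  then obtain c where c: "weighted_l1 w c" "(\<lambda>n. l1_norm w (C (x n) - c)) \<longlonglongrightarrow> 0"
    by blast
  have "(\<lambda>n. l1_norm w (C (y n) - c)) \<longlonglongrightarrow> 0"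
    if y: "range y \<subseteq> V" "(\<lambda>n. \<iota> (y n)) \<longlonglongrightarrow> f" for y
  proof (rule tendsto_sandwich[OF _ _ tendsto_const])
    have yV: "y n \<in> V" for n using y(1) by auto
    have "l1_norm w (C (y n) - c) \<le> norm (\<iota> (y n) - \<iota> (x n)) + l1_norm w (C (x n) - c)" for n
    proof -
      have "C (y n) - c = (C (y n) - C (x n)) - (c - C (x n))" by simp
      then show ?thesis
        using weighted_l1_diff(2)[OF w_all weighted_l1_diff(1)[OF w_all C_l1[OF yV] C_l1[OF xV]]
            weighted_l1_diff(1)[OF w_all c(1) C_l1[OF xV]], of n n n]
          l1_norm_minus_commute[of w c "C (x n)"]
        by (simp add: norm_diff[OF yV xV])
    qed
    then show "\<forall>\<^sub>F n in sequentially. l1_norm w (C (y n) - c) \<le>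
        norm (\<iota> (y n) - \<iota> (x n)) + l1_norm w (C (x n) - c)"
      by simp
    show "(\<lambda>n. norm (\<iota> (y n) - \<iota> (x n)) + l1_norm w (C (x n) - c)) \<longlonglongrightarrow> 0"
      using tendsto_add[OF tendsto_norm_zero[OF tendsto_diff[OF y(2) x(2), simplified]] c(2)] by simp
    show "\<forall>\<^sub>F n in sequentially. 0 \<le> l1_norm w (C (y n) - c)"
      by (simp add: l1_norm_nonneg[OF w_all])
  qed
  with c(1) show ?thesis by blast
qed

lemma E_characterisation:
  "E f \<in> Collect (weighted_l1 w) \<and>
    (\<forall>x. range x \<subseteq> V \<longrightarrow> (\<lambda>n. \<iota> (x n)) \<longlonglongrightarrow> f \<longrightarrow> (\<lambda>n. l1_norm w (C (x n) - E f)) \<longlonglongrightarrow> 0)"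
proof -
  let ?P = "\<lambda>c. c \<in> Collect (weighted_l1 w) \<and> (\<forall>x. range x \<subseteq> V \<longrightarrow> (\<lambda>n. \<iota> (x n)) \<longlonglongrightarrow> f \<longrightarrow>
      (\<lambda>n. l1_norm w (C (x n) - c)) \<longlonglongrightarrow> 0)"
  obtain x where x: "range x \<subseteq> V" "(\<lambda>n. \<iota> (x n)) \<longlonglongrightarrow> f"
    by (rule approximating_sequence)
  have "\<exists>!c. ?P c"
  proof (rule ex_ex1I)
    show "\<exists>c. ?P c"
      using extension_exists[of f] by simp
    fix c c' assume "?P c" and "?P c'"
    then show "c = c'"
      using extension_unique[OF x(1), of c c'] x by simp
  qed
  then have "?P (THE c. ?P c)"
    by (rule theI')
  moreover have "E f = (THE c. ?P c)"
    by (simp only: E_def extend_by_continuity_def)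
  ultimately show ?thesis
    by (rule ssubst[rotated])
qed

lemma E_l1: "weighted_l1 w (E f)"
  using E_characterisation[of f] by simp

lemma E_tendsto:
  "range x \<subseteq> V \<Longrightarrow> (\<lambda>n. \<iota> (x n)) \<longlonglongrightarrow> f \<Longrightarrow> (\<lambda>n. l1_norm w (C (x n) - E f)) \<longlonglongrightarrow> 0"
  using E_characterisation[of f] by simp

lemma E_coordinate_tendsto:
  assumes x: "range x \<subseteq> V" "(\<lambda>n. \<iota> (x n)) \<longlonglongrightarrow> f"
  shows "(\<lambda>n. C (x n) i) \<longlonglongrightarrow> E f i"
proof -
  have lim: "(\<lambda>n. l1_norm w (C (x n) - E f) / w i) \<longlonglongrightarrow> 0"
    using tendsto_divide[OF E_tendsto[OF x] tendsto_const, of "w i"] w_pos[of i] by simp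
  have "norm (C (x n) i - E f i) \<le> l1_norm w (C (x n) - E f) / w i" for n
  proof -
    have "weighted_l1 w (C (x n) - E f)"
      by (intro weighted_l1_diff(1) w_all C_l1 E_l1) (use x in auto)
    from coordinate_le_l1_norm[OF w_all this, of i] show ?thesis
      using w_pos[of i] by (simp add: field_simps)
  qed
  then have "(\<lambda>n. C (x n) i - E f i) \<longlonglongrightarrow> 0"
    by (intro Lim_null_comparison[OF always_eventually lim] allI)
  then show ?thesis by (simp add: LIM_zero_iff)
qed

lemma E_\<iota>: "x \<in> V \<Longrightarrow> E (\<iota> x) = C x"
proof (rule ext)
  fix i assume "x \<in> V"
  then have "(\<lambda>n::nat. C x i) \<longlonglongrightarrow> E (\<iota> x) i"
    using E_coordinate_tendsto[of "\<lambda>_. x" "\<iota> x" i] by simp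
  then show "E (\<iota> x) i = C x i"
    by (simp add: LIMSEQ_const_iff)
qed

lemma E_norm: "l1_norm w (E f) = norm f"
proof -
  obtain x where x: "range x \<subseteq> V" "(\<lambda>n. \<iota> (x n)) \<longlonglongrightarrow> f"
    by (rule approximating_sequence)
  have "\<bar>l1_norm w (C (x n)) - l1_norm w (E f)\<bar> \<le> l1_norm w (C (x n) - E f)" for n
  proof -
    have Cx: "weighted_l1 w (C (x n))" using x C_l1 by blast
    note d = weighted_l1_diff(1)[OF w_all Cx E_l1[of f]]
    have "l1_norm w (C (x n)) \<le> l1_norm w (C (x n) - E f) + l1_norm w (E f)"
      using weighted_l1_add(2)[OF w_all d E_l1[of f]] by simp
    moreover have "l1_norm w (E f) \<le> l1_norm w (C (x n)) + l1_norm w (C (x n) - E f)"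
      using weighted_l1_diff(2)[OF w_all Cx d] by simp
    ultimately show ?thesis by arith
  qed
  then have "(\<lambda>n. l1_norm w (C (x n)) - l1_norm w (E f)) \<longlonglongrightarrow> 0"
    by (intro Lim_null_comparison[OF always_eventually E_tendsto[OF x]] allI) simp
  then have "(\<lambda>n. norm (\<iota> (x n))) \<longlonglongrightarrow> l1_norm w (E f)"
    using x by (simp add: LIM_zero_iff norm_\<iota> range_subsetD)
  moreover have "(\<lambda>n. norm (\<iota> (x n))) \<longlonglongrightarrow> norm f"
    by (rule tendsto_norm[OF x(2)])
  ultimately show ?thesis by (rule LIMSEQ_unique)
qed

lemma E_add: "E (f + g) i = E f i + E g i"
proof -
  obtain x where x: "range x \<subseteq> V" "(\<lambda>n. \<iota> (x n)) \<longlonglongrightarrow> f"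
    by (rule approximating_sequence)
  obtain y where y: "range y \<subseteq> V" "(\<lambda>n. \<iota> (y n)) \<longlonglongrightarrow> g"
    by (rule approximating_sequence)
  have xy: "x n \<in> V" "y n \<in> V" for n using x y by auto
  have "(\<lambda>n. \<iota> (x n + y n)) \<longlonglongrightarrow> f + g"
    using tendsto_add[OF x(2) y(2)] by (simp add: \<iota>_add xy)
  then have "(\<lambda>n. C (x n + y n) i) \<longlonglongrightarrow> E (f + g) i"
    by (intro E_coordinate_tendsto) (use xy V_add in auto)
  moreover have "(\<lambda>n. C (x n + y n) i) \<longlonglongrightarrow> E f i + E g i"
    unfolding analysis_add by (intro tendsto_add E_coordinate_tendsto x y)
  ultimately show ?thesis by (rule LIMSEQ_unique)
qed

lemma E_scale: "E (a *\<^sub>C f) i = a * E f i"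
proof -
  obtain x where x: "range x \<subseteq> V" "(\<lambda>n. \<iota> (x n)) \<longlonglongrightarrow> f"
    by (rule approximating_sequence)
  have xV: "x n \<in> V" for n using x by auto
  have "(\<lambda>n. \<iota> (a *\<^sub>C x n)) \<longlonglongrightarrow> a *\<^sub>C f"
    using bounded_linear.tendsto[OF bounded_linear_scaleC x(2), of a] by (simp add: \<iota>_scale xV)
  then have "(\<lambda>n. C (a *\<^sub>C x n) i) \<longlonglongrightarrow> E (a *\<^sub>C f) i"
    by (intro E_coordinate_tendsto) (use xV V_scale in auto)
  moreover have "(\<lambda>n. C (a *\<^sub>C x n) i) \<longlonglongrightarrow> a * E f i"
    unfolding analysis_scale by (intro tendsto_intros E_coordinate_tendsto x)
  ultimately show ?thesis by (rule LIMSEQ_unique)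
qed

lemma E_coordinate_le: "cmod (E f i) \<le> norm f / w i"
  using coordinate_le_l1_norm[OF w_all E_l1, of f i] w_pos[of i] by (simp add: E_norm field_simps)

lemma E_coordinate_bounded_linear: "bounded_linear (\<lambda>f. E f i)"
proof (rule bounded_linear_intro)
  show "E (f + g) i = E f i + E g i" for f g
    by (rule E_add)
  show "E (r *\<^sub>R f) i = r *\<^sub>R E f i" for r f
    by (simp add: E_scale scaleR_conv_of_real flip: scaleC_of_real)
  show "norm (E f i) \<le> norm f * (1 / w i)" for f
    using E_coordinate_le[of f i] by simp
qed

lemma E_minus: "E (f - g) i = E f i - E g i"
  using E_add[of "f - g" g i] by simp

lemma E_inj: "(\<And>i. E f i = E g i) \<Longrightarrow> f = g"
  using E_norm[of "f - g"] by (simp add: E_minus l1_norm_def)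

definition J :: "('i \<Rightarrow> complex) \<Rightarrow> 'b"
  where "J c = (\<Sum>\<^sub>\<infinity>i. c i *\<^sub>C \<iota> (\<Psi> i))"

lemma J_abs_summable:
  assumes "weighted_l1 w c"
  shows "(\<lambda>i. norm (c i *\<^sub>C \<iota> (\<Psi> i))) summable_on UNIV"
proof (rule summable_on_comparison_test)
  show "(\<lambda>i. M * (cmod (c i) * w i)) summable_on UNIV"
    using assms unfolding weighted_l1_def by (rule summable_on_cmult_right)
  show "norm (c i *\<^sub>C \<iota> (\<Psi> i)) \<le> M * (cmod (c i) * w i)" for i
    using mult_left_mono[OF norm_\<iota>_base[of i], of "cmod (c i)"] by (simp add: norm_scaleC mult_ac)
qed simp

lemma J_has_sum:
  assumes "weighted_l1 w c"
  shows "((\<lambda>i. c i *\<^sub>C \<iota> (\<Psi> i)) has_sum J c) UNIV"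
  unfolding J_def using abs_summable_summable[OF J_abs_summable[OF assms]] by simp

lemma norm_J:
  assumes "weighted_l1 w c"
  shows "norm (J c) \<le> M * l1_norm w c"
proof -
  have "norm (J c) \<le> (\<Sum>\<^sub>\<infinity>i. norm (c i *\<^sub>C \<iota> (\<Psi> i)))"
    unfolding J_def by (rule norm_infsum_bound[OF J_abs_summable[OF assms]])
  also have "\<dots> \<le> (\<Sum>\<^sub>\<infinity>i. M * (cmod (c i) * w i))"
  proof (rule infsum_mono[OF J_abs_summable[OF assms]])
    show "(\<lambda>i. M * (cmod (c i) * w i)) summable_on UNIV"
      using assms unfolding weighted_l1_def by (rule summable_on_cmult_right)
    show "norm (c i *\<^sub>C \<iota> (\<Psi> i)) \<le> M * (cmod (c i) * w i)" for i
      using mult_left_mono[OF norm_\<iota>_base[of i], of "cmod (c i)"] by (simp add: norm_scaleC mult_ac)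
  qed
  also have "\<dots> = M * l1_norm w c"
    using assms unfolding weighted_l1_def l1_norm_def by (rule infsum_cmult_right)
  finally show ?thesis .
qed

lemma J_add:
  assumes "weighted_l1 w c" and "weighted_l1 w d"
  shows "J (\<lambda>i. c i + d i) = J c + J d"
  unfolding J_def scaleC_add_left
  by (rule infsum_add[OF abs_summable_summable[OF J_abs_summable[OF assms(1)]]
        abs_summable_summable[OF J_abs_summable[OF assms(2)]]])

lemma J_scale:
  assumes "weighted_l1 w c"
  shows "J (\<lambda>i. a * c i) = a *\<^sub>C J c"
  using has_sum_bounded_linear[OF bounded_linear_scaleC J_has_sum[OF assms], of a]
  unfolding J_def by (simp add: scaleC_scaleC infsumI)

lemma E_J:
  assumes "weighted_l1 w c"
  shows "((\<lambda>k. cross_gram \<Psi> i k * c k) has_sum E (J c) i) UNIV"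
  using has_sum_bounded_linear[OF E_coordinate_bounded_linear J_has_sum[OF assms], of i]
  by (simp add: E_scale E_\<iota>[OF V_base] analysis_dual_column mult.commute)

text \<open>The reconstruction formula \<open>f = \<Sum>\<^sub>i \<langle>f, \<psi>\<^sub>i\<^sup>~\<rangle> \<psi>\<^sub>i\<close> persists in the co-orbit space, with
  absolute convergence.\<close>

lemma J_E: "J (E f) = f"
proof -
  have on_V: "J (E (\<iota> x)) - \<iota> x = 0" if "x \<in> V" for x
  proof -
    have "E (J (C x)) i = E (\<iota> x) i" for i
      using E_J[OF C_l1[OF that], of i] cross_gram_fixes_C[OF that, of i] has_sum_unique
      by (simp add: E_\<iota>[OF that]) blast
    then have "J (C x) = \<iota> x" by (rule E_inj)
    then show ?thesis by (simp add: E_\<iota>[OF that])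
  qed
  have lin: "bounded_linear (\<lambda>f. J (E f))"
  proof (rule bounded_linear_intro)
    have E_plus: "E (f + g) = (\<lambda>i. E f i + E g i)" for f g
      by (rule ext) (rule E_add)
    show "J (E (f + g)) = J (E f) + J (E g)" for f g
      unfolding E_plus by (rule J_add[OF E_l1 E_l1])
    have E_times: "E (r *\<^sub>R f) = (\<lambda>i. of_real r * E f i)" for r f
      by (rule ext) (simp add: E_scale flip: scaleC_of_real)
    show "J (E (r *\<^sub>R f)) = r *\<^sub>R J (E f)" for r f
      unfolding E_times J_scale[OF E_l1] by (rule scaleC_of_real)
    show "norm (J (E f)) \<le> norm f * M" for f
      using norm_J[OF E_l1[of f]] by (simp add: E_norm mult.commute)
  qed
  have "J (E f) - f = 0" if "f \<in> closure (\<iota> ` V)" for f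
  proof (rule continuous_constant_on_closure[OF _ _ that])
    show "continuous_on (closure (\<iota> ` V)) (\<lambda>f. J (E f) - f)"
      by (intro continuous_on_diff linear_continuous_on[OF lin] continuous_on_id)
  qed (use on_V in auto)
  moreover have "f \<in> closure (\<iota> ` V)"
    using completion by (simp add: is_completion_def)
  ultimately show ?thesis by simp
qed

lemma cross_gram_fixes_E: "((\<lambda>k. cross_gram \<Psi> i k * E f k) has_sum E f i) UNIV"
  using E_J[OF E_l1[of f], of i] by (simp add: J_E)

lemma expansion: "((\<lambda>i. E f i *\<^sub>C \<iota> (\<Psi> i)) has_sum f) UNIV"
  using J_has_sum[OF E_l1[of f]] by (simp add: J_E)

end


section \<open>Tensor products of Bessel families and of frames\<close>

text \<open>The map \<open>t x y = \<tau> (rank_one x y)\<close>, detached from rank-one operators and their span. It is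
  conjugate-linear in \<open>x\<close>, as \<open>x\<close> is the second argument of the inner product in
  \<open>rank_one x y\<close>.\<close>

locale hilbert_tensor =
  fixes t :: "'h1::complex_hilbert \<Rightarrow> 'h2::complex_hilbert \<Rightarrow> 'h::complex_hilbert"
  assumes t_add_left: "t (x + x') y = t x y + t x' y"
    and t_scale_left: "t (a *\<^sub>C x) y = cnj a *\<^sub>C t x y"
    and t_add_right: "t x (y + y') = t x y + t x y'"
    and t_scale_right: "t x (a *\<^sub>C y) = a *\<^sub>C t x y"
    and t_cinner: "cinner (t x y) (t x' y') = cnj (cinner x x') * cinner y y'"
    and t_total: "(\<And>x y. cinner d (t x y) = 0) \<Longrightarrow> d = 0"

lemma hilbert_tensor_rank_one:
  assumes "is_hilbert_tensor_product \<tau>"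
  shows "hilbert_tensor (\<lambda>f g. \<tau> (rank_one f g))"
proof -
  define V where "V = cspan {rank_one f1 f2 | (f1::'a) (f2::'b). True}"
  have lin: "clinear_on V \<tau>" and dense: "closure (\<tau> ` V) = UNIV"
    and inner: "\<And>f1 f2 g1 g2. cinner (\<tau> (rank_one f1 f2)) (\<tau> (rank_one g1 g2)) =
         cnj (cinner f1 g1) * cinner f2 g2"
    using assms unfolding is_hilbert_tensor_product_def V_def Let_def by auto
  have sub: "complex_vector.subspace V"
    unfolding V_def cspan_def by (rule complex_vector.subspace_span)
  have base: "rank_one f g \<in> V" for f g
    unfolding V_def cspan_def by (rule complex_vector.span_base) blast
  have \<tau>_add: "\<tau> (x + y) = \<tau> x + \<tau> y" if "x \<in> V" "y \<in> V" for x y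
    using lin that by (simp add: clinear_on_def)
  have \<tau>_scale: "\<tau> (a *\<^sub>C x) = a *\<^sub>C \<tau> x" if "x \<in> V" for a x
    using lin that by (simp add: clinear_on_def)
  show ?thesis
  proof
    show "\<tau> (rank_one (x + x') y) = \<tau> (rank_one x y) + \<tau> (rank_one x' y)" for x x' y
      by (simp flip: \<tau>_add[OF base base])
        (simp add: rank_one_def plus_fun_def cinner_add_right scaleC_add_left)
    show "\<tau> (rank_one (a *\<^sub>C x) y) = cnj a *\<^sub>C \<tau> (rank_one x y)" for a x y
      by (simp flip: \<tau>_scale[OF base]) (simp add: rank_one_def scaleC_fun_def cinner_scaleC_right scaleC_scaleC)
    show "\<tau> (rank_one x (y + y')) = \<tau> (rank_one x y) + \<tau> (rank_one x y')" for x y y'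
      by (simp flip: \<tau>_add[OF base base]) (simp add: rank_one_def plus_fun_def scaleC_add_right)
    show "\<tau> (rank_one x (a *\<^sub>C y)) = a *\<^sub>C \<tau> (rank_one x y)" for a x y
      by (simp flip: \<tau>_scale[OF base]) (simp add: rank_one_def scaleC_fun_def scaleC_scaleC mult.commute)
    show "cinner (\<tau> (rank_one x y)) (\<tau> (rank_one x' y')) = cnj (cinner x x') * cinner y y'" for x y x' y'
      by (rule inner)
    fix d assume d: "\<And>x y. cinner d (\<tau> (rank_one x y)) = 0"
    have "v \<in> V \<and> cinner d (\<tau> v) = 0" if "v \<in> V" for v
      using that[unfolded V_def cspan_def]
    proof (induction rule: complex_vector.span_induct_alt)
      case base
      have "\<tau> 0 = 0"
        using \<tau>_scale[of 0 0] sub by (simp add: complex_vector.subspace_def)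
      moreover have "0 \<in> V"
        using sub by (simp add: complex_vector.subspace_def)
      ultimately show ?case
        by (metis cinner_zero_right)
    next
      case (step c x y)
      then obtain f g where x: "x = rank_one f g" by blast
      have cx: "c *\<^sub>C x \<in> V"
        using complex_vector.subspace_scale[OF sub base[of f g]] by (simp only: x)
      have y: "y \<in> V" "cinner d (\<tau> y) = 0"
        using step by blast+
      have "cinner d (\<tau> (c *\<^sub>C x + y)) = 0"
        unfolding \<tau>_add[OF cx y(1)] unfolding x \<tau>_scale[OF base]
        by (simp add: cinner_add_right cinner_scaleC_right d y(2))
      then show ?case
        using complex_vector.subspace_add[OF sub cx y(1)] by blast
    qed
    then show "d = 0"
      by (intro cinner_eq_zero_of_dense[OF dense]) auto
  qed
qed

definition orthonormal :: "'h::complex_hilbert set \<Rightarrow> bool"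
  where "orthonormal U \<longleftrightarrow> (\<forall>u\<in>U. \<forall>v\<in>U. cinner u v = (if u = v then 1 else 0))"

lemma Gram_Schmidt:
  assumes "finite W"
  shows "\<exists>U. finite U \<and> orthonormal U \<and> (\<forall>v\<in>W. v = (\<Sum>u\<in>U. cinner v u *\<^sub>C u))"
  using assms
proof (induction W)
  case empty
  show ?case by (intro exI[of _ "{}"]) (simp add: orthonormal_def)
next
  case (insert x W)
  then obtain U where U: "finite U" "orthonormal U" "\<And>v. v \<in> W \<Longrightarrow> v = (\<Sum>u\<in>U. cinner v u *\<^sub>C u)"
    by blast
  define r where "r = x - (\<Sum>u\<in>U. cinner x u *\<^sub>C u)"
  have r_orth: "cinner r v = 0" if "v \<in> U" for v
  proof -
    have "(\<Sum>u\<in>U. cinner x u * cinner u v) = (\<Sum>u\<in>U. if u = v then cinner x v else 0)"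
      using U(2) that by (intro sum.cong) (auto simp: orthonormal_def)
    then show ?thesis
      using U(1) that by (simp add: r_def cinner_diff_left cinner_sum_left cinner_scaleC_left)
  qed
  show ?case
  proof (cases "r = 0")
    case True
    then show ?thesis
      using U by (intro exI[of _ U]) (auto simp: r_def)
  next
    case False
    define e where "e = (1 / norm r) *\<^sub>R r"
    have e_orth: "cinner e v = 0" "cinner v e = 0" if "v \<in> U" for v
      using r_orth[OF that] cinner_commute[of v r]
      by (simp_all add: e_def cinner_scaleR_left cinner_scaleR_right)
    have e1: "cinner e e = 1"
      using False by (simp add: e_def cinner_scaleR_left cinner_scaleR_right cinner_self
          power2_eq_square scaleR_conv_of_real)
    have eU: "e \<notin> U" using e_orth(1)[of e] e1 by auto
    have on: "orthonormal (insert e U)"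
      using U(2) e_orth e1 eU unfolding orthonormal_def by auto
    have v: "v = (\<Sum>u\<in>insert e U. cinner v u *\<^sub>C u)" if "v \<in> W" for v
    proof -
      have "cinner v e = (\<Sum>u\<in>U. cinner v u * cinner u e)"
        by (subst U(3)[OF that]) (simp add: cinner_sum_left cinner_scaleC_left)
      also have "\<dots> = 0" using e_orth by simp
      finally show ?thesis
        using U(1) U(3)[OF that] eU by simp
    qed
    have "cinner x e = cinner r e"
      using e_orth by (simp add: r_def cinner_diff_left cinner_sum_left cinner_scaleC_left)
    also have "\<dots> = norm r"
      using False by (simp add: e_def cinner_scaleR_right cinner_self power2_eq_square scaleR_conv_of_real)
    finally have "cinner x e *\<^sub>C e = r"
      using False by (simp add: e_def scaleC_of_real)
    then have "x = (\<Sum>u\<in>insert e U. cinner x u *\<^sub>C u)"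
      using U(1) eU by (simp add: r_def)
    with on v U(1) show ?thesis
      by (intro exI[of _ "insert e U"]) blast
  qed
qed

lemma orthonormal_norm_sq:
  assumes "orthonormal U" and "finite U" and "v = (\<Sum>u\<in>U. cinner v u *\<^sub>C u)"
  shows "(norm v)\<^sup>2 = (\<Sum>u\<in>U. (cmod (cinner v u))\<^sup>2)"
proof -
  have "cinner v v = (\<Sum>u\<in>U. cinner v u * cinner u v)"
    by (subst (1) assms(3)) (simp add: cinner_sum_left cinner_scaleC_left)
  also have "\<dots> = (\<Sum>u\<in>U. of_real ((cmod (cinner v u))\<^sup>2))"
    by (intro sum.cong refl) (metis cinner_commute complex_norm_square)
  finally have "complex_of_real ((norm v)\<^sup>2) = of_real (\<Sum>u\<in>U. (cmod (cinner v u))\<^sup>2)"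
    by (simp add: cinner_self)
  then show ?thesis
    by (simp only: of_real_eq_iff)
qed

lemma has_sum_times_complex:
  fixes a :: "'i \<Rightarrow> complex" and b :: "'j \<Rightarrow> complex"
  assumes a: "(a has_sum x) UNIV" and b: "(b has_sum y) UNIV"
  shows "((\<lambda>(i, j). a i * b j) has_sum x * y) UNIV"
proof -
  have sa: "(\<lambda>i. cmod (a i)) summable_on UNIV" and sb: "(\<lambda>j. cmod (b j)) summable_on UNIV"
    using a b by (auto simp flip: summable_on_iff_abs_summable_on_complex intro: has_sum_imp_summable)
  have "(\<lambda>(i, j). cmod (a i) * cmod (b j)) summable_on UNIV \<times> UNIV"
    by (rule summable_on_SigmaI[where g = "\<lambda>i. cmod (a i) * (\<Sum>\<^sub>\<infinity>j. cmod (b j))"])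
      (use sa sb in \<open>auto intro!: has_sum_cmult_right summable_on_cmult_left\<close>)
  then have "(\<lambda>p. norm (case p of (i, j) \<Rightarrow> a i * b j)) summable_on UNIV \<times> UNIV"
    by (simp add: case_prod_unfold norm_mult)
  then have "(\<lambda>(i, j). a i * b j) summable_on UNIV \<times> UNIV"
    by (rule abs_summable_summable)
  then have "((\<lambda>(i, j). a i * b j) has_sum x * y) (UNIV \<times> UNIV)"
    by (intro has_sum_SigmaI[where g = "\<lambda>i. a i * y"] has_sum_cmult_left[OF a])
      (auto intro: has_sum_cmult_right b)
  then show ?thesis by simp
qed

context hilbert_tensor
begin

lemma norm_t: "norm (t x y) = norm x * norm y"
proof -
  have "complex_of_real ((norm (t x y))\<^sup>2) = of_real ((norm x * norm y)\<^sup>2)"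
    using t_cinner[of x y x y] by (simp add: cinner_self power_mult_distrib)
  then have "(norm (t x y))\<^sup>2 = (norm x * norm y)\<^sup>2"
    by (simp only: of_real_eq_iff)
  then show ?thesis by simp
qed

lemma t_bounded_linear_left: "bounded_linear (\<lambda>x. t x y)"
  by (rule bounded_linear_intro[of _ "norm y"])
    (simp_all add: t_add_left norm_t t_scale_left flip: scaleC_of_real)

lemma t_bounded_linear_right: "bounded_linear (\<lambda>y. t x y)"
  by (rule bounded_linear_intro[of _ "norm x"])
    (simp_all add: t_add_right norm_t t_scale_right mult.commute flip: scaleC_of_real)

lemma t_sum_left: "t (\<Sum>i\<in>F. x i) y = (\<Sum>i\<in>F. t (x i) y)"
  using bounded_linear.linear[OF t_bounded_linear_left] by (rule linear_sum)

lemma t_sum_right: "t x (\<Sum>i\<in>F. y i) = (\<Sum>i\<in>F. t x (y i))"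
  using bounded_linear.linear[OF t_bounded_linear_right] by (rule linear_sum)

text \<open>Expanding the vectors \<open>v\<^sub>i\<close> in an orthonormal system turns the sum into an orthogonal one, whose
  terms are sums over the first family with scalar coefficients.\<close>

lemma vector_valued_bessel:
  assumes B: "bessel B \<Psi>" and F: "finite F"
  shows "(norm (\<Sum>i\<in>F. t (\<Psi> i) (v i)))\<^sup>2 \<le> B * (\<Sum>i\<in>F. (norm (v i))\<^sup>2)"
proof -
  obtain U where U: "finite U" "orthonormal U"
    and exp: "\<And>i. i \<in> F \<Longrightarrow> v i = (\<Sum>u\<in>U. cinner (v i) u *\<^sub>C u)"
    using Gram_Schmidt[of "v ` F"] F by auto
  define x where "x u = (\<Sum>i\<in>F. cnj (cinner (v i) u) *\<^sub>C \<Psi> i)" for u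
  have "(\<Sum>i\<in>F. t (\<Psi> i) (v i)) = (\<Sum>i\<in>F. \<Sum>u\<in>U. t (cnj (cinner (v i) u) *\<^sub>C \<Psi> i) u)"
    by (intro sum.cong refl, subst exp) (simp_all add: t_sum_right t_scale_right t_scale_left)
  also have "\<dots> = (\<Sum>u\<in>U. t (x u) u)"
    by (subst sum.swap) (simp add: x_def t_sum_left)
  finally have s: "(\<Sum>i\<in>F. t (\<Psi> i) (v i)) = (\<Sum>u\<in>U. t (x u) u)" .
  have "cinner (\<Sum>u\<in>U. t (x u) u) (\<Sum>u\<in>U. t (x u) u) = (\<Sum>u\<in>U. of_real ((norm (x u))\<^sup>2))"
  proof -
    have "(\<Sum>u'\<in>U. cinner (t (x u) u) (t (x u') u')) = of_real ((norm (x u))\<^sup>2)" if "u \<in> U" for u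
    proof -
      have "(\<Sum>u'\<in>U. cinner (t (x u) u) (t (x u') u')) =
          (\<Sum>u'\<in>U. if u = u' then complex_of_real ((norm (x u))\<^sup>2) else 0)"
        using U(2) that by (intro sum.cong) (auto simp: t_cinner orthonormal_def cinner_self)
      then show ?thesis using U(1) that by simp
    qed
    then have "(\<Sum>u\<in>U. \<Sum>u'\<in>U. cinner (t (x u) u) (t (x u') u')) = (\<Sum>u\<in>U. of_real ((norm (x u))\<^sup>2))"
      by (intro sum.cong refl)
    moreover have "cinner (\<Sum>u\<in>U. t (x u) u) (\<Sum>u\<in>U. t (x u) u) =
        (\<Sum>u\<in>U. \<Sum>u'\<in>U. cinner (t (x u) u) (t (x u') u'))"
      by (subst cinner_sum_left) (simp only: cinner_sum_right)
    ultimately show ?thesis by simp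
  qed
  then have "complex_of_real ((norm (\<Sum>u\<in>U. t (x u) u))\<^sup>2) = of_real (\<Sum>u\<in>U. (norm (x u))\<^sup>2)"
    by (simp add: cinner_self)
  then have "(norm (\<Sum>i\<in>F. t (\<Psi> i) (v i)))\<^sup>2 = (\<Sum>u\<in>U. (norm (x u))\<^sup>2)"
    by (simp only: of_real_eq_iff s)
  also have "\<dots> \<le> (\<Sum>u\<in>U. B * (\<Sum>i\<in>F. (cmod (cinner (v i) u))\<^sup>2))"
  proof (rule sum_mono)
    fix u
    have "(norm (\<Sum>i\<in>F. c i *\<^sub>C \<Psi> i))\<^sup>2 \<le> B * (\<Sum>i\<in>F. (cmod (c i))\<^sup>2)" for c
      using B F by (simp add: bessel_def)
    from this[of "\<lambda>i. cnj (cinner (v i) u)"]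
    show "(norm (x u))\<^sup>2 \<le> B * (\<Sum>i\<in>F. (cmod (cinner (v i) u))\<^sup>2)"
      by (simp add: x_def)
  qed
  also have "\<dots> = B * (\<Sum>i\<in>F. \<Sum>u\<in>U. (cmod (cinner (v i) u))\<^sup>2)"
    by (subst sum.swap) (simp add: sum_distrib_left)
  also have "\<dots> = B * (\<Sum>i\<in>F. (norm (v i))\<^sup>2)"
    using orthonormal_norm_sq[OF U(2,1) exp] by simp
  finally show ?thesis .
qed

lemma bessel_tensor:
  fixes \<Psi>1 :: "'i \<Rightarrow> 'h1" and \<Psi>2 :: "'j \<Rightarrow> 'h2"
  assumes B1: "bessel B1 \<Psi>1" and B2: "bessel B2 \<Psi>2"
  shows "bessel (B1 * B2) (\<lambda>(i, j). t (\<Psi>1 i) (\<Psi>2 j))"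
  unfolding bessel_def
proof (intro conjI allI impI)
  show "0 \<le> B1 * B2"
    using bessel_nonneg[OF B1] bessel_nonneg[OF B2] by simp
  fix F :: "('i \<times> 'j) set" and c :: "'i \<times> 'j \<Rightarrow> complex" assume F: "finite F"
  define I where "I = fst ` F"
  define J where "J = snd ` F"
  define d where "d p = (if p \<in> F then c p else 0)" for p
  have fin: "finite I" "finite J" and sub: "F \<subseteq> I \<times> J"
    using F by (auto simp: I_def J_def rev_image_eqI)
  have "(\<Sum>p\<in>F. c p *\<^sub>C (case p of (i, j) \<Rightarrow> t (\<Psi>1 i) (\<Psi>2 j))) =
      (\<Sum>p\<in>I\<times>J. d p *\<^sub>C (case p of (i, j) \<Rightarrow> t (\<Psi>1 i) (\<Psi>2 j)))"
    using fin sub by (intro sum.mono_neutral_cong_left) (auto simp: d_def)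
  also have "\<dots> = (\<Sum>i\<in>I. t (\<Psi>1 i) (\<Sum>j\<in>J. d (i, j) *\<^sub>C \<Psi>2 j))"
    by (simp add: sum.cartesian_product' t_sum_right t_scale_right)
  finally have "(norm (\<Sum>p\<in>F. c p *\<^sub>C (case p of (i, j) \<Rightarrow> t (\<Psi>1 i) (\<Psi>2 j))))\<^sup>2 \<le>
      B1 * (\<Sum>i\<in>I. (norm (\<Sum>j\<in>J. d (i, j) *\<^sub>C \<Psi>2 j))\<^sup>2)"
    using vector_valued_bessel[OF B1 fin(1)] by simp
  also have "\<dots> \<le> B1 * (\<Sum>i\<in>I. B2 * (\<Sum>j\<in>J. (cmod (d (i, j)))\<^sup>2))"
  proof (intro mult_left_mono sum_mono bessel_nonneg[OF B1])
    show "(norm (\<Sum>j\<in>J. d (i, j) *\<^sub>C \<Psi>2 j))\<^sup>2 \<le> B2 * (\<Sum>j\<in>J. (cmod (d (i, j)))\<^sup>2)" for i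
      using B2 fin(2) by (simp add: bessel_def)
  qed
  also have "\<dots> = B1 * B2 * (\<Sum>p\<in>I\<times>J. (cmod (d p))\<^sup>2)"
    by (simp add: sum.cartesian_product' sum_distrib_left mult.assoc)
  also have "(\<Sum>p\<in>I\<times>J. (cmod (d p))\<^sup>2) = (\<Sum>p\<in>F. (cmod (c p))\<^sup>2)"
    using fin sub by (intro sum.mono_neutral_cong_right) (auto simp: d_def)
  finally show "(norm (\<Sum>p\<in>F. c p *\<^sub>C (case p of (i, j) \<Rightarrow> t (\<Psi>1 i) (\<Psi>2 j))))\<^sup>2 \<le>
      B1 * B2 * (\<Sum>p\<in>F. (cmod (c p))\<^sup>2)" .
qed

end

locale frame_tensor = hilbert_tensor t + frame1: frame \<Psi>1 A1 B1 + frame2: frame \<Psi>2 A2 B2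
  for t :: "'h1::complex_hilbert \<Rightarrow> 'h2::complex_hilbert \<Rightarrow> 'h::complex_hilbert"
    and \<Psi>1 :: "'i \<Rightarrow> 'h1" and A1 B1 and \<Psi>2 :: "'j \<Rightarrow> 'h2" and A2 B2
begin

definition \<Psi>12 :: "'i \<times> 'j \<Rightarrow> 'h"
  where "\<Psi>12 = (\<lambda>(i, j). t (\<Psi>1 i) (\<Psi>2 j))"

lemma \<Psi>12_apply: "\<Psi>12 (i, j) = t (\<Psi>1 i) (\<Psi>2 j)"
  by (simp add: \<Psi>12_def)

lemma bessel_12: "bessel (B1 * B2) \<Psi>12"
  unfolding \<Psi>12_def by (rule bessel_tensor[OF frame1.bessel frame2.bessel])

text \<open>Tested against a simple tensor, the double series of the frame operator factorises into two
  absolutely convergent series of numbers.\<close>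

lemma frame_op_tensor: "frame_op \<Psi>12 (t f g) = t (frame_op \<Psi>1 f) (frame_op \<Psi>2 g)"
proof -
  have "cinner (frame_op \<Psi>12 (t f g)) (t h k) = cinner (t (frame_op \<Psi>1 f) (frame_op \<Psi>2 g)) (t h k)" for h k
  proof (rule has_sum_unique[OF frame_op_cinner[OF bessel_12]])
    have "((\<lambda>i. cnj (cinner f (\<Psi>1 i) * cinner (\<Psi>1 i) h)) has_sum cnj (cinner (frame_op \<Psi>1 f) h)) UNIV"
      by (simp only: has_sum_cnj_iff frame_op_cinner[OF frame1.bessel])
    from has_sum_times_complex[OF this frame_op_cinner[OF frame2.bessel, of g k]]
    show "((\<lambda>p. cinner (t f g) (\<Psi>12 p) * cinner (\<Psi>12 p) (t h k)) has_sum
        cinner (t (frame_op \<Psi>1 f) (frame_op \<Psi>2 g)) (t h k)) UNIV"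
      by (simp add: \<Psi>12_def case_prod_unfold t_cinner mult_ac)
  qed
  then have "frame_op \<Psi>12 (t f g) - t (frame_op \<Psi>1 f) (frame_op \<Psi>2 g) = 0"
    by (intro t_total) (simp add: cinner_diff_left)
  then show ?thesis by simp
qed

text \<open>The reconstruction formulas of the two frames turn orthogonality to the products of frame vectors
  into orthogonality to all simple tensors. Hence the frame operator of the tensor family is injective,
  and its value at a tensor of dual vectors identifies the dual of the family.\<close>

lemma \<Psi>12_total:
  assumes "\<And>p. cinner d (\<Psi>12 p) = 0"
  shows "d = 0"
proof (rule t_total)
  have col: "cinner d (t (\<Psi>1 i) g) = 0" for i g
  proof -
    have "((\<lambda>j. cinner d (t (\<Psi>1 i) (cinner g (canonical_dual \<Psi>2 j) *\<^sub>C \<Psi>2 j))) has_sum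
        cinner d (t (\<Psi>1 i) g)) UNIV"
      by (intro has_sum_bounded_linear[OF bounded_linear_cinner_right]
          has_sum_bounded_linear[OF t_bounded_linear_right] frame2.reconstruction)
    moreover have "cinner d (t (\<Psi>1 i) (\<Psi>2 j)) = 0" for j
      using assms[of "(i, j)"] by (simp add: \<Psi>12_def)
    ultimately have "((\<lambda>j::'j. 0::complex) has_sum cinner d (t (\<Psi>1 i) g)) UNIV"
      by (simp add: t_scale_right cinner_scaleC_right)
    then show ?thesis
      by (rule has_sum_unique[OF _ has_sum_0_simp])
  qed
  show "cinner d (t f g) = 0" for f g
  proof -
    have "((\<lambda>i. cinner d (t (cinner f (canonical_dual \<Psi>1 i) *\<^sub>C \<Psi>1 i) g)) has_sum cinner d (t f g)) UNIV"
      by (intro has_sum_bounded_linear[OF bounded_linear_cinner_right]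
          has_sum_bounded_linear[OF t_bounded_linear_left] frame1.reconstruction)
    then have "((\<lambda>i::'i. 0::complex) has_sum cinner d (t f g)) UNIV"
      by (simp add: t_scale_left cinner_scaleC_right col)
    then show ?thesis
      by (rule has_sum_unique[OF _ has_sum_0_simp])
  qed
qed

lemma frame_op_12_inj: "inj (frame_op \<Psi>12)"
proof (rule injI)
  fix x y assume "frame_op \<Psi>12 x = frame_op \<Psi>12 y"
  then have "frame_op \<Psi>12 (x - y) = 0"
    using bounded_linear.linear[OF bounded_clinear_bounded_linear[OF frame_op_bounded_clinear[OF bessel_12]]]
    by (simp add: linear_diff)
  then have "square_sum (analysis_op \<Psi>12 (x - y)) = 0"
    using frame_op_quadratic_form[OF bessel_12, of "x - y"] by simp
  then have "(cmod (analysis_op \<Psi>12 (x - y) p))\<^sup>2 = 0" for p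
    using bessel_analysis(1)[OF bessel_12, of "x - y"] unfolding square_sum_def square_summable_def
    by (intro nonneg_infsum_le_0D[where A = UNIV and f = "\<lambda>p. (cmod (analysis_op \<Psi>12 (x - y) p))\<^sup>2"]) auto
  then have "x - y = 0"
    by (intro \<Psi>12_total) (simp add: analysis_op_def)
  then show "x = y" by simp
qed

lemma canonical_dual_tensor:
  "canonical_dual \<Psi>12 (i, j) = t (canonical_dual \<Psi>1 i) (canonical_dual \<Psi>2 j)"
  unfolding canonical_dual_def
  by (rule inv_f_eq[OF frame_op_12_inj])
    (simp add: frame_op_tensor frame1.frame_op_inv frame2.frame_op_inv \<Psi>12_apply)

lemma cross_gram_tensor:
  "cross_gram \<Psi>12 (i, j) (k, l) = cnj (cross_gram \<Psi>1 i k) * cross_gram \<Psi>2 j l"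
  by (simp add: cross_gram_def canonical_dual_tensor t_cinner \<Psi>12_apply)

end


section \<open>Product weights\<close>

definition tensor_weight :: "('i \<Rightarrow> real) \<Rightarrow> ('j \<Rightarrow> real) \<Rightarrow> 'i \<times> 'j \<Rightarrow> real"
  where "tensor_weight w1 w2 = (\<lambda>(i, j). w1 i * w2 j)"

definition tensor_coeffs :: "('i \<Rightarrow> complex) \<Rightarrow> ('j \<Rightarrow> complex) \<Rightarrow> 'i \<times> 'j \<Rightarrow> complex"
  where "tensor_coeffs a b = (\<lambda>(i, j). cnj (a i) * b j)"

lemma tensor_weight_pos:
  assumes "\<forall>i. 0 < w1 i" and "\<forall>j. 0 < w2 j"
  shows "\<forall>p. 0 < tensor_weight w1 w2 p"
  using assms by (simp add: tensor_weight_def case_prod_unfold)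

lemma tensor_coeffs_l1:
  assumes w: "\<forall>i. 0 < w1 i" "\<forall>j. 0 < w2 j" and a: "weighted_l1 w1 a" and b: "weighted_l1 w2 b"
  shows "weighted_l1 (tensor_weight w1 w2) (tensor_coeffs a b)"
    and "l1_norm (tensor_weight w1 w2) (tensor_coeffs a b) = l1_norm w1 a * l1_norm w2 b"
proof -
  let ?f = "\<lambda>(i, j). (cmod (a i) * w1 i) * (cmod (b j) * w2 j)"
  have sum: "((\<lambda>i. cmod (a i) * w1 i) has_sum l1_norm w1 a) UNIV"
    "((\<lambda>j. cmod (b j) * w2 j) has_sum l1_norm w2 b) UNIV"
    using a b by (auto simp: weighted_l1_def l1_norm_def)
  have "?f summable_on UNIV \<times> UNIV"
    by (rule summable_on_SigmaI[where g = "\<lambda>i. (cmod (a i) * w1 i) * l1_norm w2 b"])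
      (use w a in \<open>auto intro!: has_sum_cmult_right sum summable_on_cmult_left simp: weighted_l1_def less_imp_le\<close>)
  then have "(?f has_sum l1_norm w1 a * l1_norm w2 b) (UNIV \<times> UNIV)"
    by (intro has_sum_SigmaI[where g = "\<lambda>i. (cmod (a i) * w1 i) * l1_norm w2 b"]
        has_sum_cmult_left[OF sum(1)]) (auto intro: has_sum_cmult_right sum)
  moreover have "?f = (\<lambda>p. cmod (tensor_coeffs a b p) * tensor_weight w1 w2 p)"
    by (auto simp: tensor_coeffs_def tensor_weight_def norm_mult)
  ultimately have "((\<lambda>p. cmod (tensor_coeffs a b p) * tensor_weight w1 w2 p) has_sum
      l1_norm w1 a * l1_norm w2 b) UNIV"
    by simp
  then show "weighted_l1 (tensor_weight w1 w2) (tensor_coeffs a b)"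
    "l1_norm (tensor_weight w1 w2) (tensor_coeffs a b) = l1_norm w1 a * l1_norm w2 b"
    by (auto simp: weighted_l1_def l1_norm_def has_sum_iff)
qed

text \<open>By Tonelli the iterated sums amount to summation over pairs. Outside the space the norms may differ,
  because each divergent sum counts as zero.\<close>

lemma l11w_eq:
  fixes w1 :: "'i \<Rightarrow> real" and w2 :: "'j \<Rightarrow> real"
  assumes w: "\<forall>i. 0 < w1 i" "\<forall>j. 0 < w2 j"
  shows "l11w_space w1 w2 = Collect (weighted_l1 (tensor_weight w1 w2))"
    and "weighted_l1 (tensor_weight w1 w2) c \<Longrightarrow> l11w_norm w1 w2 c = l1_norm (tensor_weight w1 w2) c"
proof -
  define f where "f c = (\<lambda>j i. cmod (c (i, j)) * (w1 i * w2 j))" for c :: "'i \<times> 'j \<Rightarrow> complex"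
  have f_nonneg: "0 \<le> f c j i" for c j i
    using w by (simp add: f_def less_imp_le)
  have swap: "f c j i = cmod (c (prod.swap (j, i))) * tensor_weight w1 w2 (prod.swap (j, i))" for c j i
    by (simp add: f_def tensor_weight_def)
  have bij: "bij_betw prod.swap (UNIV \<times> UNIV :: ('j \<times> 'i) set) (UNIV :: ('i \<times> 'j) set)"
    by simp
  have l1_iff: "weighted_l1 (tensor_weight w1 w2) c \<longleftrightarrow> (\<lambda>(j, i). f c j i) summable_on UNIV \<times> UNIV" for c
    using summable_on_reindex_bij_betw[OF bij, of "\<lambda>p. cmod (c p) * tensor_weight w1 w2 p"]
    unfolding weighted_l1_def swap by (simp add: case_prod_unfold prod.swap_def)
  have norm_eq: "l1_norm (tensor_weight w1 w2) c = infsum (\<lambda>(j, i). f c j i) (UNIV \<times> UNIV)" for c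
    using infsum_reindex_bij_betw[OF bij, of "\<lambda>p. cmod (c p) * tensor_weight w1 w2 p"]
    unfolding l1_norm_def swap by (simp add: case_prod_unfold prod.swap_def)
  show "l11w_space w1 w2 = Collect (weighted_l1 (tensor_weight w1 w2))"
  proof (intro set_eqI iffI)
    fix c assume "c \<in> l11w_space w1 w2"
    then have c: "\<And>j. f c j summable_on UNIV" "(\<lambda>j. infsum (f c j) UNIV) summable_on UNIV"
      by (auto simp: l11w_space_def f_def)
    have "(\<lambda>(j, i). f c j i) summable_on UNIV \<times> UNIV"
      by (rule summable_on_SigmaI[where g = "\<lambda>j. infsum (f c j) UNIV"]) (use c f_nonneg in auto)
    then show "c \<in> Collect (weighted_l1 (tensor_weight w1 w2))"
      by (simp add: l1_iff)
  next
    fix c assume "c \<in> Collect (weighted_l1 (tensor_weight w1 w2))"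
    then have c: "(\<lambda>(j, i). f c j i) summable_on UNIV \<times> UNIV"
      by (simp add: l1_iff)
    have "f c j summable_on UNIV" for j
      using summable_on_SigmaD1[OF c] by simp
    moreover have "(\<lambda>j. infsum (f c j) UNIV) summable_on UNIV"
      by (rule summable_on_Sigma_banach[OF c])
    ultimately show "c \<in> l11w_space w1 w2"
      by (simp add: l11w_space_def f_def)
  qed
  show "l11w_norm w1 w2 c = l1_norm (tensor_weight w1 w2) c" if "weighted_l1 (tensor_weight w1 w2) c"
    using infsum_Sigma'_banach[OF that[unfolded l1_iff]] by (simp add: norm_eq l11w_norm_def f_def)
qed

text \<open>Summation of an absolutely convergent series of sequences in weighted \<open>\<ell>\<^sup>1\<close> commutes with
  functionals \<open>h\<close> of the dual, which is weighted \<open>\<ell>\<^sup>\<infinity>\<close>.\<close>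

lemma l1_valued_series:
  fixes X :: "'r \<Rightarrow> 'k \<Rightarrow> complex"
  assumes w: "\<forall>k. 0 < w k" and X: "\<And>r. weighted_l1 w (X r)"
    and sum: "(\<lambda>r. l1_norm w (X r)) summable_on R"
  shows "weighted_l1 w (\<lambda>k. \<Sum>\<^sub>\<infinity>r\<in>R. X r k)"
    and "l1_norm w (\<lambda>k. \<Sum>\<^sub>\<infinity>r\<in>R. X r k) \<le> (\<Sum>\<^sub>\<infinity>r\<in>R. l1_norm w (X r))"
    and "(\<And>k. cmod (h k) \<le> K * w k) \<Longrightarrow>
      ((\<lambda>k. (\<Sum>\<^sub>\<infinity>r\<in>R. X r k) * h k) has_sum (\<Sum>\<^sub>\<infinity>r\<in>R. \<Sum>\<^sub>\<infinity>k. X r k * h k)) UNIV"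
proof -
  have double: "(\<lambda>(r, k). cmod (X r k) * w k) summable_on R \<times> UNIV"
  proof (rule summable_on_SigmaI[where g = "\<lambda>r. l1_norm w (X r)"])
    show "((\<lambda>k. case (r, k) of (r, k) \<Rightarrow> cmod (X r k) * w k) has_sum l1_norm w (X r)) UNIV" for r
      using X[of r] by (simp add: weighted_l1_def l1_norm_def)
  qed (use w sum in \<open>auto simp: less_imp_le\<close>)
  have double': "(\<lambda>(k, r). cmod (X r k) * w k) summable_on UNIV \<times> R"
    using double by (subst summable_on_swap) (simp add: case_prod_unfold)
  have row: "(\<lambda>r. cmod (X r k) * w k) summable_on R" for k
    using summable_on_SigmaD1[OF double'] by simp
  have row_norm: "(\<lambda>r. norm (X r k)) summable_on R" for k
    using summable_on_cmult_left[OF row[of k], of "1 / w k"] w[rule_format, of k] by simp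
  have le: "cmod (\<Sum>\<^sub>\<infinity>r\<in>R. X r k) * w k \<le> (\<Sum>\<^sub>\<infinity>r\<in>R. cmod (X r k) * w k)" for k
  proof -
    have "cmod (\<Sum>\<^sub>\<infinity>r\<in>R. X r k) * w k \<le> (\<Sum>\<^sub>\<infinity>r\<in>R. cmod (X r k)) * w k"
      using w by (intro mult_right_mono norm_infsum_bound row_norm) (simp add: less_imp_le)
    then show ?thesis
      by (simp add: infsum_cmult_left[OF row_norm])
  qed
  have col: "(\<lambda>k. \<Sum>\<^sub>\<infinity>r\<in>R. cmod (X r k) * w k) summable_on UNIV"
    by (rule summable_on_Sigma_banach[OF double'])
  show l1: "weighted_l1 w (\<lambda>k. \<Sum>\<^sub>\<infinity>r\<in>R. X r k)"
    unfolding weighted_l1_def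
    by (rule summable_on_comparison_test[OF col le]) (use w in \<open>simp add: less_imp_le\<close>)
  have "l1_norm w (\<lambda>k. \<Sum>\<^sub>\<infinity>r\<in>R. X r k) \<le> (\<Sum>\<^sub>\<infinity>k. \<Sum>\<^sub>\<infinity>r\<in>R. cmod (X r k) * w k)"
    unfolding l1_norm_def by (rule infsum_mono[OF l1[unfolded weighted_l1_def] col le])
  also have "\<dots> = (\<Sum>\<^sub>\<infinity>r\<in>R. l1_norm w (X r))"
    unfolding l1_norm_def by (rule infsum_swap_banach[OF double'])
  finally show "l1_norm w (\<lambda>k. \<Sum>\<^sub>\<infinity>r\<in>R. X r k) \<le> (\<Sum>\<^sub>\<infinity>r\<in>R. l1_norm w (X r))" .
  assume h: "\<And>k. cmod (h k) \<le> K * w k"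
  have "(\<lambda>p. norm (case p of (k, r) \<Rightarrow> X r k * h k)) summable_on UNIV \<times> R"
  proof (rule summable_on_comparison_test)
    show "(\<lambda>p. K * (case p of (k, r) \<Rightarrow> cmod (X r k) * w k)) summable_on UNIV \<times> R"
      by (rule summable_on_cmult_right[OF double'])
    show "norm (case p of (k, r) \<Rightarrow> X r k * h k) \<le> K * (case p of (k, r) \<Rightarrow> cmod (X r k) * w k)" for p
      using mult_left_mono[OF h[of "fst p"], of "cmod (X (snd p) (fst p))"]
      by (simp add: case_prod_unfold norm_mult mult_ac)
  qed simp
  then have s: "(\<lambda>(k, r). X r k * h k) summable_on UNIV \<times> R"
    by (rule abs_summable_summable)
  have factor: "(\<Sum>\<^sub>\<infinity>r\<in>R. X r k * h k) = (\<Sum>\<^sub>\<infinity>r\<in>R. X r k) * h k" for k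
    by (rule infsum_cmult_left[OF abs_summable_summable[OF row_norm]])
  have "((\<lambda>k. \<Sum>\<^sub>\<infinity>r\<in>R. X r k * h k) has_sum (\<Sum>\<^sub>\<infinity>k. \<Sum>\<^sub>\<infinity>r\<in>R. X r k * h k)) UNIV"
    using summable_on_Sigma_banach[OF s] by simp
  then show "((\<lambda>k. (\<Sum>\<^sub>\<infinity>r\<in>R. X r k) * h k) has_sum (\<Sum>\<^sub>\<infinity>r\<in>R. \<Sum>\<^sub>\<infinity>k. X r k * h k)) UNIV"
    unfolding factor infsum_swap_banach[OF s, symmetric] .
qed


section \<open>The projective tensor product of co-orbit spaces\<close>

locale coorbit_tensor =
  c1: coorbit \<Psi>1 w1 M1 \<iota>1 + c2: coorbit \<Psi>2 w2 M2 \<iota>2 + c12: coorbit \<Psi> "tensor_weight w1 w2" M \<iota>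
  for \<Psi>1 :: "'i::countable \<Rightarrow> 'h1::complex_hilbert" and w1 M1 and \<iota>1 :: "'h1 \<Rightarrow> 'b1::complex_banach"
    and \<Psi>2 :: "'j::countable \<Rightarrow> 'h2::complex_hilbert" and w2 M2 and \<iota>2 :: "'h2 \<Rightarrow> 'b2::complex_banach"
    and \<Psi> :: "'i \<times> 'j \<Rightarrow> 'h::complex_hilbert" and M and \<iota> :: "'h \<Rightarrow> 'b::complex_banach" +
  assumes cross_gram: "cross_gram \<Psi> (i, j) (k, l) = cnj (cross_gram \<Psi>1 i k) * cross_gram \<Psi>2 j l"
begin

abbreviation w where "w \<equiv> tensor_weight w1 w2"

definition coordinate_form :: "'i \<times> 'j \<Rightarrow> 'b1 \<Rightarrow> 'b2 \<Rightarrow> complex"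
  where "coordinate_form p f g = tensor_coeffs (c1.E f) (c2.E g) p"

text \<open>The coefficients of a tensor are the values of this functional at the coordinate forms, so that
  they do not depend on a representation.\<close>

definition coeffs :: "(('b1 \<Rightarrow> 'b2 \<Rightarrow> complex) \<Rightarrow> complex) \<Rightarrow> 'i \<times> 'j \<Rightarrow> complex"
  where "coeffs F p = F (coordinate_form p)"

definition T :: "(('b1 \<Rightarrow> 'b2 \<Rightarrow> complex) \<Rightarrow> complex) \<Rightarrow> 'b"
  where "T F = c12.J (coeffs F)"

lemma tensor_E:
  "weighted_l1 w (tensor_coeffs (c1.E f) (c2.E g))"
  "l1_norm w (tensor_coeffs (c1.E f) (c2.E g)) = norm f * norm g"
  using tensor_coeffs_l1[OF c1.w_all c2.w_all c1.E_l1 c2.E_l1]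
  by (simp_all add: c1.E_norm c2.E_norm)

lemma bounded_coordinate_form: "bounded_sesquilinear_form (coordinate_form p)"
proof -
  obtain i j where p: "p = (i, j)" by force
  have bound: "cmod (coordinate_form p f g) \<le> (1 / w1 i * (1 / w2 j)) * norm f * norm g" for f g
    using mult_mono[OF c1.E_coordinate_le[of f i] c2.E_coordinate_le[of g j]] c1.w_pos[of i]
    by (simp add: coordinate_form_def tensor_coeffs_def p norm_mult)
  show ?thesis
    unfolding bounded_sesquilinear_form_def
  proof (intro conjI allI)
    show "\<exists>K. \<forall>f g. cmod (coordinate_form p f g) \<le> K * norm f * norm g"
      using bound by blast
  qed (simp_all add: coordinate_form_def tensor_coeffs_def p c1.E_add c1.E_scale c2.E_add c2.E_scale
      algebra_simps)
qed

lemma sesquilinear_expansion: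
  assumes "bounded_sesquilinear_form \<beta>"
  shows "\<exists>K. \<forall>i j. cmod (\<beta> (\<iota>1 (\<Psi>1 i)) (\<iota>2 (\<Psi>2 j))) \<le> K * w (i, j)"
    and "((\<lambda>(i, j). tensor_coeffs (c1.E f) (c2.E g) (i, j) * \<beta> (\<iota>1 (\<Psi>1 i)) (\<iota>2 (\<Psi>2 j))) has_sum \<beta> f g) UNIV"
proof -
  from assms obtain K where add_left: "\<And>x x' y. \<beta> (x + x') y = \<beta> x y + \<beta> x' y"
    and scale_left: "\<And>a x y. \<beta> (a *\<^sub>C x) y = cnj a * \<beta> x y"
    and add_right: "\<And>x y y'. \<beta> x (y + y') = \<beta> x y + \<beta> x y'"
    and scale_right: "\<And>a x y. \<beta> x (a *\<^sub>C y) = a * \<beta> x y"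
    and K: "\<And>x y. cmod (\<beta> x y) \<le> K * norm x * norm y"
    unfolding bounded_sesquilinear_form_def by blast
  have K_abs: "cmod (\<beta> x y) \<le> \<bar>K\<bar> * norm x * norm y" for x y
  proof -
    have "K * (norm x * norm y) \<le> \<bar>K\<bar> * (norm x * norm y)"
      by (intro mult_right_mono) auto
    with K[of x y] show ?thesis by (simp add: mult.assoc)
  qed
  have left: "bounded_linear (\<lambda>x. \<beta> x y)" for y
    by (rule bounded_linear_intro[of _ "K * norm y"])
      (use K in \<open>auto simp: add_left scale_left scaleR_conv_of_real mult_ac simp flip: scaleC_of_real\<close>)
  have right: "bounded_linear (\<lambda>y. \<beta> x y)" for x
    by (rule bounded_linear_intro[of _ "K * norm x"])
      (use K in \<open>auto simp: add_right scale_right scaleR_conv_of_real mult_ac simp flip: scaleC_of_real\<close>)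
  define h where "h = (\<lambda>(i, j). \<beta> (\<iota>1 (\<Psi>1 i)) (\<iota>2 (\<Psi>2 j)))"
  have h: "cmod (h p) \<le> \<bar>K\<bar> * M1 * M2 * w p" for p
  proof -
    obtain i j where p: "p = (i, j)" by force
    have "cmod (h p) \<le> \<bar>K\<bar> * norm (\<iota>1 (\<Psi>1 i)) * norm (\<iota>2 (\<Psi>2 j))"
      using K_abs by (simp add: h_def p)
    also have "\<dots> \<le> \<bar>K\<bar> * (M1 * w1 i) * (M2 * w2 j)"
      using c1.M_pos c1.w_pos[of i]
      by (intro mult_mono mult_nonneg_nonneg c1.norm_\<iota>_base c2.norm_\<iota>_base) auto
    finally show ?thesis
      by (simp add: p tensor_weight_def mult_ac)
  qed
  show "\<exists>K. \<forall>i j. cmod (\<beta> (\<iota>1 (\<Psi>1 i)) (\<iota>2 (\<Psi>2 j))) \<le> K * w (i, j)"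
    using h by (auto simp: h_def)
  let ?F = "\<lambda>(i, j). tensor_coeffs (c1.E f) (c2.E g) (i, j) * h (i, j)"
  have "(\<lambda>p. norm (?F p)) summable_on UNIV \<times> UNIV"
  proof (rule summable_on_comparison_test)
    show "(\<lambda>p. (\<bar>K\<bar> * M1 * M2) * (cmod (tensor_coeffs (c1.E f) (c2.E g) p) * w p)) summable_on UNIV \<times> UNIV"
      using tensor_E(1)[of f g] unfolding weighted_l1_def by (auto intro: summable_on_cmult_right)
    show "norm (?F p) \<le> (\<bar>K\<bar> * M1 * M2) * (cmod (tensor_coeffs (c1.E f) (c2.E g) p) * w p)" for p
      using mult_left_mono[OF h[of p], of "cmod (tensor_coeffs (c1.E f) (c2.E g) p)"]
      by (simp add: case_prod_unfold norm_mult mult_ac)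
  qed simp
  then have "?F summable_on UNIV \<times> UNIV"
    by (rule abs_summable_summable)
  then have "(?F has_sum \<beta> f g) (UNIV \<times> UNIV)"
  proof (rule has_sum_SigmaI[rotated 2])
    have "((\<lambda>i. \<beta> (c1.E f i *\<^sub>C \<iota>1 (\<Psi>1 i)) g) has_sum \<beta> f g) UNIV"
      by (rule has_sum_bounded_linear[OF left c1.expansion])
    then show "((\<lambda>i. cnj (c1.E f i) * \<beta> (\<iota>1 (\<Psi>1 i)) g) has_sum \<beta> f g) UNIV"
      by (simp add: scale_left)
    show "((\<lambda>j. ?F (i, j)) has_sum cnj (c1.E f i) * \<beta> (\<iota>1 (\<Psi>1 i)) g) UNIV" for i
    proof -
      have "((\<lambda>j. \<beta> (\<iota>1 (\<Psi>1 i)) (c2.E g j *\<^sub>C \<iota>2 (\<Psi>2 j))) has_sum \<beta> (\<iota>1 (\<Psi>1 i)) g) UNIV"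
        by (rule has_sum_bounded_linear[OF right c2.expansion])
      then have "((\<lambda>j. cnj (c1.E f i) * (c2.E g j * \<beta> (\<iota>1 (\<Psi>1 i)) (\<iota>2 (\<Psi>2 j)))) has_sum
          cnj (c1.E f i) * \<beta> (\<iota>1 (\<Psi>1 i)) g) UNIV"
        by (intro has_sum_cmult_right) (simp add: scale_right)
      then show ?thesis
        by (simp add: tensor_coeffs_def h_def mult.assoc)
    qed
  qed
  then show "((\<lambda>(i, j). tensor_coeffs (c1.E f) (c2.E g) (i, j) * \<beta> (\<iota>1 (\<Psi>1 i)) (\<iota>2 (\<Psi>2 j))) has_sum \<beta> f g) UNIV"
    by (simp add: h_def)
qed

context
  fixes F :: "('b1 \<Rightarrow> 'b2 \<Rightarrow> complex) \<Rightarrow> complex" and R f g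
  assumes rep: "tensor_representation F R f g"
begin

lemma coeffs_representation: "coeffs F = (\<lambda>p. \<Sum>\<^sub>\<infinity>r\<in>R. tensor_coeffs (c1.E (f r)) (c2.E (g r)) p)"
  using rep by (auto simp: tensor_representation_def coeffs_def simple_tensor_def bounded_coordinate_form
      coordinate_form_def)

lemma coeffs_l1:
  "weighted_l1 w (coeffs F)" "l1_norm w (coeffs F) \<le> (\<Sum>\<^sub>\<infinity>r\<in>R. norm (f r) * norm (g r))"
proof -
  have "(\<lambda>r. l1_norm w (tensor_coeffs (c1.E (f r)) (c2.E (g r)))) summable_on R"
    using rep by (simp add: tensor_E tensor_representation_def)
  from l1_valued_series(1,2)[OF c12.w_all tensor_E(1) this]
  show "weighted_l1 w (coeffs F)" "l1_norm w (coeffs F) \<le> (\<Sum>\<^sub>\<infinity>r\<in>R. norm (f r) * norm (g r))"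
    by (simp_all add: coeffs_representation tensor_E)
qed

text \<open>The coefficients determine the whole functional: expand \<open>f\<^sub>r\<close> and \<open>g\<^sub>r\<close> in the frames and
  exchange the sums.\<close>

lemma evaluation:
  assumes "bounded_sesquilinear_form \<beta>"
  shows "((\<lambda>p. coeffs F p * \<beta> (\<iota>1 (\<Psi>1 (fst p))) (\<iota>2 (\<Psi>2 (snd p)))) has_sum F \<beta>) UNIV"
proof -
  obtain K where "\<And>i j. cmod (\<beta> (\<iota>1 (\<Psi>1 i)) (\<iota>2 (\<Psi>2 j))) \<le> K * w (i, j)"
    using sesquilinear_expansion(1)[OF assms] by blast
  then have K: "cmod (\<beta> (\<iota>1 (\<Psi>1 (fst p))) (\<iota>2 (\<Psi>2 (snd p)))) \<le> K * w p" for p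
    by (metis prod.collapse)
  have "(\<lambda>r. l1_norm w (tensor_coeffs (c1.E (f r)) (c2.E (g r)))) summable_on R"
    using rep by (simp add: tensor_E tensor_representation_def)
  note series = l1_valued_series(3)[OF c12.w_all tensor_E(1) this K]
  have "(\<Sum>\<^sub>\<infinity>p. tensor_coeffs (c1.E (f r)) (c2.E (g r)) p * \<beta> (\<iota>1 (\<Psi>1 (fst p))) (\<iota>2 (\<Psi>2 (snd p)))) =
      \<beta> (f r) (g r)" for r
    using sesquilinear_expansion(2)[OF assms, of "f r" "g r"]
    by (intro infsumI) (simp add: case_prod_unfold)
  moreover have "F \<beta> = (\<Sum>\<^sub>\<infinity>r\<in>R. \<beta> (f r) (g r))"
    using rep assms by (simp add: tensor_representation_def simple_tensor_def)
  ultimately show ?thesis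
    using series by (simp add: coeffs_representation)
qed

lemma off_forms: "\<not> bounded_sesquilinear_form \<beta> \<Longrightarrow> F \<beta> = 0"
  using rep by (simp add: tensor_representation_def simple_tensor_def)

text \<open>Evaluating at the coordinate forms themselves shows that the coefficients are fixed by the
  cross Gram matrix.\<close>

lemma E_T: "c12.E (T F) = coeffs F"
proof
  fix p
  have "coordinate_form p (\<iota>1 (\<Psi>1 (fst q))) (\<iota>2 (\<Psi>2 (snd q))) = cross_gram \<Psi> p q" for q
    using cross_gram[of "fst p" "snd p" "fst q" "snd q"]
    by (simp add: coordinate_form_def tensor_coeffs_def case_prod_unfold c1.E_\<iota>[OF c1.V_base]
        c2.E_\<iota>[OF c2.V_base] analysis_dual_column)
  then have "((\<lambda>q. cross_gram \<Psi> p q * coeffs F q) has_sum F (coordinate_form p)) UNIV"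
    using evaluation[OF bounded_coordinate_form, of p] by (simp add: mult.commute)
  then show "c12.E (T F) p = coeffs F p"
    using c12.E_J[OF coeffs_l1(1), of p] has_sum_unique unfolding T_def coeffs_def[of F p] by blast
qed

lemma norm_T_le: "norm (T F) \<le> (\<Sum>\<^sub>\<infinity>r\<in>R. norm (f r) * norm (g r))"
  using coeffs_l1(2) c12.E_norm[of "T F"] by (simp add: E_T)

end

lemma proj_tensorE:
  assumes "F \<in> proj_tensor"
  obtains R f g where "tensor_representation F R f g"
  using assms by (auto simp: proj_tensor_def)

lemma T_linear: "clinear_on proj_tensor T"
  unfolding clinear_on_def
proof (intro conjI ballI allI)
  fix F G :: "('b1 \<Rightarrow> 'b2 \<Rightarrow> complex) \<Rightarrow> complex"
  assume "F \<in> proj_tensor" "G \<in> proj_tensor"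
  then have "weighted_l1 w (coeffs F)" "weighted_l1 w (coeffs G)"
    by (auto elim!: proj_tensorE intro: coeffs_l1)
  moreover have "coeffs (F + G) = (\<lambda>p. coeffs F p + coeffs G p)"
    by (simp add: coeffs_def fun_eq_iff)
  ultimately show "T (F + G) = T F + T G"
    unfolding T_def by (simp only: c12.J_add)
next
  fix a and F :: "('b1 \<Rightarrow> 'b2 \<Rightarrow> complex) \<Rightarrow> complex"
  assume "F \<in> proj_tensor"
  then have "weighted_l1 w (coeffs F)"
    by (auto elim!: proj_tensorE intro: coeffs_l1)
  moreover have "coeffs (a *\<^sub>C F) = (\<lambda>p. a * coeffs F p)"
    by (simp add: coeffs_def fun_eq_iff scaleC_fun_def scaleC_complex_def)
  ultimately show "T (a *\<^sub>C F) = a *\<^sub>C T F"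
    unfolding T_def by (simp only: c12.J_scale)
qed

lemma T_inj: "inj_on T proj_tensor"
proof (rule inj_onI)
  fix F G assume "F \<in> proj_tensor" "G \<in> proj_tensor" and eq: "T F = T G"
  then obtain R f g R' f' g' where F: "tensor_representation F R f g"
    and G: "tensor_representation G R' f' g'"
    by (auto elim!: proj_tensorE)
  have "coeffs F = coeffs G"
    using E_T[OF F] E_T[OF G] eq by simp
  show "F = G"
  proof
    fix \<beta>
    show "F \<beta> = G \<beta>"
    proof (cases "bounded_sesquilinear_form \<beta>")
      case True
      show ?thesis
        using evaluation[OF F True] evaluation[OF G True] has_sum_unique
        unfolding \<open>coeffs F = coeffs G\<close> by blast
    next
      case False
      then show ?thesis
        by (simp add: off_forms[OF F] off_forms[OF G])
    qed
  qed
qed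

lemma norm_T_le_proj_norm:
  assumes "F \<in> proj_tensor"
  shows "norm (T F) \<le> proj_norm F"
  unfolding proj_norm_def
proof (rule cInf_greatest)
  show "{\<Sum>\<^sub>\<infinity>r\<in>R. norm (f r) * norm (g r) |R f g. tensor_representation F R f g} \<noteq> {}"
    using assms by (auto simp: proj_tensor_def)
qed (auto intro: norm_T_le)

lemma proj_norm_le:
  assumes "tensor_representation F R f g"
  shows "proj_norm F \<le> (\<Sum>\<^sub>\<infinity>r\<in>R. norm (f r) * norm (g r))"
  unfolding proj_norm_def
proof (rule cInf_lower)
  show "bdd_below {\<Sum>\<^sub>\<infinity>r\<in>R. norm (f r) * norm (g r) |R f g. tensor_representation F R f g}"
    by (rule bdd_belowI[of _ 0]) (auto intro: infsum_nonneg)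
qed (use assms in blast)

text \<open>The frame expansion of \<open>y\<close> in the co-orbit space of the tensor product is a series of simple
  tensors, and its projective cost is at most a constant times the \<open>\<ell>\<^sup>1\<close> norm of its coefficients.\<close>

lemma T_surj:
  "\<exists>F\<in>proj_tensor. T F = y \<and> proj_norm F \<le> M1 * M2 * norm y"
proof -
  define c where "c = c12.E y"
  define R where "R = range (to_nat :: 'i \<times> 'j \<Rightarrow> nat)"
  \<comment> \<open>The coefficient is conjugated because it multiplies the conjugate-homogeneous factor.\<close>
  define f where "f r = (let p = from_nat r in cnj (c p) *\<^sub>C \<iota>1 (\<Psi>1 (fst p)))" for r
  define g where "g r = (let p = from_nat r :: 'i \<times> 'j in \<iota>2 (\<Psi>2 (snd p)))" for r
  define F where "F \<beta> = (\<Sum>\<^sub>\<infinity>r\<in>R. simple_tensor (f r) (g r) \<beta>)" for \<beta>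
  have bij: "bij_betw (to_nat :: 'i \<times> 'j \<Rightarrow> nat) UNIV R"
    by (simp add: R_def bij_betw_def)
  have c: "weighted_l1 w c"
    unfolding c_def by (rule c12.E_l1)
  have cs: "(\<lambda>p. M1 * M2 * (cmod (c p) * w p)) summable_on UNIV"
    using c unfolding weighted_l1_def by (rule summable_on_cmult_right)
  have term_le: "norm (f (to_nat p)) * norm (g (to_nat p)) \<le> M1 * M2 * (cmod (c p) * w p)" for p
  proof -
    have "norm (f (to_nat p)) * norm (g (to_nat p)) =
        cmod (c p) * (norm (\<iota>1 (\<Psi>1 (fst p))) * norm (\<iota>2 (\<Psi>2 (snd p))))"
      by (simp add: f_def g_def norm_scaleC)
    also have "\<dots> \<le> cmod (c p) * ((M1 * w1 (fst p)) * (M2 * w2 (snd p)))"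
      using c1.M_pos c1.w_pos[of "fst p"]
      by (intro mult_left_mono mult_mono c1.norm_\<iota>_base c2.norm_\<iota>_base) auto
    finally show ?thesis
      by (simp add: tensor_weight_def case_prod_unfold mult_ac)
  qed
  have terms: "(\<lambda>p. norm (f (to_nat p)) * norm (g (to_nat (p :: 'i \<times> 'j)))) summable_on UNIV"
    by (rule summable_on_comparison_test[OF cs term_le]) simp
  have rep: "tensor_representation F R f g"
    unfolding tensor_representation_def
    using terms summable_on_reindex_bij_betw[OF bij, of "\<lambda>r. norm (f r) * norm (g r)"]
    by (simp add: F_def fun_eq_iff)
  have "coeffs F p = c p" for p
  proof -
    have "simple_tensor (f (to_nat q)) (g (to_nat q)) (coordinate_form p) = cross_gram \<Psi> p q * c q" for q
      using cross_gram[of "fst p" "snd p" "fst q" "snd q"]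
      by (simp add: simple_tensor_def bounded_coordinate_form f_def g_def coordinate_form_def
          tensor_coeffs_def case_prod_unfold c1.E_scale c1.E_\<iota>[OF c1.V_base]
          c2.E_\<iota>[OF c2.V_base] analysis_dual_column)
    then have "coeffs F p = (\<Sum>\<^sub>\<infinity>q. cross_gram \<Psi> p q * c q)"
      unfolding coeffs_def F_def
      using infsum_reindex_bij_betw[OF bij, of "\<lambda>r. simple_tensor (f r) (g r) (coordinate_form p)"]
      by simp
    then show ?thesis
      using c12.cross_gram_fixes_E[of p y] by (simp add: c_def infsumI)
  qed
  then have "coeffs F = c" by (rule ext)
  then have "T F = y"
    by (simp add: T_def c_def c12.J_E)
  moreover have "proj_norm F \<le> M1 * M2 * norm y"
  proof -
    have "proj_norm F \<le> (\<Sum>\<^sub>\<infinity>r\<in>R. norm (f r) * norm (g r))"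
      by (rule proj_norm_le[OF rep])
    also have "\<dots> = (\<Sum>\<^sub>\<infinity>p. norm (f (to_nat p)) * norm (g (to_nat (p :: 'i \<times> 'j))))"
      using infsum_reindex_bij_betw[OF bij, of "\<lambda>r. norm (f r) * norm (g r)"] by simp
    also have "\<dots> \<le> (\<Sum>\<^sub>\<infinity>p. M1 * M2 * (cmod (c p) * w p))"
      by (rule infsum_mono[OF terms cs term_le])
    also have "\<dots> = M1 * M2 * l1_norm w c"
      using c unfolding weighted_l1_def l1_norm_def by (rule infsum_cmult_right)
    finally show ?thesis
      by (simp add: c_def c12.E_norm)
  qed
  moreover have "F \<in> proj_tensor"
    using rep unfolding proj_tensor_def by blast
  ultimately show ?thesis by blast
qed

lemma T_bij: "bij_betw T proj_tensor UNIV"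
proof -
  have "y \<in> T ` proj_tensor" for y
    using T_surj[of y] by blast
  then show ?thesis
    using T_inj by (auto simp: bij_betw_def)
qed

lemma proj_norm_le_norm_T:
  assumes "F \<in> proj_tensor"
  shows "proj_norm F \<le> M1 * M2 * norm (T F)"
proof -
  obtain G where G: "G \<in> proj_tensor" "T G = T F" "proj_norm G \<le> M1 * M2 * norm (T F)"
    using T_surj[of "T F"] by blast
  then have "G = F"
    using T_inj assms by (simp add: inj_on_eq_iff)
  with G show ?thesis by simp
qed

lemma E_T_simple_tensor: "c12.E (T (simple_tensor f g)) = tensor_coeffs (c1.E f) (c2.E g)"
proof -
  have "tensor_representation (simple_tensor f g) {0} (\<lambda>_. f) (\<lambda>_. g)"
    by (simp add: tensor_representation_def)
  from E_T[OF this] show ?thesis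
    by (simp add: fun_eq_iff coeffs_def simple_tensor_def bounded_coordinate_form coordinate_form_def)
qed

theorem projective_tensor_product:
  "\<exists>T. clinear_on proj_tensor T \<and> bij_betw T proj_tensor UNIV \<and>
    (\<forall>f g. c12.E (T (simple_tensor f g)) = (\<lambda>(i, j). cnj (c1.E f i) * c2.E g j)) \<and>
    (\<exists>a>0. \<exists>b>0. \<forall>F\<in>proj_tensor. a * proj_norm F \<le> norm (T F) \<and> norm (T F) \<le> b * proj_norm F)"
proof (intro exI[of _ T] conjI allI)
  have M: "0 < M1 * M2"
    using c1.M_pos c2.M_pos by simp
  have "1 / (M1 * M2) * proj_norm F \<le> norm (T F)" if "F \<in> proj_tensor" for F
    using proj_norm_le_norm_T[OF that] M by (simp add: field_simps)
  then show "\<exists>a>0. \<exists>b>0. \<forall>F\<in>proj_tensor. a * proj_norm F \<le> norm (T F) \<and> norm (T F) \<le> b * proj_norm F"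
    using M norm_T_le_proj_norm
    by (intro exI[of _ "1 / (M1 * M2)"] conjI exI[of _ 1]) auto
qed (simp_all add: T_linear T_bij E_T_simple_tensor tensor_coeffs_def)

end

lemma localised_frame_bounded_cross_gram:
  assumes "spectral_matrix_algebra \<A> N" and "localised_frame \<A> \<Psi>" and "admissible_weight \<A> w"
  shows "\<exists>A B M. frame \<Psi> A B \<and> bounded_cross_gram \<Psi> w M"
proof -
  obtain A B where fr: "frame \<Psi> A B"
    using assms(2) is_frame_imp_frame[of \<Psi>] unfolding localised_frame_def by blast
  interpret frame \<Psi> A B by fact
  obtain M where "0 < M" "\<And>j. weighted_l1 w (\<lambda>i. cross_gram \<Psi> i j)"
    "\<And>j. l1_norm w (\<lambda>i. cross_gram \<Psi> i j) \<le> M * w j"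
    using cross_gram_column_bound[OF fr assms(1) _ assms(3)] assms(2)
    unfolding localised_frame_def by blast
  then have "bounded_cross_gram \<Psi> w M"
    using assms(3) cross_gram_idempotent
    by unfold_locales (auto simp: admissible_weight_def)
  with fr show ?thesis by blast
qed

lemma extend_by_continuity_cong:
  assumes "\<And>x c. x \<in> V \<Longrightarrow> c \<in> L \<Longrightarrow> N (C x - c) = N' (C x - c)"
  shows "extend_by_continuity V \<iota> L N C = extend_by_continuity V \<iota> L N' C"
proof
  fix f
  have "(c \<in> L \<and> (\<forall>x. range x \<subseteq> V \<longrightarrow> (\<lambda>n. \<iota> (x n)) \<longlonglongrightarrow> f \<longrightarrow> (\<lambda>n. N (C (x n) - c)) \<longlonglongrightarrow> 0)) \<longleftrightarrow>
    (c \<in> L \<and> (\<forall>x. range x \<subseteq> V \<longrightarrow> (\<lambda>n. \<iota> (x n)) \<longlonglongrightarrow> f \<longrightarrow> (\<lambda>n. N' (C (x n) - c)) \<longlonglongrightarrow> 0))" for c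
    using assms by (auto simp: range_subsetD)
  then show "extend_by_continuity V \<iota> L N C f = extend_by_continuity V \<iota> L N' C f"
    unfolding extend_by_continuity_def by simp
qed

theorem theorem4p2:
  fixes \<Psi>1 :: "'i::countable \<Rightarrow> 'h1::complex_hilbert"
    and \<Psi>2 :: "'j::countable \<Rightarrow> 'h2::complex_hilbert"
    and \<A>1 :: "('i \<Rightarrow> 'i \<Rightarrow> complex) set" and N1 :: "('i \<Rightarrow> 'i \<Rightarrow> complex) \<Rightarrow> real"
    and \<A>2 :: "('j \<Rightarrow> 'j \<Rightarrow> complex) set" and N2 :: "('j \<Rightarrow> 'j \<Rightarrow> complex) \<Rightarrow> real"
    and w1 :: "'i \<Rightarrow> real" and w2 :: "'j \<Rightarrow> real"
    and \<tau> :: "('h1 \<Rightarrow> 'h2) \<Rightarrow> 'h12::complex_hilbert"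
    and \<iota>1 :: "'h1 \<Rightarrow> 'b1::complex_banach"
    and \<iota>2 :: "'h2 \<Rightarrow> 'b2::complex_banach"
    and \<iota>12 :: "'h12 \<Rightarrow> 'b12::complex_banach"
  assumes "separable_space (euclidean :: 'h1 topology)"
    and "separable_space (euclidean :: 'h2 topology)"
    and "spectral_matrix_algebra \<A>1 N1" and "spectral_matrix_algebra \<A>2 N2"
    and "localised_frame \<A>1 \<Psi>1" and "localised_frame \<A>2 \<Psi>2"
    and "admissible_weight \<A>1 w1" and "admissible_weight \<A>2 w2"
    and "is_hilbert_tensor_product \<tau>"
    and "is_coorbit1 \<Psi>1 w1 \<iota>1" and "is_coorbit1 \<Psi>2 w2 \<iota>2"
    and "is_coorbit11 (tensor_family \<tau> \<Psi>1 \<Psi>2) w1 w2 \<iota>12"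
  shows "\<exists>T :: (('b1 \<Rightarrow> 'b2 \<Rightarrow> complex) \<Rightarrow> complex) \<Rightarrow> 'b12.
    clinear_on proj_tensor T \<and> bij_betw T proj_tensor UNIV \<and>
    (\<forall>f g. coorbit11_coeffs (tensor_family \<tau> \<Psi>1 \<Psi>2) w1 w2 \<iota>12 (T (simple_tensor f g)) =
       (\<lambda>(i, j). cnj (coorbit1_coeffs \<Psi>1 w1 \<iota>1 f i) * coorbit1_coeffs \<Psi>2 w2 \<iota>2 g j)) \<and>
    (\<exists>a>0. \<exists>b>0. \<forall>F\<in>proj_tensor. a * proj_norm F \<le> norm (T F) \<and> norm (T F) \<le> b * proj_norm F)"
proof -
  note w1 = assms(7)[unfolded admissible_weight_def, THEN conjunct1]
    and w2 = assms(8)[unfolded admissible_weight_def, THEN conjunct1]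
  obtain A1 B1 M1 where 1: "frame \<Psi>1 A1 B1" "bounded_cross_gram \<Psi>1 w1 M1"
    using localised_frame_bounded_cross_gram[OF assms(3,5,7)] by blast
  obtain A2 B2 M2 where 2: "frame \<Psi>2 A2 B2" "bounded_cross_gram \<Psi>2 w2 M2"
    using localised_frame_bounded_cross_gram[OF assms(4,6,8)] by blast
  interpret b1: bounded_cross_gram \<Psi>1 w1 M1 by (rule 1)
  interpret b2: bounded_cross_gram \<Psi>2 w2 M2 by (rule 2)
  interpret c1: coorbit \<Psi>1 w1 M1 \<iota>1
    by unfold_locales (use assms(10) in \<open>simp add: is_coorbit1_def lpw_1[OF w1]\<close>)
  interpret c2: coorbit \<Psi>2 w2 M2 \<iota>2
    by unfold_locales (use assms(11) in \<open>simp add: is_coorbit1_def lpw_1[OF w2]\<close>)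
  interpret ft: frame_tensor "\<lambda>f g. \<tau> (rank_one f g)" \<Psi>1 A1 B1 \<Psi>2 A2 B2
    by (intro frame_tensor.intro 1 2 hilbert_tensor_rank_one[OF assms(9)])
  let ?\<Psi> = "tensor_family \<tau> \<Psi>1 \<Psi>2"
  let ?w = "tensor_weight w1 w2"
  have \<Psi>: "ft.\<Psi>12 = ?\<Psi>"
    by (simp add: ft.\<Psi>12_def tensor_family_def)
  note cross = ft.cross_gram_tensor[unfolded \<Psi>]
  have column: "(\<lambda>p. cross_gram ?\<Psi> p (k, l)) =
      tensor_coeffs (\<lambda>i. cross_gram \<Psi>1 i k) (\<lambda>j. cross_gram \<Psi>2 j l)" for k l
    by (auto simp: cross tensor_coeffs_def)
  interpret b: bounded_cross_gram ?\<Psi> ?w "M1 * M2"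
  proof
    show "\<forall>p. 0 < ?w p"
      by (rule tensor_weight_pos[OF w1 w2])
    show "0 < M1 * M2"
      using b1.M_pos b2.M_pos by simp
    note l1 = tensor_coeffs_l1[OF w1 w2 b1.column_l1 b2.column_l1]
    show "weighted_l1 ?w (\<lambda>p. cross_gram ?\<Psi> p q)" for q
      by (cases q) (simp only: column l1)
    show "l1_norm ?w (\<lambda>p. cross_gram ?\<Psi> p q) \<le> M1 * M2 * ?w q" for q
    proof (cases q)
      case (Pair k l)
      have "l1_norm ?w (\<lambda>p. cross_gram ?\<Psi> p q) \<le> (M1 * w1 k) * (M2 * w2 l)"
        unfolding Pair column l1
        using b1.M_pos b1.w_pos[of k]
        by (intro mult_mono b1.column_bound b2.column_bound l1_norm_nonneg[OF w2]) simp
      then show ?thesis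
        by (simp add: Pair tensor_weight_def mult_ac)
    qed
    show "((\<lambda>r. cross_gram ?\<Psi> p r * cross_gram ?\<Psi> r q) has_sum cross_gram ?\<Psi> p q) UNIV" for p q
    proof -
      obtain i j where p: "p = (i, j)" by force
      obtain k l where q: "q = (k, l)" by force
      have "((\<lambda>r. cnj (cross_gram \<Psi>1 i r * cross_gram \<Psi>1 r k)) has_sum cnj (cross_gram \<Psi>1 i k)) UNIV"
        by (simp only: has_sum_cnj_iff b1.idempotent)
      from has_sum_times_complex[OF this b2.idempotent[of j l]]
      have "((\<lambda>(a, b). cnj (cross_gram \<Psi>1 i a * cross_gram \<Psi>1 a k) * (cross_gram \<Psi>2 j b * cross_gram \<Psi>2 b l))
          has_sum cross_gram ?\<Psi> p q) UNIV"
        by (simp only: p q cross)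
      moreover have "(\<lambda>r. cross_gram ?\<Psi> p r * cross_gram ?\<Psi> r q) =
          (\<lambda>(a, b). cnj (cross_gram \<Psi>1 i a * cross_gram \<Psi>1 a k) * (cross_gram \<Psi>2 j b * cross_gram \<Psi>2 b l))"
        by (auto simp: fun_eq_iff p q cross)
      ultimately show ?thesis by simp
    qed
  qed
  interpret c12: coorbit ?\<Psi> ?w "M1 * M2" \<iota>12
  proof unfold_locales
    have "l11w_norm w1 w2 (b.C x) = l1_norm ?w (b.C x)" if "x \<in> b.V" for x
      by (rule l11w_eq(2)[OF w1 w2 b.C_l1[OF that]])
    then show "is_completion b.V (\<lambda>F. l1_norm ?w (b.C F)) \<iota>12"
      using assms(12) by (simp add: is_coorbit11_def is_completion_def)
  qed
  interpret coorbit_tensor \<Psi>1 w1 M1 \<iota>1 \<Psi>2 w2 M2 \<iota>2 ?\<Psi> "M1 * M2" \<iota>12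
    by unfold_locales (rule cross)
  have E1: "coorbit1_coeffs \<Psi>1 w1 \<iota>1 = c1.E" and E2: "coorbit1_coeffs \<Psi>2 w2 \<iota>2 = c2.E"
    by (simp_all add: coorbit1_coeffs_def c1.E_def c2.E_def lpw_1[OF w1] lpw_1[OF w2])
  have E12: "coorbit11_coeffs ?\<Psi> w1 w2 \<iota>12 = c12.E"
    unfolding coorbit11_coeffs_def c12.E_def l11w_eq(1)[OF w1 w2]
    by (rule extend_by_continuity_cong)
      (auto intro!: l11w_eq(2)[OF w1 w2] weighted_l1_diff(1)[OF b.w_all] b.C_l1)
  show ?thesis
    unfolding E1 E2 E12 by (rule projective_tensor_product)
qed

end
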